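(* Let $M$ be $\mathbb{R}^2$ or the mass shell $V^{+,m}$ with $m>0$, let $\varrho$ be a unitary representation of the braid group $B_n$ on a finite dimensional Hilbert space $F$, and let the hermitean vector bundles $\tilde{\mathcal F}\to {}^nM$ and $\mathcal F^{\approx}\to M^{\times n}\setminus D_n$, the bundle map $\mathrm{Pr}:\mathcal F^{\approx}\to\tilde{\mathcal F}$ and the operators $U(\pi)$ $(\pi\in S_n)$ and $P$ be as defined in the context. Then via the map $\frac{1}{n!}\,\mathrm{Pr}^\ast$ the space $L^2(\tilde{\mathcal F})$ is unitarily equivalent to the linear subspace $$L^2_{inv}(\mathcal F^{\approx})=\mathrm{Range}\,P$$ of $L^2(\mathcal F^{\approx})$ consisting of the square integrable sections $\eta$ of $\mathcal F^{\approx}$ which satisfy $\eta=U(\pi)\eta$ (for all $\pi\in S_n$) at almost all $\mathbf p\in M^{\times n}\setminus D_n$.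
   Context: $V^{+,m}=\{p=(p^0,p^1,p^2)\in\mathbb R^3: p^0=((p^1)^2+(p^2)^2+m^2)^{1/2}\}\cong\mathbb R^2$. $D_n\subset M^{\times n}$ is the set of $(p_1,\dots,p_n)$ with $p_i=p_j$ for some $i\neq j$. The symmetric group $S_n$ acts on the right on $M^{\times n}\setminus D_n$ by $(\mathbf p\pi)_i=p_{\pi(i)}$, and ${}^nM=(M^{\times n}\setminus D_n)/S_n$ with projection $\mathrm{pr}$. $B_n=\pi_1({}^nM)$ is the braid group, and ${}^n\tilde M$ is the universal covering space of ${}^nM$, a principal (right) $B_n$-bundle over ${}^nM$ with projection $\widetilde{\mathrm{pr}}$. There is a canonical homomorphism $\tau:B_n\to S_n$ (onto) whose kernel is the pure braid group $PB_n$. ${}^n\tilde M$ is also the universal covering space of $M^{\times n}\setminus D_n$, being a principal $PB_n$-bundle over it with projection $\widetilde{\widetilde{\mathrm{pr}}}$, where $\mathrm{pr}\circ\widetilde{\widetilde{\mathrm{pr}}}=\widetilde{\mathrm{pr}}$. $B_n$ acts on ${}^n\tilde M\times F$ on the right by $b:(\tilde{\mathbf p},f)\mapsto(\tilde{\mathbf p}\cdot b,\varrho(b^{-1})f)$. $\tilde{\mathcal F}={}^n\tilde M\times_{\varrho,B_n}F$ is the orbit space under $B_n$, a hermitean vector bundle over ${}^nM$; $\mathcal F^{\approx}={}^n\tilde M\times_{\varrho,PB_n}F$ is the orbit space under the restricted action of $PB_n$, a hermitean vector bundle over $M^{\times n}\setminus D_n$. The orbits of $(\tilde{\mathbf p},f)$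 are denoted $\tilde\chi(\tilde{\mathbf p},f)\in\tilde{\mathcal F}$ and $\chi^{\approx}(\tilde{\mathbf p},f)\in\mathcal F^{\approx}$; the fibre scalar products are $\langle\tilde\chi(\tilde{\mathbf p},f),\tilde\chi(\tilde{\mathbf p},f')\rangle=\langle f,f'\rangle_F$ and likewise for $\chi^{\approx}$. $L^2(\tilde{\mathcal F})$ is the Hilbert space completion of the space of smooth sections of $\tilde{\mathcal F}$ having finite norm with respect to the scalar product $\langle\xi,\xi'\rangle=\int_{{}^nM}\langle\xi(\mathbf p),\xi'(\mathbf p)\rangle_{\mathbf p}\,d\mu(\mathbf p)$, where $d\mu(\mathbf p)$ is the canonical volume form on ${}^nM$ inherited from Lebesgue measure on $\mathbb R^2$ if $M=\mathbb R^2$, and from the Lorentz invariant measure $\frac12((p^1)^2+(p^2)^2+m^2)^{-1/2}dp^1dp^2$ if $M=V^{+,m}$. $L^2(\mathcal F^{\approx})$ is the corresponding Hilbert space of square integrable sections of $\mathcal F^{\approx}$ over $M^{\times n}\setminus D_n$. $\mathrm{Pr}:\mathcal F^{\approx}\to\tilde{\mathcal F}$ associates to each $PB_n$ orbit its $B_n$ orbit, i.e. sends $\chi^{\approx}(\tilde{\mathbf p},f)$ to $\tilde\chi(\tilde{\mathbf p},f)$; it is a vector bundle map lifting $\mathrm{pr}$ which is an isomorphism on fibres, so there is a linear pullback $\mathrm{Pr}^\ast$ from smooth sections of $\tilde{\mathcal F}$ to smooth sections of $\mathcal F^{\approx}$, characterized by $\mathrm{Pr}((\mathrm{Pr}^\ast\xi)(\mathbf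 p))=\xi(\mathrm{pr}(\mathbf p))$; the map $\frac{1}{n!}\mathrm{Pr}^\ast$ is extended to $L^2(\tilde{\mathcal F})$. For $\pi\in S_n$ define $S(\pi)$ on $\mathcal F^{\approx}$ by $S(\pi)\chi^{\approx}(\tilde{\mathbf p},f)=\chi^{\approx}(\tilde{\mathbf p}\cdot b(\pi),\varrho(b(\pi))^{-1}f)$, where $b(\pi)\in B_n$ is any element with $\tau(b(\pi))=\pi$ (the result does not depend on the choice). On sections set $(U(\pi)\eta)(\mathbf p)=S(\pi)^{-1}\eta(\mathbf p\pi)$ and $P\eta=\frac1{n!}\sum_{\pi\in S_n}U(\pi)\eta$; $P$ extends to an orthogonal projection on $L^2(\mathcal F^{\approx})$. $L^2_{inv}(\mathcal F^{\approx})$ is the closed subspace of $L^2(\mathcal F^{\approx})$ spanned by the smooth sections $\eta$ with $U(\pi)\eta=\eta$ for all $\pi\in S_n$.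
   Formalization: The map (1/n!)Pr* is not isometric for n ≥ 2 (it scales squared norms by 1/n! for the inherited volume form); the statement proved is that √(n!)·(1/n!)Pr* is unitary onto the invariant subspace. F is taken as C^k with k ≥ 1, and n ≥ 1. *)

theory Defs
  imports "HOL-Analysis.Analysis" "HOL-Algebra.Group"
begin

section \<open>One-particle momentum spaces\<close>

text \<open>A momentum space \<open>M\<close> is a subset of a Euclidean space with a global smooth parametrisation by
  \<open>\<real>\<^sup>2\<close>, which fixes its smooth structure, and a measure.\<close>

record 'a momentum_space =
  points :: "'a set"
  param :: "real^2 \<Rightarrow> 'a"
  vol :: "'a measure"

definition plane :: "(real^2) momentum_space" where
  "plane = \<lparr>points = UNIV, param = (\<lambda>q. q), vol = lborel\<rparr>"

text \<open>The components of \<open>p :: real^3\<close> are indexed by \<open>0, 1, 2\<close> (in the index type, \<open>0 = 3\<close>).\<close>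

definition shell_param :: "real \<Rightarrow> real^2 \<Rightarrow> real^3" where
  "shell_param m q =
     (\<chi> i. if i = 0 then sqrt ((q$1)\<^sup>2 + (q$2)\<^sup>2 + m\<^sup>2) else if i = 1 then q$1 else q$2)"

definition mass_shell :: "real \<Rightarrow> (real^3) momentum_space" where
  "mass_shell m =
     \<lparr>points = {p. p$0 = sqrt ((p$1)\<^sup>2 + (p$2)\<^sup>2 + m\<^sup>2)},
      param = shell_param m,
      vol = distr (density lborel (\<lambda>q. ennreal (1 / (2 * sqrt ((q$1)\<^sup>2 + (q$2)\<^sup>2 + m\<^sup>2)))))
              borel (shell_param m)\<rparr>"


section \<open>Configurations of distinct points, with and without ordering\<close>

text \<open>The number of particles is \<open>n = CARD('n)\<close>; tuples and permutations are indexed by \<open>'n\<close>.\<close>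

definition permute :: "'a^'n \<Rightarrow> ('n \<Rightarrow> 'n) \<Rightarrow> 'a^'n" where
  "permute p \<pi> = (\<chi> i. p $ \<pi> i)"

definition perms :: "('n \<Rightarrow> 'n) set" where
  "perms = {\<pi>. bij \<pi>}"

definition same_orbit :: "'a^'n \<Rightarrow> 'a^'n \<Rightarrow> bool" where
  "same_orbit p q \<longleftrightarrow> (\<exists>\<pi>\<in>perms. q = permute p \<pi>)"

lemma equivp_same_orbit: "equivp (same_orbit :: 'a^'n \<Rightarrow> 'a^'n \<Rightarrow> bool)"
proof (rule equivpI)
  show "reflp (same_orbit :: 'a^'n \<Rightarrow> 'a^'n \<Rightarrow> bool)"
    unfolding reflp_def same_orbit_def perms_def permute_def
    by (intro allI bexI[of _ id]) auto
  show "symp (same_orbit :: 'a^'n \<Rightarrow> 'a^'n \<Rightarrow> bool)"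
  proof (rule sympI)
    fix p q :: "'a^'n" assume "same_orbit p q"
    then obtain \<pi> where a: "bij \<pi>" "q = permute p \<pi>"
      unfolding same_orbit_def perms_def by blast
    then have "p = permute q (inv_into UNIV \<pi>)"
      by (simp add: permute_def vec_eq_iff bij_is_surj surj_f_inv_f)
    then show "same_orbit q p"
      using bij_imp_bij_inv[OF a(1)] unfolding same_orbit_def perms_def by blast
  qed
  show "transp (same_orbit :: 'a^'n \<Rightarrow> 'a^'n \<Rightarrow> bool)"
  proof (rule transpI)
    fix p q r :: "'a^'n" assume "same_orbit p q" "same_orbit q r"
    then obtain \<pi> \<sigma> where a: "bij \<pi>" "q = permute p \<pi>" "bij \<sigma>" "r = permute q \<sigma>"
      unfolding same_orbit_def perms_def by blast
    then have "r = permute p (\<pi> \<circ> \<sigma>)"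
      by (simp add: permute_def vec_eq_iff)
    then show "same_orbit p r"
      using bij_comp[OF a(3,1)] unfolding same_orbit_def perms_def by blast
  qed
qed

quotient_type ('a, 'n) sym_power = "'a^'n" / same_orbit
  by (rule equivp_same_orbit)

definition pr :: "'a^'n \<Rightarrow> ('a, 'n) sym_power" where
  "pr = abs_sym_power"

instantiation sym_power :: (topological_space, finite) topological_space
begin

definition open_sym_power :: "('a, 'b) sym_power set \<Rightarrow> bool" where
  "open_sym_power U \<longleftrightarrow> open (pr -` U)"

instance
proof
  show "open (UNIV :: ('a, 'b) sym_power set)"
    by (simp add: open_sym_power_def)
  show "open (S \<inter> T)" if "open S" "open T" for S T :: "('a, 'b) sym_power set"
    using that by (simp add: open_sym_power_def vimage_Int open_Int)
  show "open (\<Union>K)" if "\<forall>S\<in>K. open S" for K :: "('a, 'b) sym_power set set"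
    using that by (simp add: open_sym_power_def vimage_Union open_UN)
qed

end

text \<open>\<open>conf M\<close> is \<open>M\<^sup>n\<close> without the set \<open>D\<^sub>n\<close> of tuples with coincident entries, and \<open>nconf M\<close>
  is its quotient by \<open>S\<^sub>n\<close>.\<close>

definition conf :: "'a momentum_space \<Rightarrow> ('a^'n) set" where
  "conf M = {p. (\<forall>i. p$i \<in> points M) \<and> \<not> (\<exists>i j. i \<noteq> j \<and> p$i = p$j)}"

definition nconf :: "'a momentum_space \<Rightarrow> ('a, 'n::finite) sym_power set" where
  "nconf M = pr ` conf M"

definition conf_measure :: "('a::euclidean_space) momentum_space \<Rightarrow> ('a^'n) measure" where
  "conf_measure M =
     restrict_space (distr (\<Pi>\<^sub>M i\<in>(UNIV::'n set). vol M) borel (\<lambda>p. \<chi> i. p i)) (conf M)"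

text \<open>The projection \<open>pr\<close> is an \<open>n!\<close>-sheeted covering on \<open>conf M\<close>, so the factor \<open>1/n!\<close> makes it
  locally measure preserving: this is the volume form on the quotient whose pullback along \<open>pr\<close> is
  the volume form of \<open>M\<^sup>n\<close>.\<close>

definition nconf_measure :: "('a::euclidean_space) momentum_space \<Rightarrow> ('a, 'n::finite) sym_power measure" where
  "nconf_measure M =
     scale_measure (ennreal (1 / fact CARD('n)))
       (distr (conf_measure M) (restrict_space borel (nconf M)) pr)"


section \<open>Smooth functions\<close>

primrec Ck_on :: "nat \<Rightarrow> ('a::real_normed_vector) set \<Rightarrow> ('a \<Rightarrow> 'b::real_normed_vector) \<Rightarrow> bool" where
  "Ck_on 0 U f \<longleftrightarrow> continuous_on U f"
| "Ck_on (Suc k) U f \<longleftrightarrow>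
     f differentiable_on U \<and> (\<forall>v. Ck_on k U (\<lambda>x. frechet_derivative f (at x) v))"

definition smooth_on :: "('a::real_normed_vector) set \<Rightarrow> ('a \<Rightarrow> 'b::real_normed_vector) \<Rightarrow> bool" where
  "smooth_on U f \<longleftrightarrow> (\<forall>k. Ck_on k U f)"

definition smooth_on_conf ::
    "'a momentum_space \<Rightarrow> ('a^'n) set \<Rightarrow> ('a^'n \<Rightarrow> 'b::real_normed_vector) \<Rightarrow> bool" where
  "smooth_on_conf M U f \<longleftrightarrow>
     smooth_on {q. (\<chi> i. param M (q$i)) \<in> U} (\<lambda>q. f (\<chi> i. param M (q$i)))"

definition smooth_on_nconf ::
    "'a momentum_space \<Rightarrow> ('a, 'n::finite) sym_power set \<Rightarrow>
     (('a, 'n) sym_power \<Rightarrow> 'b::real_normed_vector) \<Rightarrow> bool" where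
  "smooth_on_nconf M U f \<longleftrightarrow> smooth_on_conf M (conf M \<inter> pr -` U) (\<lambda>p. f (pr p))"


section \<open>The fundamental group, and unitary operators on the fibre\<close>

definition loop_class :: "('x::topological_space) set \<Rightarrow> (real \<Rightarrow> 'x) \<Rightarrow> (real \<Rightarrow> 'x) set" where
  "loop_class X g = {h. homotopic_paths X g h}"

definition loops :: "('x::topological_space) set \<Rightarrow> 'x \<Rightarrow> (real \<Rightarrow> 'x) set" where
  "loops X x0 = {g. path g \<and> path_image g \<subseteq> X \<and> pathstart g = x0 \<and> pathfinish g = x0}"

definition fundamental_group :: "('x::topological_space) set \<Rightarrow> 'x \<Rightarrow> (real \<Rightarrow> 'x) set monoid" where
  "fundamental_group X x0 =
     \<lparr>carrier = loop_class X ` loops X x0,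
      mult = (\<lambda>a b. \<Union>g\<in>a. \<Union>h\<in>b. loop_class X (g +++ h)),
      one = loop_class X (\<lambda>_. x0)\<rparr>"

definition hinner :: "complex^'k \<Rightarrow> complex^'k \<Rightarrow> complex" where
  "hinner f g = (\<Sum>i\<in>UNIV. cnj (f$i) * g$i)"

definition unitary_group :: "(complex^'k \<Rightarrow> complex^'k) monoid" where
  "unitary_group =
     \<lparr>carrier = {A. Vector_Spaces.linear (*s) (*s) A \<and> surj A \<and>
                    (\<forall>f g. hinner (A f) (A g) = hinner f g)},
      mult = (\<circ>),
      one = id\<rparr>"


section \<open>The universal covering space and the representation\<close>

record ('a, 'n, 'e, 'k) braid_data =
  mom :: "'a momentum_space"
  cover :: "'e set"
  cover_pt :: "'e"
  prt :: "'e \<Rightarrow> ('a, 'n) sym_power"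
  prtt :: "'e \<Rightarrow> 'a^'n"
  act :: "'e \<Rightarrow> (real \<Rightarrow> ('a, 'n) sym_power) set \<Rightarrow> 'e"
  rep :: "(real \<Rightarrow> ('a, 'n) sym_power) set \<Rightarrow> complex^'k \<Rightarrow> complex^'k"

type_synonym ('a, 'n) braid = "(real \<Rightarrow> ('a, 'n) sym_power) set"

definition braid_group ::
    "('a::euclidean_space, 'n::finite, 'e, 'k::finite) braid_data \<Rightarrow> ('a, 'n) braid monoid" where
  "braid_group D = fundamental_group (nconf (mom D)) (prt D (cover_pt D))"

text \<open>The last condition on the action says that \<open>braid_group D\<close> acts as the fundamental group does
  canonically. Lifts have to \<^emph>\<open>end\<close> at the base point: since \<open>g +++ h\<close> traverses \<open>g\<close> first, this is
  the convention for which the canonical action is a right action.\<close>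

definition universal_cover ::
    "('a::euclidean_space, 'n::finite, 'e::topological_space, 'k::finite) braid_data \<Rightarrow> bool" where
  "universal_cover D \<longleftrightarrow>
     simply_connected (cover D) \<and> cover_pt D \<in> cover D \<and>
     covering_space (cover D) (prt D) (nconf (mom D)) \<and>
     covering_space (cover D) (prtt D) (conf (mom D)) \<and>
     (\<forall>e\<in>cover D. pr (prtt D e) = prt D e)"

definition principal_action ::
    "('a::euclidean_space, 'n::finite, 'e::topological_space, 'k::finite) braid_data \<Rightarrow> bool" where
  "principal_action D \<longleftrightarrow>
     (\<forall>e\<in>cover D. act D e \<one>\<^bsub>braid_group D\<^esub> = e) \<and>
     (\<forall>e\<in>cover D. \<forall>b\<in>carrier (braid_group D). \<forall>c\<in>carrier (braid_group D).
        act D e (b \<otimes>\<^bsub>braid_group D\<^esub> c) = act D (act D e b) c) \<and>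
     (\<forall>b\<in>carrier (braid_group D).
        (\<lambda>e. act D e b) ` cover D \<subseteq> cover D \<and> continuous_on (cover D) (\<lambda>e. act D e b)) \<and>
     (\<forall>e\<in>cover D. bij_betw (act D e) (carrier (braid_group D)) {e'\<in>cover D. prt D e' = prt D e}) \<and>
     (\<forall>g\<in>loops (nconf (mom D)) (prt D (cover_pt D)). \<exists>h.
        path h \<and> path_image h \<subseteq> cover D \<and> (\<forall>t\<in>{0..1}. prt D (h t) = g t) \<and>
        pathstart h = act D (cover_pt D) (loop_class (nconf (mom D)) g) \<and>
        pathfinish h = cover_pt D)"

definition braid_setup ::
    "('a::euclidean_space, 'n::finite, 'e::topological_space, 'k::finite) braid_data \<Rightarrow> bool" where
  "braid_setup D \<longleftrightarrow>
     universal_cover D \<and> principal_action D \<and> rep D \<in> hom (braid_group D) unitary_group"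

text \<open>The permutation of a braid, obtained by lifting the loop from \<open>nconf\<close> to \<open>conf\<close>; again lifts
  end at the base point.\<close>

definition tau ::
    "('a::euclidean_space, 'n::finite, 'e, 'k::finite) braid_data \<Rightarrow> ('a, 'n) braid \<Rightarrow> 'n \<Rightarrow> 'n" where
  "tau D b = (THE \<pi>. \<pi> \<in> perms \<and>
     (\<exists>g. path g \<and> path_image g \<subseteq> conf (mom D) \<and> pr \<circ> g \<in> b \<and>
          pathfinish g = prtt D (cover_pt D) \<and>
          pathstart g = permute (prtt D (cover_pt D)) \<pi>))"

definition pure_braids ::
    "('a::euclidean_space, 'n::finite, 'e, 'k::finite) braid_data \<Rightarrow> ('a, 'n) braid set" where
  "pure_braids D = {b\<in>carrier (braid_group D). tau D b = id}"


section \<open>Hermitean vector bundles and their spaces of square integrable sections\<close>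

text \<open>The points of the base are \<open>space (base B)\<close>. Smooth and measurable sections are part of the
  data; sections are functions on the whole type whose values matter on the base only.\<close>

record ('x, 'v) hbundle =
  base :: "'x measure"
  fadd :: "'v \<Rightarrow> 'v \<Rightarrow> 'v"
  fscale :: "complex \<Rightarrow> 'v \<Rightarrow> 'v"
  finner :: "'v \<Rightarrow> 'v \<Rightarrow> complex"
  smooth_sections :: "('x \<Rightarrow> 'v) set"
  measurable_sections :: "('x \<Rightarrow> 'v) set"

definition sq_integrable :: "('x, 'v) hbundle \<Rightarrow> ('x \<Rightarrow> 'v) set" where
  "sq_integrable B = {\<eta>\<in>measurable_sections B. integrable (base B) (\<lambda>x. Re (finner B (\<eta> x) (\<eta> x)))}"

definition dist_sq :: "('x, 'v) hbundle \<Rightarrow> ('x \<Rightarrow> 'v) \<Rightarrow> ('x \<Rightarrow> 'v) \<Rightarrow> real" where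
  "dist_sq B \<eta> \<theta> =
     (LINT x|base B. Re (finner B (fadd B (\<eta> x) (fscale B (-1) (\<theta> x)))
                                  (fadd B (\<eta> x) (fscale B (-1) (\<theta> x)))))"

definition ae_class :: "('x, 'v) hbundle \<Rightarrow> ('x \<Rightarrow> 'v) \<Rightarrow> ('x \<Rightarrow> 'v) set" where
  "ae_class B \<eta> = {\<theta>\<in>sq_integrable B. AE x in base B. \<theta> x = \<eta> x}"

text \<open>The closure of a set of sections in the (complete) space of classes of measurable square
  integrable sections.\<close>

definition L2_closure :: "('x, 'v) hbundle \<Rightarrow> ('x \<Rightarrow> 'v) set \<Rightarrow> ('x \<Rightarrow> 'v) set set" where
  "L2_closure B S =
     {ae_class B \<eta> |\<eta>. \<eta> \<in> sq_integrable B \<and>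
        (\<exists>\<sigma>::nat \<Rightarrow> 'x \<Rightarrow> 'v. (\<forall>k. \<sigma> k \<in> S) \<and> (\<lambda>k. dist_sq B (\<sigma> k) \<eta>) \<longlonglongrightarrow> 0)}"

text \<open>The completion of the space of smooth sections of finite norm.\<close>

definition L2 :: "('x, 'v) hbundle \<Rightarrow> ('x \<Rightarrow> 'v) set set" where
  "L2 B = L2_closure B (smooth_sections B \<inter> sq_integrable B)"

definition L2_add :: "('x, 'v) hbundle \<Rightarrow> ('x \<Rightarrow> 'v) set \<Rightarrow> ('x \<Rightarrow> 'v) set \<Rightarrow> ('x \<Rightarrow> 'v) set" where
  "L2_add B X Y = (\<Union>\<eta>\<in>X. \<Union>\<theta>\<in>Y. ae_class B (\<lambda>x. fadd B (\<eta> x) (\<theta> x)))"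

definition L2_scale :: "('x, 'v) hbundle \<Rightarrow> complex \<Rightarrow> ('x \<Rightarrow> 'v) set \<Rightarrow> ('x \<Rightarrow> 'v) set" where
  "L2_scale B c X = (\<Union>\<eta>\<in>X. ae_class B (\<lambda>x. fscale B c (\<eta> x)))"

definition L2_inner :: "('x, 'v) hbundle \<Rightarrow> ('x \<Rightarrow> 'v) set \<Rightarrow> ('x \<Rightarrow> 'v) set \<Rightarrow> complex" where
  "L2_inner B X Y = (THE c. \<exists>\<eta>\<in>X. \<exists>\<theta>\<in>Y. c = (LINT x|base B. finner B (\<eta> x) (\<theta> x)))"

text \<open>The operator on classes induced by an operator on sections with values in the sections
  of \<open>B\<close>.\<close>

definition induced :: "('y, 'w) hbundle \<Rightarrow> (('x \<Rightarrow> 'v) \<Rightarrow> 'y \<Rightarrow> 'w) \<Rightarrow> ('x \<Rightarrow> 'v) set \<Rightarrow> ('y \<Rightarrow> 'w) set" where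
  "induced B T X = (\<Union>\<eta>\<in>X. ae_class B (T \<eta>))"

definition linear_subspace :: "('x, 'v) hbundle \<Rightarrow> ('x \<Rightarrow> 'v) set set \<Rightarrow> bool" where
  "linear_subspace B W \<longleftrightarrow>
     W \<subseteq> L2 B \<and> W \<noteq> {} \<and> (\<forall>X\<in>W. \<forall>Y\<in>W. L2_add B X Y \<in> W) \<and> (\<forall>c. \<forall>X\<in>W. L2_scale B c X \<in> W)"

definition unitary_onto ::
    "('x, 'v) hbundle \<Rightarrow> ('y, 'w) hbundle \<Rightarrow> ('y \<Rightarrow> 'w) set set \<Rightarrow> (('x \<Rightarrow> 'v) set \<Rightarrow> ('y \<Rightarrow> 'w) set) \<Rightarrow> bool" where
  "unitary_onto B B' W T \<longleftrightarrow>
     bij_betw T (L2 B) W \<and>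
     (\<forall>X\<in>L2 B. \<forall>Y\<in>L2 B. T (L2_add B X Y) = L2_add B' (T X) (T Y)) \<and>
     (\<forall>c. \<forall>X\<in>L2 B. T (L2_scale B c X) = L2_scale B' c (T X)) \<and>
     (\<forall>X\<in>L2 B. \<forall>Y\<in>L2 B. L2_inner B' (T X) (T Y) = L2_inner B X Y)"


section \<open>Associated bundles\<close>

text \<open>\<open>chi D H e f\<close> is the orbit of \<open>(e, f)\<close> under the subgroup \<open>H\<close> of the braid group. It is
  \<open>\<chi>\<^bsup>~\<^esup>(e, f)\<close> if \<open>H\<close> is the whole group and \<open>\<chi>\<^bsup>~~\<^esup>(e, f)\<close> if \<open>H\<close> consists of the pure braids.\<close>

definition chi ::
    "('a::euclidean_space, 'n::finite, 'e, 'k::finite) braid_data \<Rightarrow> ('a, 'n) braid set \<Rightarrow>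
     'e \<Rightarrow> complex^'k \<Rightarrow> ('e \<times> (complex^'k)) set" where
  "chi D H e f = (\<lambda>b. (act D e b, rep D (inv\<^bsub>braid_group D\<^esub> b) f)) ` H"

text \<open>Sections that in the local trivialisation given by a continuous local section \<open>s\<close> of the
  covering \<open>q\<close> have a coordinate function \<open>f\<close> of the given regularity. The trivialisations over
  different \<open>s\<close> differ by locally constant elements of \<open>H\<close>.\<close>

definition local_sections ::
    "('a::euclidean_space, 'n::finite, 'e::topological_space, 'k::finite) braid_data \<Rightarrow>
     ('a, 'n) braid set \<Rightarrow> ('e \<Rightarrow> 'x::topological_space) \<Rightarrow> 'x set \<Rightarrow>
     ('x set \<Rightarrow> ('x \<Rightarrow> complex^'k) \<Rightarrow> bool) \<Rightarrow> ('x \<Rightarrow> ('e \<times> (complex^'k)) set) set" where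
  "local_sections D H q X regular =
     {\<eta>. \<forall>x\<in>X. \<exists>U s f. x \<in> U \<and> openin (top_of_set X) U \<and>
        continuous_on U s \<and> s ` U \<subseteq> cover D \<and> regular U f \<and>
        (\<forall>y\<in>U. q (s y) = y \<and> \<eta> y = chi D H (s y) (f y))}"

definition associated_bundle ::
    "('a::euclidean_space, 'n::finite, 'e::topological_space, 'k::finite) braid_data \<Rightarrow>
     ('a, 'n) braid set \<Rightarrow> ('e \<Rightarrow> 'x::topological_space) \<Rightarrow> 'x measure \<Rightarrow>
     ('x set \<Rightarrow> ('x \<Rightarrow> complex^'k) \<Rightarrow> bool) \<Rightarrow> ('x, ('e \<times> (complex^'k)) set) hbundle" where
  "associated_bundle D H q \<mu> smooth =
     \<lparr>base = \<mu>,
      fadd = (\<lambda>v w. THE u. \<exists>e\<in>cover D. \<exists>f g. v = chi D H e f \<and> w = chi D H e g \<and> u = chi D H e (f + g)),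
      fscale = (\<lambda>c v. THE u. \<exists>e\<in>cover D. \<exists>f. v = chi D H e f \<and> u = chi D H e (c *s f)),
      finner = (\<lambda>v w. THE c. \<exists>e\<in>cover D. \<exists>f g. v = chi D H e f \<and> w = chi D H e g \<and> c = hinner f g),
      smooth_sections = local_sections D H q (space \<mu>) smooth,
      measurable_sections =
        local_sections D H q (space \<mu>) (\<lambda>U f. f \<in> borel_measurable (restrict_space borel U))\<rparr>"

text \<open>The bundle over the unordered configurations (one tilde) and the one over the ordered
  configurations (two tildes).\<close>

definition bundle_t ::
    "('a::euclidean_space, 'n::finite, 'e::topological_space, 'k::finite) braid_data \<Rightarrow>
     (('a, 'n) sym_power, ('e \<times> (complex^'k)) set) hbundle" where
  "bundle_t D = associated_bundle D (carrier (braid_group D)) (prt D)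
     (nconf_measure (mom D)) (smooth_on_nconf (mom D))"

definition bundle_tt ::
    "('a::euclidean_space, 'n::finite, 'e::topological_space, 'k::finite) braid_data \<Rightarrow>
     ('a^'n, ('e \<times> (complex^'k)) set) hbundle" where
  "bundle_tt D = associated_bundle D (pure_braids D) (prtt D)
     (conf_measure (mom D)) (smooth_on_conf (mom D))"

definition fibre_tt ::
    "('a::euclidean_space, 'n::finite, 'e, 'k::finite) braid_data \<Rightarrow> 'a^'n \<Rightarrow> ('e \<times> (complex^'k)) set set" where
  "fibre_tt D p = {chi D (pure_braids D) e f |e f. e \<in> cover D \<and> prtt D e = p}"


section \<open>The bundle map and the action of the symmetric group on sections\<close>

definition Pr ::
    "('a::euclidean_space, 'n::finite, 'e, 'k::finite) braid_data \<Rightarrow>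
     ('e \<times> (complex^'k)) set \<Rightarrow> ('e \<times> (complex^'k)) set" where
  "Pr D v = (THE u. \<exists>e\<in>cover D. \<exists>f.
     v = chi D (pure_braids D) e f \<and> u = chi D (carrier (braid_group D)) e f)"

definition Pr_pullback ::
    "('a::euclidean_space, 'n::finite, 'e, 'k::finite) braid_data \<Rightarrow>
     (('a, 'n) sym_power \<Rightarrow> ('e \<times> (complex^'k)) set) \<Rightarrow> 'a^'n \<Rightarrow> ('e \<times> (complex^'k)) set" where
  "Pr_pullback D \<xi> p = (THE v. v \<in> fibre_tt D p \<and> Pr D v = \<xi> (pr p))"

definition S_op ::
    "('a::euclidean_space, 'n::finite, 'e, 'k::finite) braid_data \<Rightarrow> ('n \<Rightarrow> 'n) \<Rightarrow>
     ('e \<times> (complex^'k)) set \<Rightarrow> ('e \<times> (complex^'k)) set" where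
  "S_op D \<pi> v = (THE u. \<exists>e\<in>cover D. \<exists>f. \<exists>b\<in>carrier (braid_group D). tau D b = \<pi> \<and>
     v = chi D (pure_braids D) e f \<and>
     u = chi D (pure_braids D) (act D e b) (rep D (inv\<^bsub>braid_group D\<^esub> b) f))"

definition U_op ::
    "('a::euclidean_space, 'n::finite, 'e, 'k::finite) braid_data \<Rightarrow> ('n \<Rightarrow> 'n) \<Rightarrow>
     ('a^'n \<Rightarrow> ('e \<times> (complex^'k)) set) \<Rightarrow> 'a^'n \<Rightarrow> ('e \<times> (complex^'k)) set" where
  "U_op D \<pi> \<eta> p =
     inv_into (\<Union>p\<in>conf (mom D). fibre_tt D p) (S_op D \<pi>) (\<eta> (permute p \<pi>))"

definition P_op ::
    "('a::euclidean_space, 'n::finite, 'e, 'k::finite) braid_data \<Rightarrow>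
     ('a^'n \<Rightarrow> ('e \<times> (complex^'k)) set) \<Rightarrow> 'a^'n \<Rightarrow> ('e \<times> (complex^'k)) set" where
  "P_op D \<eta> p = (THE u. \<exists>e\<in>cover D. \<exists>f. prtt D e = p \<and>
     (\<forall>\<pi>\<in>perms. U_op D \<pi> \<eta> p = chi D (pure_braids D) e (f \<pi>)) \<and>
     u = chi D (pure_braids D) e ((1 / fact CARD('n)) *s (\<Sum>\<pi>\<in>perms. f \<pi>)))"

text \<open>The invariant smooth sections form a linear space, so the closed subspace they span is their
  closure.\<close>

definition L2_inv ::
    "('a::euclidean_space, 'n::finite, 'e::topological_space, 'k::finite) braid_data \<Rightarrow>
     ('a^'n \<Rightarrow> ('e \<times> (complex^'k)) set) set set" where
  "L2_inv D = L2_closure (bundle_tt D)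
     {\<eta>\<in>smooth_sections (bundle_tt D) \<inter> sq_integrable (bundle_tt D).
        \<forall>\<pi>\<in>perms. \<forall>p\<in>conf (mom D). U_op D \<pi> \<eta> p = \<eta> p}"

text \<open>The operators on classes of sections induced by \<open>(1/n!) Pr\<^sup>*\<close> and by the projection.\<close>

definition pullback_L2 ::
    "('a::euclidean_space, 'n::finite, 'e::topological_space, 'k::finite) braid_data \<Rightarrow>
     (('a, 'n) sym_power \<Rightarrow> ('e \<times> (complex^'k)) set) set \<Rightarrow> ('a^'n \<Rightarrow> ('e \<times> (complex^'k)) set) set" where
  "pullback_L2 D =
     induced (bundle_tt D) (\<lambda>\<xi> p. fscale (bundle_tt D) (1 / fact CARD('n)) (Pr_pullback D \<xi> p))"

definition P_L2 ::
    "('a::euclidean_space, 'n::finite, 'e::topological_space, 'k::finite) braid_data \<Rightarrow>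
     ('a^'n \<Rightarrow> ('e \<times> (complex^'k)) set) set \<Rightarrow> ('a^'n \<Rightarrow> ('e \<times> (complex^'k)) set) set" where
  "P_L2 D = induced (bundle_tt D) (P_op D)"

definition ae_invariant ::
    "('a::euclidean_space, 'n::finite, 'e::topological_space, 'k::finite) braid_data \<Rightarrow>
     ('a^'n \<Rightarrow> ('e \<times> (complex^'k)) set) \<Rightarrow> bool" where
  "ae_invariant D \<eta> \<longleftrightarrow> (\<forall>\<pi>\<in>perms. AE p in conf_measure (mom D). \<eta> p = U_op D \<pi> \<eta> p)"

end

theory Submission
  imports Defs
begin

text \<open>A section of an associated bundle is the same as a function on the universal cover that is
  equivariant under the structure group: its value at \<open>e\<close> is the coordinate of the section with respect
  to \<open>e\<close>. In these terms the pullback along \<open>Pr\<close> is the identity, so its image consists of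
  the pure-braid equivariant functions that are equivariant under the whole braid group. The operator
  \<open>U(\<pi>)\<close> becomes \<open>F \<mapsto> (e \<mapsto> \<rho>(b) F(e b))\<close> for any braid \<open>b\<close> over \<open>\<pi>\<close>, so this
  is invariance under all \<open>U(\<pi>)\<close>. The norms differ by the factor \<open>n!\<close>, the number of sheets of
  \<open>pr\<close>. Since \<open>P\<close> is a contraction that preserves smoothness, a limit of smooth invariant sections
  is the same as an invariant limit of smooth sections.\<close>

section \<open>Permutations of configurations, the braid group and its permutations\<close>

text \<open>The factor \<open>sqrt (fact CARD('n))\<close> in the statement is forced by the
  measures. An integral over unordered configurations is 1/n! times the integral of the pulled back
  function, so the pullback with prefactor 1/n! multiplies squared norms by n!/(n!)^2 = 1/n!, and
  only its multiple by sqrt(n!) is unitary. The approximating sequences are smooth and their limits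
  only Borel; an abstract notion of regularity carries both through the same arguments. Fibre
  operations, the bundle map and \<open>tau\<close> are definite descriptions over orbits or lifts.
  Their uniqueness rests on two free actions, of braids on the cover and of permutations on tuples
  with distinct entries; connectedness of the cover carries what is known at the base point to all
  other points.\<close>

lemma norm_vec_sq_hinner: "hinner f f = complex_of_real ((norm f)\<^sup>2)"
proof -
  have "hinner f f = (\<Sum>i\<in>UNIV. complex_of_real ((norm (f$i))\<^sup>2))"
    unfolding hinner_def by (intro sum.cong refl) (simp add: complex_norm_square mult.commute del: of_real_power)
  also have "\<dots> = complex_of_real ((norm f)\<^sup>2)"
    by (simp add: norm_vec_def L2_set_def sum_nonneg)
  finally show ?thesis .
qed

lemma permute_comp: "permute (permute p \<pi>) \<sigma> = permute p (\<pi> \<circ> \<sigma>)"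
  by (simp add: permute_def vec_eq_iff)

lemma permute_id [simp]: "permute p id = p" "permute p (\<lambda>i. i) = p"
  by (simp_all add: permute_def vec_eq_iff)

lemma pr_eq_iff: "pr p = pr q \<longleftrightarrow> (\<exists>\<pi>\<in>perms. q = permute p \<pi>)"
  unfolding pr_def by (subst sym_power.abs_eq_iff) (simp add: same_orbit_def)

lemma pr_permute: "\<pi> \<in> perms \<Longrightarrow> pr (permute p \<pi>) = pr p"
  using pr_eq_iff by metis

lemma perms_comp: "\<pi> \<in> perms \<Longrightarrow> \<sigma> \<in> perms \<Longrightarrow> \<pi> \<circ> \<sigma> \<in> perms"
  by (auto simp: perms_def bij_comp)

lemma perms_inv: "\<pi> \<in> perms \<Longrightarrow> inv_into UNIV \<pi> \<in> perms"
  by (simp add: perms_def bij_imp_bij_inv)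

lemma perms_inv_comp:
  assumes "\<pi> \<in> perms"
  shows "inv_into UNIV \<pi> \<circ> \<pi> = id" "\<pi> \<circ> inv_into UNIV \<pi> = id"
  using assms by (auto simp: perms_def bij_def fun_eq_iff surj_f_inv_f)

lemma conf_permute: "p \<in> conf M \<Longrightarrow> \<pi> \<in> perms \<Longrightarrow> permute p \<pi> \<in> conf M"
  by (auto simp: conf_def permute_def perms_def bij_def dest: injD)

lemma conf_permute_iff: "\<pi> \<in> perms \<Longrightarrow> permute p \<pi> \<in> conf M \<longleftrightarrow> p \<in> conf M"
  using conf_permute[of "permute p \<pi>" M "inv_into UNIV \<pi>"] conf_permute[of p M \<pi>]
  by (auto simp: permute_comp perms_inv_comp perms_inv)

text \<open>The entries of a configuration are distinct, so an index is recovered from its entry.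
  Every later identification of a permutation reduces to this freeness.\<close>

lemma permute_inj_on_conf:
  assumes "p \<in> conf M" "permute p \<pi> = permute p \<sigma>"
  shows "\<pi> = \<sigma>"
proof
  fix i
  have "p $ \<pi> i = p $ \<sigma> i" using assms(2) by (simp add: permute_def vec_eq_iff)
  then show "\<pi> i = \<sigma> i" using assms(1) by (auto simp: conf_def)
qed

lemma finite_perms: "finite (perms :: ('n::finite \<Rightarrow> 'n) set)"
  by simp

lemma card_perms: "card (perms :: ('n::finite \<Rightarrow> 'n) set) = fact CARD('n)"
proof -
  have "(perms :: ('n \<Rightarrow> 'n) set) = {\<pi>. \<pi> permutes UNIV}"
    by (auto simp: perms_def permutes_bij intro: bij_imp_permutes)
  then show ?thesis using card_permutations[of "UNIV :: 'n set" "CARD('n)"] by simp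
qed

lemma continuous_on_permute: "continuous_on A (\<lambda>p::'a::topological_space^'n. permute p \<pi>)"
  unfolding permute_def by (intro continuous_intros continuous_on_vec_lambda)

lemma continuous_on_pr: "continuous_on A (pr :: 'a::topological_space^'n::finite \<Rightarrow> _)"
  by (rule continuous_on_subset[of UNIV])
    (auto simp: continuous_on_open_vimage[OF open_UNIV] open_sym_power_def)

text \<open>Two functions into \<open>conf\<close> with the same unordered values differ by a permutation, which is
  locally constant because its level sets are closed and finite in number.\<close>

lemma openin_permute_level:
  fixes f g :: "'y::topological_space \<Rightarrow> 'a::metric_space^'n::finite"
  assumes f: "continuous_on Y f" and g: "continuous_on Y g"
    and fc: "\<And>y. y \<in> Y \<Longrightarrow> f y \<in> conf M" and eq: "\<And>y. y \<in> Y \<Longrightarrow> pr (f y) = pr (g y)"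
  shows "openin (top_of_set Y) {y\<in>Y. g y = permute (f y) \<pi>}"
    and "closedin (top_of_set Y) {y\<in>Y. g y = permute (f y) \<pi>}"
proof -
  have cl: "closedin (top_of_set Y) {y\<in>Y. g y = permute (f y) \<sigma>}" for \<sigma>
  proof -
    have "continuous_on Y (\<lambda>y. permute (f y) \<sigma>)"
      by (rule continuous_on_compose2[OF continuous_on_permute f]) auto
    then have "continuous_on Y (\<lambda>y. (g y, permute (f y) \<sigma>))"
      by (intro continuous_intros g)
    then have "closedin (top_of_set Y) (Y \<inter> (\<lambda>y. (g y, permute (f y) \<sigma>)) -` {y. \<exists>x. y = (x, x)})"
      by (rule continuous_closedin_preimage) (rule closed_diagonal)
    moreover have "Y \<inter> (\<lambda>y. (g y, permute (f y) \<sigma>)) -` {y. \<exists>x. y = (x, x)} = {y\<in>Y. g y = permute (f y) \<sigma>}"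
      by auto
    ultimately show ?thesis by simp
  qed
  then show "closedin (top_of_set Y) {y\<in>Y. g y = permute (f y) \<pi>}" .
  have "{y\<in>Y. g y = permute (f y) \<pi>} = Y - (\<Union>\<sigma>\<in>perms - {\<pi>}. {y\<in>Y. g y = permute (f y) \<sigma>})"
  proof (intro Set.set_eqI iffI)
    fix y assume "y \<in> {y\<in>Y. g y = permute (f y) \<pi>}"
    then show "y \<in> Y - (\<Union>\<sigma>\<in>perms - {\<pi>}. {y\<in>Y. g y = permute (f y) \<sigma>})"
      using permute_inj_on_conf[OF fc] by auto
  next
    fix y assume y: "y \<in> Y - (\<Union>\<sigma>\<in>perms - {\<pi>}. {y\<in>Y. g y = permute (f y) \<sigma>})"
    then obtain \<sigma> where "\<sigma> \<in> perms" "g y = permute (f y) \<sigma>"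
      using eq[of y] pr_eq_iff by blast
    with y show "y \<in> {y\<in>Y. g y = permute (f y) \<pi>}" by auto
  qed
  moreover have "closedin (top_of_set Y) (\<Union>\<sigma>\<in>perms - {\<pi>}. {y\<in>Y. g y = permute (f y) \<sigma>})"
    by (rule closedin_Union) (use cl in auto)
  ultimately show "openin (top_of_set Y) {y\<in>Y. g y = permute (f y) \<pi>}"
    by (metis (no_types, lifting) openin_diff openin_topspace topspace_euclidean_subtopology openin_subtopology_self)
qed

text \<open>A non-empty clopen level set fills a connected domain. This is uniqueness of lifts along
  \<open>pr\<close>: with an interval as domain it compares paths, with the whole cover as domain it
  reaches points far from the base point.\<close>

lemma permute_const_connected:
  fixes f g :: "'y::topological_space \<Rightarrow> 'a::metric_space^'n::finite"
  assumes "continuous_on Y f" "continuous_on Y g" "connected Y"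
    and "\<And>y. y \<in> Y \<Longrightarrow> f y \<in> conf M" "\<And>y. y \<in> Y \<Longrightarrow> pr (f y) = pr (g y)"
    and "y0 \<in> Y" "g y0 = permute (f y0) \<pi>" "y \<in> Y"
  shows "g y = permute (f y) \<pi>"
proof -
  have "{y\<in>Y. g y = permute (f y) \<pi>} = Y"
    using assms(3,6,7) openin_permute_level[of Y f g M \<pi>, OF assms(1,2,4,5)]
    unfolding connected_clopen by blast
  then show ?thesis using assms(8) by blast
qed

section \<open>Loop classes under concatenation\<close>

lemma loop_class_eqI: "homotopic_paths X g h \<Longrightarrow> loop_class X g = loop_class X h"
  unfolding loop_class_def by (auto intro: homotopic_paths_trans homotopic_paths_sym)

text \<open>The product is a union over all pairs of representatives. Concatenation respects
  homotopy, so the members of that union coincide, and the given pair shows that there is at least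
  one.\<close>

lemma mult_loop_class:
  assumes "g \<in> loops X x0" "h \<in> loops X x0"
  shows "loop_class X g \<otimes>\<^bsub>fundamental_group X x0\<^esub> loop_class X h = loop_class X (g +++ h)"
proof -
  have *: "loop_class X (g' +++ h') = loop_class X (g +++ h)"
    if "g' \<in> loop_class X g" "h' \<in> loop_class X h" for g' h'
    using that assms unfolding loop_class_def loops_def
    by (intro loop_class_eqI[unfolded loop_class_def] homotopic_paths_sym[OF homotopic_paths_join]) auto
  have gh: "g \<in> loop_class X g" "h \<in> loop_class X h"
    using assms by (auto simp: loop_class_def loops_def)
  have "(\<Union>g'\<in>loop_class X g. \<Union>h'\<in>loop_class X h. loop_class X (g' +++ h'))
      = (\<Union>g'\<in>loop_class X g. \<Union>h'\<in>loop_class X h. loop_class X (g +++ h))"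
    by (intro SUP_cong refl *)
  also have "\<dots> = loop_class X (g +++ h)" using gh by blast
  finally show ?thesis by (simp add: fundamental_group_def)
qed

lemma mult_closed_fundamental_group:
  assumes "a \<in> carrier (fundamental_group X x0)" "b \<in> carrier (fundamental_group X x0)"
  shows "a \<otimes>\<^bsub>fundamental_group X x0\<^esub> b \<in> carrier (fundamental_group X x0)"
proof -
  obtain g h where gh: "g \<in> loops X x0" "h \<in> loops X x0" "a = loop_class X g" "b = loop_class X h"
    using assms by (auto simp: fundamental_group_def)
  then have "g +++ h \<in> loops X x0"
    by (auto simp: loops_def path_image_join)
  then show ?thesis
    using gh by (simp add: mult_loop_class) (simp add: fundamental_group_def)
qed

lemma one_closed_fundamental_group:
  assumes "x0 \<in> X"
  shows "\<one>\<^bsub>fundamental_group X x0\<^esub> \<in> carrier (fundamental_group X x0)"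
proof -
  have "(\<lambda>_. x0) \<in> loops X x0"
    using assms by (auto simp: loops_def path_def path_image_def pathstart_def pathfinish_def)
  then show ?thesis by (simp add: fundamental_group_def)
qed

text \<open>Complex linearity is what the unitary group supplies; real linearity is what continuity
  and differentiability of changes of coordinates ask for.\<close>

lemma vlinear_imp_linear:
  assumes "Vector_Spaces.linear (*s) (*s) (A :: complex^'k \<Rightarrow> complex^'k)"
  shows "linear A"
proof (rule linearI)
  interpret Vector_Spaces.linear "(*s)" "(*s)" A by fact
  show "A (x + y) = A x + A y" for x y by (rule add)
  show "A (c *\<^sub>R x) = c *\<^sub>R A x" for c x
  proof -
    have *: "c *\<^sub>R y = complex_of_real c *s y" for y :: "complex^'k"
      by (simp add: vec_eq_iff) (simp add: scaleR_conv_of_real)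
    show ?thesis unfolding * by (rule scale)
  qed
qed

text \<open>Constant loops at two points are freely homotopic, and following one parameter value
  through the homotopy gives a path between the points. The total space of the covering is a bare
  topological space, hence this generality.\<close>

lemma simply_connected_imp_connected_topological:
  fixes S :: "'x::topological_space set"
  assumes "simply_connected S"
  shows "connected S"
proof -
  have "path_component S a b" if "a \<in> S" "b \<in> S" for a b
  proof -
    have "homotopic_loops S (\<lambda>_. a) (\<lambda>_. b)"
      using that by (intro assms[unfolded simply_connected_def, rule_format])
        (auto simp: path_def path_image_def pathstart_def pathfinish_def)
    then obtain h where h: "continuous_on ({0..1::real} \<times> {0..1::real}) h" "h ` ({0..1} \<times> {0..1}) \<subseteq> S"
      "\<forall>x\<in>{0..1}. h (0, x) = a" "\<forall>x\<in>{0..1}. h (1, x) = b"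
      unfolding homotopic_loops by (auto simp: image_subset_iff_funcset)
    have "path (\<lambda>t. h (t, 0))" unfolding path_def
      by (rule continuous_on_compose2[OF h(1)]) (auto intro!: continuous_intros)
    moreover have "path_image (\<lambda>t. h (t, 0)) \<subseteq> S" using h(2) by (auto simp: path_image_def)
    moreover have "pathstart (\<lambda>t. h (t, 0)) = a" "pathfinish (\<lambda>t. h (t, 0)) = b"
      using h(3,4) by (auto simp: pathstart_def pathfinish_def)
    ultimately show ?thesis unfolding path_component_def by blast
  qed
  then have "path_connected S" by (simp add: path_connected_component)
  then show ?thesis by (rule path_connected_imp_connected)
qed

section \<open>The braid group acting on the universal cover\<close>

locale braid_geometry =
  fixes D :: "('a::euclidean_space, 'n::finite, 'e::topological_space, 'k::finite) braid_data"
  assumes data: "braid_setup D"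
begin

abbreviation "G \<equiv> braid_group D"
abbreviation "C \<equiv> cover D"
abbreviation "M \<equiv> mom D"
abbreviation "braid_one \<equiv> \<one>\<^bsub>braid_group D\<^esub>"
abbreviation "binv b \<equiv> inv\<^bsub>braid_group D\<^esub> b"
abbreviation braid_mult (infixl "\<cdot>" 70) where "b \<cdot> c \<equiv> b \<otimes>\<^bsub>braid_group D\<^esub> c"

lemma universal: "universal_cover D" and principal: "principal_action D"
  and rep_hom: "rep D \<in> hom G unitary_group"
  using data by (auto simp: braid_setup_def)

lemma cov_t: "covering_space C (prt D) (nconf M)" and cov_tt: "covering_space C (prtt D) (conf M)"
  and pr_prtt: "e \<in> C \<Longrightarrow> pr (prtt D e) = prt D e" and base_pt: "cover_pt D \<in> C"
  and connected_cover: "connected C"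
  using universal by (auto simp: universal_cover_def simply_connected_imp_connected_topological)

lemma prt_in: "e \<in> C \<Longrightarrow> prt D e \<in> nconf M" and prtt_in: "e \<in> C \<Longrightarrow> prtt D e \<in> conf M"
  using cov_t cov_tt by (auto dest: covering_space_imp_surjective)

lemma act_one: "e \<in> C \<Longrightarrow> act D e braid_one = e"
  and act_mult: "e \<in> C \<Longrightarrow> b \<in> carrier G \<Longrightarrow> c \<in> carrier G \<Longrightarrow>
    act D e (b \<cdot> c) = act D (act D e b) c"
  and act_closed: "e \<in> C \<Longrightarrow> b \<in> carrier G \<Longrightarrow> act D e b \<in> C"
  and continuous_act: "b \<in> carrier G \<Longrightarrow> continuous_on C (\<lambda>e. act D e b)"
  and act_bij: "e \<in> C \<Longrightarrow> bij_betw (act D e) (carrier G) {e'\<in>C. prt D e' = prt D e}"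
  and loop_lift: "g \<in> loops (nconf M) (prt D (cover_pt D)) \<Longrightarrow> \<exists>h. path h \<and> path_image h \<subseteq> C \<and>
      (\<forall>t\<in>{0..1}. prt D (h t) = g t) \<and>
      pathstart h = act D (cover_pt D) (loop_class (nconf M) g) \<and> pathfinish h = cover_pt D"
  using principal unfolding principal_action_def by blast+

lemma prt_act: "e \<in> C \<Longrightarrow> b \<in> carrier G \<Longrightarrow> prt D (act D e b) = prt D e"
  using act_bij[of e] by (auto dest!: bij_betw_imp_surj_on)

lemma act_inj: "e \<in> C \<Longrightarrow> b \<in> carrier G \<Longrightarrow> c \<in> carrier G \<Longrightarrow> act D e b = act D e c \<Longrightarrow> b = c"
  using act_bij[of e] by (auto simp: bij_betw_def inj_on_def)

lemma prt_fibre: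
  assumes "e \<in> C" "e' \<in> C" "prt D e' = prt D e"
  obtains b where "b \<in> carrier G" "e' = act D e b"
  using act_bij[of e] assms by (auto simp: bij_betw_def image_iff set_eq_iff)

lemma one_closed: "braid_one \<in> carrier G"
  unfolding braid_group_def by (rule one_closed_fundamental_group) (rule prt_in[OF base_pt])

lemma mult_closed: "b \<in> carrier G \<Longrightarrow> c \<in> carrier G \<Longrightarrow> b \<cdot> c \<in> carrier G"
  unfolding braid_group_def by (rule mult_closed_fundamental_group)

text \<open>The group axioms follow from those of a free and transitive action on the fibres.\<close>

lemma group_braid_group: "group G"
proof (rule groupI)
  let ?e = "cover_pt D"
  show "x \<cdot> y \<cdot> z = x \<cdot> (y \<cdot> z)"
    if "x \<in> carrier G" "y \<in> carrier G" "z \<in> carrier G" for x y z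
    by (rule act_inj[OF base_pt]) (use that base_pt in \<open>simp_all add: mult_closed act_mult act_closed\<close>)
  show "braid_one \<cdot> x = x" if "x \<in> carrier G" for x
    by (rule act_inj[OF base_pt])
      (use that base_pt in \<open>simp_all add: mult_closed one_closed act_mult act_closed act_one\<close>)
  show "\<exists>y\<in>carrier G. y \<cdot> x = braid_one" if x: "x \<in> carrier G" for x
  proof -
    let ?e' = "act D ?e x"
    have e': "?e' \<in> C" "prt D ?e' = prt D ?e"
      using x base_pt by (auto simp: act_closed prt_act)
    obtain y where y: "y \<in> carrier G" "?e = act D ?e' y"
      using prt_fibre[OF e'(1) base_pt] e'(2) by metis
    \<comment> \<open>\<open>y\<close> leads from the translate back to the base point and
      \<open>x\<close> leads out again; comparing at the translate is what makes \<open>y\<close> a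
      left inverse.\<close>
    have "act D ?e' (y \<cdot> x) = act D ?e' braid_one"
      using x y e' by (simp add: act_mult act_one)
    then show ?thesis
      using act_inj[OF e'(1) mult_closed[OF y(1) x] one_closed] y(1) by blast
  qed
qed (auto simp: mult_closed one_closed)

sublocale braid: group G
  by (rule group_braid_group)

lemma act_inv: "e \<in> C \<Longrightarrow> b \<in> carrier G \<Longrightarrow> act D (act D e b) (binv b) = e"
  and act_inv': "e \<in> C \<Longrightarrow> b \<in> carrier G \<Longrightarrow> act D (act D e (binv b)) b = e"
  by (simp_all add: act_mult[symmetric] act_one)

lemma rep_unitary: "b \<in> carrier G \<Longrightarrow> rep D b \<in> carrier unitary_group"
  using rep_hom by (rule hom_in_carrier)

lemma rep_mult: "b \<in> carrier G \<Longrightarrow> c \<in> carrier G \<Longrightarrow> rep D (b \<cdot> c) f = rep D b (rep D c f)"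
  using hom_mult[OF rep_hom, of b c] by (simp add: unitary_group_def)

lemma vlinear_rep: "b \<in> carrier G \<Longrightarrow> Vector_Spaces.linear (*s) (*s) (rep D b)"
  and hinner_rep: "b \<in> carrier G \<Longrightarrow> hinner (rep D b f) (rep D b g) = hinner f g"
  using rep_unitary[of b] by (auto simp: unitary_group_def)

lemma linear_rep: "b \<in> carrier G \<Longrightarrow> linear (rep D b)"
  by (rule vlinear_imp_linear[OF vlinear_rep])

lemma norm_rep: "b \<in> carrier G \<Longrightarrow> norm (rep D b f) = norm f"
  using hinner_rep[of b f f] by (simp add: norm_vec_sq_hinner del: of_real_power)

lemma rep_add: "b \<in> carrier G \<Longrightarrow> rep D b (f + g) = rep D b f + rep D b g"
  and rep_sum: "b \<in> carrier G \<Longrightarrow> rep D b (\<Sum>i\<in>I. F i) = (\<Sum>i\<in>I. rep D b (F i))"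
  by (simp_all add: linear_add[OF linear_rep] linear_sum[OF linear_rep])

lemma rep_scale: "b \<in> carrier G \<Longrightarrow> rep D b (c *s f) = c *s rep D b f"
proof -
  assume "b \<in> carrier G"
  then interpret Vector_Spaces.linear "(*s)" "(*s)" "rep D b" by (rule vlinear_rep)
  show ?thesis by (rule scale)
qed

text \<open>Membership in \<open>hom\<close> gives multiplicativity, so the image of the unit is
  idempotent; a surjective idempotent map is the identity.\<close>

lemma rep_one: "rep D braid_one f = f"
proof -
  have "surj (rep D braid_one)" using rep_unitary[OF one_closed] by (simp add: unitary_group_def)
  then obtain g where g: "f = rep D braid_one g" by (metis surjD)
  have "rep D braid_one (rep D braid_one g) = rep D braid_one g"
    using rep_mult[OF one_closed one_closed, of g] by simp
  then show ?thesis by (simp add: g)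
qed

lemma rep_inv: "b \<in> carrier G \<Longrightarrow> rep D (binv b) (rep D b f) = f"
  and rep_inv': "b \<in> carrier G \<Longrightarrow> rep D b (rep D (binv b) f) = f"
  by (simp_all add: rep_mult[symmetric] rep_one)

text \<open>\<open>tau\<close> is defined by lifting loops at the base point; the lifts supplied by the action make it
  computable from the action.\<close>

lemma tau_base:
  assumes b: "b \<in> carrier G"
  shows "tau D b \<in> perms" "prtt D (act D (cover_pt D) b) = permute (prtt D (cover_pt D)) (tau D b)"
proof -
  let ?e = "cover_pt D" and ?X = "nconf M"
  have e: "act D ?e b \<in> C" using b base_pt by (simp add: act_closed)
  have "pr (prtt D ?e) = pr (prtt D (act D ?e b))"
    using b base_pt e by (simp add: pr_prtt prt_act)
  then obtain \<pi> where \<pi>: "\<pi> \<in> perms" "prtt D (act D ?e b) = permute (prtt D ?e) \<pi>"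
    using pr_eq_iff by metis
  have lift: "\<exists>h. path h \<and> path_image h \<subseteq> C \<and> (\<forall>t\<in>{0..1}. prt D (h t) = g t) \<and>
      pathstart h = act D ?e b \<and> pathfinish h = ?e" if g: "g \<in> b" for g
  proof -
    obtain g0 where g0: "g0 \<in> loops ?X (prt D ?e)" "b = loop_class ?X g0"
      using b by (auto simp: braid_group_def fundamental_group_def)
    have h: "homotopic_paths ?X g0 g" using g g0 by (simp add: loop_class_def)
    have "g \<in> loops ?X (prt D ?e)"
      using g0(1) homotopic_paths_imp_path[OF h] homotopic_paths_imp_subset[OF h]
        homotopic_paths_imp_pathstart[OF h] homotopic_paths_imp_pathfinish[OF h]
      by (simp add: loops_def)
    moreover have "loop_class ?X g = b" using g0 loop_class_eqI[OF h] by simp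
    ultimately show ?thesis using loop_lift by metis
  qed
  have "tau D b = \<pi>" unfolding tau_def
  proof (rule the_equality)
    obtain g0 where g0: "g0 \<in> loops ?X (prt D ?e)" "b = loop_class ?X g0"
      using b by (auto simp: braid_group_def fundamental_group_def)
    then have gb: "g0 \<in> b" by (auto simp: loop_class_def loops_def)
    obtain h where h: "path h" "path_image h \<subseteq> C" "\<forall>t\<in>{0..1}. prt D (h t) = g0 t"
      "pathstart h = act D ?e b" "pathfinish h = ?e" using lift[OF gb] by blast
    have hC: "h t \<in> C" if "t \<in> {0..1}" for t using h(2) that by (auto simp: path_image_def)
    have p: "path (prtt D \<circ> h)"
      using h(1,2) cov_tt by (intro path_continuous_image)
        (auto intro: continuous_on_subset dest: covering_space_imp_continuous)
    have eq: "(pr \<circ> (prtt D \<circ> h)) t = g0 t" if "t \<in> {0..1}" for t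
      using h(3) hC[OF that] that by (simp add: pr_prtt)
    have "homotopic_paths ?X g0 (pr \<circ> (prtt D \<circ> h))"
      using g0(1) eq by (intro homotopic_paths_eq) (auto simp: loops_def)
    then have "pr \<circ> (prtt D \<circ> h) \<in> b" using g0(2) by (simp add: loop_class_def)
    moreover have "path_image (prtt D \<circ> h) \<subseteq> conf M"
      using hC prtt_in by (auto simp: path_image_def)
    moreover have "pathfinish (prtt D \<circ> h) = prtt D ?e" "pathstart (prtt D \<circ> h) = permute (prtt D ?e) \<pi>"
      using h(4,5) \<pi>(2) by (simp_all add: pathfinish_compose pathstart_compose)
    ultimately show "\<pi> \<in> perms \<and> (\<exists>g. path g \<and> path_image g \<subseteq> conf M \<and> pr \<circ> g \<in> b \<and>
        pathfinish g = prtt D ?e \<and> pathstart g = permute (prtt D ?e) \<pi>)"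
      using \<pi>(1) p by blast
  next
    fix \<sigma> assume "\<sigma> \<in> perms \<and> (\<exists>g. path g \<and> path_image g \<subseteq> conf M \<and> pr \<circ> g \<in> b \<and>
        pathfinish g = prtt D ?e \<and> pathstart g = permute (prtt D ?e) \<sigma>)"
    then obtain g where g: "path g" "path_image g \<subseteq> conf M" "pr \<circ> g \<in> b"
      "pathfinish g = prtt D ?e" "pathstart g = permute (prtt D ?e) \<sigma>" by blast
    obtain h where h: "path h" "path_image h \<subseteq> C" "\<forall>t\<in>{0..1}. prt D (h t) = (pr \<circ> g) t"
      "pathstart h = act D ?e b" "pathfinish h = ?e" using lift[OF g(3)] by blast
    have hC: "h t \<in> C" if "t \<in> {0..1}" for t using h(2) that by (auto simp: path_image_def)
    have p: "path (prtt D \<circ> h)"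
      using h(1,2) cov_tt by (intro path_continuous_image)
        (auto intro: continuous_on_subset dest: covering_space_imp_continuous)
    \<comment> \<open>The competing lift \<open>g\<close> and the projection of the supplied lift
      \<open>h\<close> lie over the same loop and agree at time 1, because lifts end at the base
      point. On the connected interval they then agree at time 0, where they show
      \<open>\<sigma>\<close> and \<open>\<pi>\<close>.\<close>
    have "(prtt D \<circ> h) 0 = permute (g 0) id"
    proof (rule permute_const_connected[of "{0..1}" g "prtt D \<circ> h" M 1 id 0])
      show "(prtt D \<circ> h) 1 = permute (g 1) id"
        using h(5) g(4) by (simp add: pathfinish_def)
      show "g y \<in> conf M" if "y \<in> {0..1}" for y
        using g(2) that by (auto simp: path_image_def)
      show "pr (g y) = pr ((prtt D \<circ> h) y)" if "y \<in> {0..1}" for y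
        using h(3) that hC[OF that] by (simp add: pr_prtt)
    qed (use g(1) p in \<open>auto simp: path_def\<close>)
    then have "permute (prtt D ?e) \<sigma> = permute (prtt D ?e) \<pi>"
      using g(5) h(4) \<pi>(2) by (simp add: pathstart_def)
    then show "\<sigma> = \<pi>" using permute_inj_on_conf[OF prtt_in[OF base_pt]] by blast
  qed
  then show "tau D b \<in> perms" "prtt D (act D ?e b) = permute (prtt D ?e) (tau D b)"
    using \<pi> by simp_all
qed

lemma continuous_prtt: "continuous_on C (prtt D)"
  using cov_tt by (rule covering_space_imp_continuous)

text \<open>Both maps lie over the same unordered configuration, so they differ by a permutation
  that is constant on the connected cover; its value is read off at the base point.\<close>

lemma prtt_act:
  assumes b: "b \<in> carrier G" and e: "e \<in> C"
  shows "prtt D (act D e b) = permute (prtt D e) (tau D b)"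
proof (rule permute_const_connected[of C "prtt D" "\<lambda>e. prtt D (act D e b)" M "cover_pt D"])
  show "continuous_on C (\<lambda>e. prtt D (act D e b))"
    by (rule continuous_on_compose2[OF continuous_prtt continuous_act[OF b]]) (use b act_closed in auto)
  show "pr (prtt D y) = pr (prtt D (act D y b))" if "y \<in> C" for y
    using that b by (simp add: pr_prtt prt_act act_closed)
qed (use e b in \<open>auto simp: continuous_prtt connected_cover prtt_in base_pt tau_base\<close>)

text \<open>Braids and permutations both act from the right, and the latter act freely, so
  evaluation at the base point yields a homomorphism and not an antihomomorphism.\<close>

lemma tau_mult:
  assumes "b \<in> carrier G" "c \<in> carrier G"
  shows "tau D (b \<cdot> c) = tau D b \<circ> tau D c"
proof -
  have "permute (prtt D (cover_pt D)) (tau D (b \<cdot> c)) =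
      permute (prtt D (cover_pt D)) (tau D b \<circ> tau D c)"
    using assms base_pt
    by (simp add: prtt_act[symmetric] act_mult act_closed permute_comp[symmetric])
  then show ?thesis by (rule permute_inj_on_conf[OF prtt_in[OF base_pt]])
qed

lemma tau_one: "tau D braid_one = id"
proof -
  have "permute (prtt D (cover_pt D)) (tau D braid_one) = permute (prtt D (cover_pt D)) id"
    using base_pt by (simp add: prtt_act[symmetric] act_one)
  then show ?thesis by (rule permute_inj_on_conf[OF prtt_in[OF base_pt]])
qed

lemma tau_inv: "b \<in> carrier G \<Longrightarrow> tau D (binv b) \<circ> tau D b = id"
  by (simp add: tau_mult[symmetric] tau_one)

text \<open>The cover maps onto all ordered configurations. A point above the permuted base
  configuration has the same unordered image as the base point, so some braid leads to it.\<close>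

lemma tau_surj:
  assumes "\<pi> \<in> perms"
  obtains b where "b \<in> carrier G" "tau D b = \<pi>"
proof -
  let ?p = "prtt D (cover_pt D)"
  have "permute ?p \<pi> \<in> conf M" by (rule conf_permute[OF prtt_in[OF base_pt] assms])
  then obtain e where e: "e \<in> C" "prtt D e = permute ?p \<pi>"
    using covering_space_imp_surjective[OF cov_tt] by (metis imageE)
  have "prt D e = prt D (cover_pt D)"
    using e assms pr_permute[of \<pi> ?p] base_pt by (metis pr_prtt)
  then obtain b where b: "b \<in> carrier G" "e = act D (cover_pt D) b"
    using prt_fibre[OF base_pt e(1)] by blast
  have "permute ?p (tau D b) = permute ?p \<pi>"
    using e b base_pt by (simp add: prtt_act)
  then show ?thesis
    using that b(1) permute_inj_on_conf[OF prtt_in[OF base_pt]] by blast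
qed

lemma pure_iff: "b \<in> pure_braids D \<longleftrightarrow> b \<in> carrier G \<and> tau D b = id"
  by (simp add: pure_braids_def)

lemma subgroup_pure: "subgroup (pure_braids D) G"
proof (rule braid.subgroupI)
  show "binv a \<in> pure_braids D" if "a \<in> pure_braids D" for a
    using that tau_inv[of a] by (auto simp: pure_iff)
  show "pure_braids D \<noteq> {}" using tau_one one_closed by (auto simp: pure_braids_def)
qed (auto simp: pure_iff tau_mult)

text \<open>Points over one ordered configuration also lie over one unordered configuration and are
  joined by a braid; freeness of the permutation action forces this braid to be pure.\<close>

lemma prtt_fibre_iff:
  assumes "e \<in> C" "e' \<in> C"
  shows "prtt D e = prtt D e' \<longleftrightarrow> (\<exists>b\<in>pure_braids D. e' = act D e b)"
proof
  assume eq: "prtt D e = prtt D e'"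
  then have "prt D e' = prt D e" using assms by (metis pr_prtt)
  then obtain b where b: "b \<in> carrier G" "e' = act D e b" using prt_fibre[OF assms] by blast
  then have "permute (prtt D e) (tau D b) = permute (prtt D e) id"
    using eq assms by (simp add: prtt_act)
  then have "tau D b = id" by (rule permute_inj_on_conf[OF prtt_in[OF assms(1)]])
  then show "\<exists>b\<in>pure_braids D. e' = act D e b" using b by (auto simp: pure_iff)
qed (use assms in \<open>auto simp: pure_iff prtt_act\<close>)

lemma prt_fibre_iff:
  assumes "e \<in> C" "e' \<in> C"
  shows "prt D e = prt D e' \<longleftrightarrow> (\<exists>b\<in>carrier G. e' = act D e b)"
  using prt_fibre[OF assms] prt_act[OF assms(1)] by metis

end

section \<open>Associated bundles and their square integrable sections\<close>

lemma tendsto_zero_squeeze: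
  fixes f g :: "nat \<Rightarrow> real"
  assumes "\<And>k. 0 \<le> f k" "\<And>k. f k \<le> g k" "g \<longlonglongrightarrow> 0"
  shows "f \<longlonglongrightarrow> 0"
  using assms by (intro tendsto_sandwich[OF _ _ tendsto_const assms(3)]) auto

type_synonym ('e, 'k) orbit = "('e \<times> (complex^'k)) set"

text \<open>The closure properties shared by smooth and Borel coordinate functions. The first clause
  combines restriction to smaller open sets with independence of values off the set; the last one
  admits constant changes of frame.\<close>

definition regularity ::
    "'x::topological_space set \<Rightarrow> ('x set \<Rightarrow> ('x \<Rightarrow> complex^'k) \<Rightarrow> bool) \<Rightarrow> bool" where
  "regularity X reg \<longleftrightarrow>
     (\<forall>U V f g. openin (top_of_set X) U \<and> openin (top_of_set X) V \<and> V \<subseteq> U \<and> reg U f \<and>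
        (\<forall>y\<in>V. g y = f y) \<longrightarrow> reg V g) \<and>
     (\<forall>U. openin (top_of_set X) U \<longrightarrow> reg U (\<lambda>_. 0)) \<and>
     (\<forall>U f g. openin (top_of_set X) U \<and> reg U f \<and> reg U g \<longrightarrow> reg U (\<lambda>x. f x + g x)) \<and>
     (\<forall>U f A. openin (top_of_set X) U \<and> linear A \<and> reg U f \<longrightarrow> reg U (\<lambda>x. A (f x)))"

lemma regularityD:
  assumes "regularity X reg" "openin (top_of_set X) U"
  shows "openin (top_of_set X) V \<Longrightarrow> V \<subseteq> U \<Longrightarrow> reg U f \<Longrightarrow> (\<And>y. y \<in> V \<Longrightarrow> g y = f y) \<Longrightarrow> reg V g"
    and "reg U (\<lambda>_. 0)"
    and "reg U f \<Longrightarrow> reg U g \<Longrightarrow> reg U (\<lambda>x. f x + g x)"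
    and "linear A \<Longrightarrow> reg U f \<Longrightarrow> reg U (\<lambda>x. A (f x))"
  using assms(2) assms(1)[unfolded regularity_def, THEN conjunct1, rule_format, of U V f g]
    assms(1)[unfolded regularity_def, THEN conjunct2, THEN conjunct1, rule_format, of U]
    assms(1)[unfolded regularity_def, THEN conjunct2, THEN conjunct2, THEN conjunct1, rule_format, of U f g]
    assms(1)[unfolded regularity_def, THEN conjunct2, THEN conjunct2, THEN conjunct2, rule_format, of U A f]
  by simp_all

lemma regularity_mono:
  assumes "regularity X reg" "openin (top_of_set X) U" "openin (top_of_set X) V" "V \<subseteq> U" "reg U f"
  shows "reg V f"
  using regularityD(1)[OF assms(1), OF assms(2), of V f f] assms(3-5) by simp

abbreviation "borel_reg \<equiv> \<lambda>U f. f \<in> borel_measurable (restrict_space borel U)"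

lemma sets_restrict_borel_openin:
  assumes "openin (top_of_set X) U"
  shows "U \<in> sets (restrict_space borel X)"
proof -
  obtain T where "open T" "U = X \<inter> T" using assms unfolding openin_open by blast
  then show ?thesis unfolding sets_restrict_space by (intro image_eqI[of _ _ T]) simp_all
qed

lemma regularity_borel:
  "regularity X (borel_reg :: 'x::topological_space set \<Rightarrow> ('x \<Rightarrow> complex^'k::finite) \<Rightarrow> bool)"
  unfolding regularity_def
proof (intro conjI allI impI; (elim conjE)?)
  fix U V :: "'x set" and f g :: "'x \<Rightarrow> complex^'k"
  assume *: "V \<subseteq> U" "f \<in> borel_measurable (restrict_space borel U)" "\<forall>y\<in>V. g y = f y"
  have "f \<in> borel_measurable (restrict_space (restrict_space borel U) V)"
    by (rule measurable_restrict_space1[OF *(2)])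
  then have "f \<in> borel_measurable (restrict_space borel V)"
    using *(1) by (subst measurable_cong_sets[of _ "restrict_space (restrict_space borel U) V" borel borel])
      (auto simp: sets_restrict_restrict_space Int_absorb1)
  then show "g \<in> borel_measurable (restrict_space borel V)"
    using *(3) by (subst measurable_cong[of _ g f]) (auto simp: space_restrict_space)
next
  fix U :: "'x set" and f :: "'x \<Rightarrow> complex^'k" and A :: "complex^'k \<Rightarrow> complex^'k"
  assume "linear A" and f: "f \<in> borel_measurable (restrict_space borel U)"
  then have "A \<in> borel_measurable borel"
    by (intro borel_measurable_continuous_onI linear_continuous_on) (simp add: linear_conv_bounded_linear)
  then show "(\<lambda>x. A (f x)) \<in> borel_measurable (restrict_space borel U)"
    using f by measurable
qed auto

text \<open>Meant for two instances: all braids over unordered configurations and pure braids over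
  ordered ones. The condition \<open>orbit\<close> makes \<open>q\<close> the projection of a
  principal bundle with group \<open>H\<close>; the Lindelof property serves to pass from local to
  global measurability.\<close>

locale assoc = braid_geometry D
  for D :: "('a::euclidean_space, 'n::finite, 'e::topological_space, 'k::finite) braid_data" +
  fixes H :: "('a, 'n) braid set" and q :: "'e \<Rightarrow> 'x::topological_space" and \<mu> :: "'x measure"
    and smooth :: "'x set \<Rightarrow> ('x \<Rightarrow> complex^'k) \<Rightarrow> bool"
  assumes sub: "subgroup H (braid_group D)"
    and cov: "covering_space (cover D) q (space \<mu>)"
    and orbit: "\<And>e e'. e \<in> cover D \<Longrightarrow> e' \<in> cover D \<Longrightarrow> q e = q e' \<longleftrightarrow> (\<exists>b\<in>H. e' = act D e b)"
    and sets_base: "sets \<mu> = sets (restrict_space borel (space \<mu>))"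
    and lindelof: "Lindelof_space (top_of_set (space \<mu>))"
    and smooth: "regularity (space \<mu>) smooth"
begin

abbreviation "X \<equiv> space \<mu>"
abbreviation "openX \<equiv> openin (top_of_set X)"
abbreviation "B \<equiv> associated_bundle D H q \<mu> smooth"

lemma H_carrier: "b \<in> H \<Longrightarrow> b \<in> carrier G"
  using subgroup.mem_carrier[OF sub] .

lemma H_one: "braid_one \<in> H" and H_inv: "b \<in> H \<Longrightarrow> binv b \<in> H"
  and H_mult: "b \<in> H \<Longrightarrow> c \<in> H \<Longrightarrow> b \<cdot> c \<in> H"
  using sub by (simp_all add: subgroup.one_closed subgroup.m_inv_closed subgroup.m_closed)

lemma q_in: "e \<in> C \<Longrightarrow> q e \<in> X" and q_surj: "x \<in> X \<Longrightarrow> \<exists>e\<in>C. q e = x"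
  using covering_space_imp_surjective[OF cov] by (blast, metis imageE)

lemma q_act: "e \<in> C \<Longrightarrow> b \<in> H \<Longrightarrow> q (act D e b) = q e"
  using orbit[of e "act D e b"] act_closed H_carrier by metis

lemma chi_act_subset:
  assumes e: "e \<in> C" and b: "b \<in> H"
  shows "chi D H (act D e b) (rep D (binv b) f) \<subseteq> chi D H e f"
  unfolding chi_def
proof (clarify)
  fix c assume c: "c \<in> H"
  have "act D (act D e b) c = act D e (b \<cdot> c)"
    "rep D (binv c) (rep D (binv b) f) = rep D (binv (b \<cdot> c)) f"
    using e b c by (simp_all add: act_mult H_carrier rep_mult[symmetric] braid.inv_mult_group)
  then show "(act D (act D e b) c, rep D (binv c) (rep D (binv b) f))
      \<in> (\<lambda>b. (act D e b, rep D (binv b) f)) ` H"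
    using H_mult[OF b c] by auto
qed

lemma chi_act:
  assumes e: "e \<in> C" and b: "b \<in> H"
  shows "chi D H (act D e b) (rep D (binv b) f) = chi D H e f"
proof
  show "chi D H e f \<subseteq> chi D H (act D e b) (rep D (binv b) f)"
    using chi_act_subset[of "act D e b" "binv b" "rep D (binv b) f"] e b
    by (simp add: act_closed H_carrier H_inv act_inv rep_inv')
qed (rule chi_act_subset[OF assms])

lemma chi_eq_iff:
  assumes "e \<in> C" "e' \<in> C"
  shows "chi D H e f = chi D H e' f' \<longleftrightarrow> (\<exists>b\<in>H. e' = act D e b \<and> f' = rep D (binv b) f)"
proof
  assume eq: "chi D H e f = chi D H e' f'"
  have "(e', f') \<in> chi D H e' f'"
    unfolding chi_def by (rule image_eqI[of _ _ "braid_one"]) (use assms in \<open>simp_all add: act_one rep_one H_one\<close>)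
  then have "(e', f') \<in> chi D H e f" by (simp only: eq)
  then show "\<exists>b\<in>H. e' = act D e b \<and> f' = rep D (binv b) f"
    by (auto simp: chi_def)
qed (use assms chi_act in auto)

text \<open>The action on the cover is free, so an orbit contains only one pair with a given first
  component.\<close>

lemma chi_inj:
  assumes e: "e \<in> C"
  shows "chi D H e f = chi D H e g \<longleftrightarrow> f = g"
proof
  assume "chi D H e f = chi D H e g"
  then obtain b where b: "b \<in> H" "e = act D e b" "g = rep D (binv b) f"
    using chi_eq_iff[OF e e] by blast
  have "b = braid_one"
    by (rule act_inj[OF e H_carrier[OF b(1)] one_closed]) (use b e act_one in simp)
  then show "f = g" using b(3) by (simp add: rep_one)
qed simp

section \<open>Fibres, coordinates and fibrewise operations\<close>

definition fibre :: "'x \<Rightarrow> ('e, 'k) orbit set" where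
  "fibre x = {chi D H e f |e f. e \<in> C \<and> q e = x}"

text \<open>A point \<open>e\<close> of the cover is a frame of the fibre over \<open>q e\<close>.
  As \<open>e\<close> varies, the coordinates of a section form the equivariant function that
  represents it.\<close>

definition coord :: "'e \<Rightarrow> ('e, 'k) orbit \<Rightarrow> complex^'k" where
  "coord e v = (THE f. v = chi D H e f)"

lemma coord_chi [simp]: "e \<in> C \<Longrightarrow> coord e (chi D H e f) = f"
  unfolding coord_def using chi_inj by (intro the_equality) auto

lemma chi_fibre: "e \<in> C \<Longrightarrow> x = q e \<Longrightarrow> chi D H e f \<in> fibre x"
  by (auto simp: fibre_def)

lemma fibre_chi:
  assumes "v \<in> fibre (q e)" "e \<in> C"
  obtains f where "v = chi D H e f"
proof -
  obtain e' f' where e': "e' \<in> C" "q e' = q e" "v = chi D H e' f'" using assms by (auto simp: fibre_def)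
  then obtain b where "b \<in> H" "e = act D e' b" using orbit[OF e'(1) assms(2)] by blast
  then have "v = chi D H e (rep D (binv b) f')" using e' chi_act by simp
  then show ?thesis using that by blast
qed

lemma chi_coord: "e \<in> C \<Longrightarrow> v \<in> fibre (q e) \<Longrightarrow> chi D H e (coord e v) = v"
  using fibre_chi by (metis coord_chi)

lemma fibre_eqI: "e \<in> C \<Longrightarrow> v \<in> fibre (q e) \<Longrightarrow> w \<in> fibre (q e) \<Longrightarrow> coord e v = coord e w \<Longrightarrow> v = w"
  by (metis chi_coord)

lemma coord_act:
  assumes "e \<in> C" "b \<in> H" "v \<in> fibre (q e)"
  shows "coord (act D e b) v = rep D (binv b) (coord e v)"
proof -
  have "v = chi D H (act D e b) (rep D (binv b) (coord e v))"
    using assms by (simp add: chi_act chi_coord)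
  then show ?thesis
    using assms(1,2) coord_chi[of "act D e b"] by (metis act_closed H_carrier)
qed

text \<open>Representatives of two orbits with a common first component are moved by one and the
  same braid, so linearity of the representation makes the description well defined. Scaling works
  alike, and unitarity does the same for the inner product.\<close>

lemma fadd_chi: "e \<in> C \<Longrightarrow> fadd B (chi D H e f) (chi D H e g) = chi D H e (f + g)"
  unfolding associated_bundle_def hbundle.simps
proof (rule the_equality, blast)
  fix u assume e: "e \<in> C" and "\<exists>e'\<in>C. \<exists>f' g'. chi D H e f = chi D H e' f' \<and>
    chi D H e g = chi D H e' g' \<and> u = chi D H e' (f' + g')"
  then obtain e' f' g' where *: "e' \<in> C" "chi D H e f = chi D H e' f'"
    "chi D H e g = chi D H e' g'" "u = chi D H e' (f' + g')" by blast
  obtain b where b: "b \<in> H" "e' = act D e b" using chi_eq_iff[OF e *(1)] *(2) by blast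
  have "f' = rep D (binv b) f" "g' = rep D (binv b) g"
    using *(2,3) chi_act[OF e b(1)] b(2) chi_inj[OF *(1)] by metis+
  then have "f' + g' = rep D (binv b) (f + g)"
    using b by (simp add: rep_add H_carrier)
  then show "u = chi D H e (f + g)" using *(4) b chi_act[OF e b(1)] by simp
qed

lemma fscale_chi: "e \<in> C \<Longrightarrow> fscale B c (chi D H e f) = chi D H e (c *s f)"
  unfolding associated_bundle_def hbundle.simps
proof (rule the_equality, blast)
  fix u assume e: "e \<in> C" and "\<exists>e'\<in>C. \<exists>f'. chi D H e f = chi D H e' f' \<and> u = chi D H e' (c *s f')"
  then obtain e' f' where *: "e' \<in> C" "chi D H e f = chi D H e' f'" "u = chi D H e' (c *s f')" by blast
  obtain b where b: "b \<in> H" "e' = act D e b" using chi_eq_iff[OF e *(1)] *(2) by blast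
  have "f' = rep D (binv b) f"
    using *(2) chi_act[OF e b(1)] b(2) chi_inj[OF *(1)] by metis
  then have "c *s f' = rep D (binv b) (c *s f)"
    using b by (simp add: rep_scale H_carrier)
  then show "u = chi D H e (c *s f)" using *(3) b chi_act[OF e b(1)] by simp
qed

lemma finner_chi: "e \<in> C \<Longrightarrow> finner B (chi D H e f) (chi D H e g) = hinner f g"
  unfolding associated_bundle_def hbundle.simps
proof (rule the_equality, blast)
  fix c assume e: "e \<in> C" and "\<exists>e'\<in>C. \<exists>f' g'. chi D H e f = chi D H e' f' \<and>
    chi D H e g = chi D H e' g' \<and> c = hinner f' g'"
  then obtain e' f' g' where *: "e' \<in> C" "chi D H e f = chi D H e' f'"
    "chi D H e g = chi D H e' g'" "c = hinner f' g'" by blast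
  obtain b where b: "b \<in> H" "e' = act D e b" using chi_eq_iff[OF e *(1)] *(2) by blast
  have "f' = rep D (binv b) f" "g' = rep D (binv b) g"
    using *(2,3) chi_act[OF e b(1)] b(2) chi_inj[OF *(1)] by metis+
  then show "c = hinner f g" using *(4) b by (simp add: hinner_rep H_carrier)
qed

lemma base_B [simp]: "base B = \<mu>"
  and smooth_sections_B: "smooth_sections B = local_sections D H q X smooth"
  and measurable_sections_B: "measurable_sections B = local_sections D H q X borel_reg"
  by (simp_all add: associated_bundle_def)

lemma
  assumes "e \<in> C" "v \<in> fibre (q e)"
  shows coord_fadd: "w \<in> fibre (q e) \<Longrightarrow> coord e (fadd B v w) = coord e v + coord e w"
    and coord_fscale: "coord e (fscale B c v) = c *s coord e v"
    and finner_coord: "w \<in> fibre (q e) \<Longrightarrow> finner B v w = hinner (coord e v) (coord e w)"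
    and fadd_fibre: "w \<in> fibre (q e) \<Longrightarrow> fadd B v w \<in> fibre (q e)"
    and fscale_fibre: "fscale B c v \<in> fibre (q e)"
proof -
  obtain f where f: "v = chi D H e f" using assms fibre_chi by blast
  show "coord e (fscale B c v) = c *s coord e v" "fscale B c v \<in> fibre (q e)"
    using assms(1) f by (simp_all add: fscale_chi chi_fibre)
  assume "w \<in> fibre (q e)"
  then obtain g where g: "w = chi D H e g" using assms fibre_chi by blast
  show "coord e (fadd B v w) = coord e v + coord e w" "fadd B v w \<in> fibre (q e)"
    "finner B v w = hinner (coord e v) (coord e w)"
    using assms(1) f g by (simp_all add: fadd_chi finner_chi chi_fibre)
qed

section \<open>Local trivialisations and regular sections\<close>

definition lsec :: "'x set \<Rightarrow> ('x \<Rightarrow> 'e) \<Rightarrow> bool" where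
  "lsec U s \<longleftrightarrow> openX U \<and> continuous_on U s \<and> s ` U \<subseteq> C \<and> (\<forall>y\<in>U. q (s y) = y)"

lemma lsecD:
  assumes "lsec U s"
  shows "openX U" "continuous_on U s" "y \<in> U \<Longrightarrow> s y \<in> C" "y \<in> U \<Longrightarrow> q (s y) = y"
    "y \<in> U \<Longrightarrow> y \<in> X"
  using assms openin_subset[of "top_of_set X" U] by (auto simp: lsec_def)

lemma lsec_subset: "lsec U s \<Longrightarrow> openX V \<Longrightarrow> V \<subseteq> U \<Longrightarrow> lsec V s"
  by (auto simp: lsec_def intro: continuous_on_subset)

lemma ex_lsec:
  assumes "e \<in> C"
  obtains U s where "lsec U s" "q e \<in> U" "s (q e) = e"
proof -
  obtain T u s where *: "e \<in> T" "openin (top_of_set C) T" "q e \<in> u" "openX u"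
    "homeomorphism T u q s" using covering_space_local_homeomorphism[OF cov assms] by blast
  have "T \<subseteq> C" using *(2) openin_subset by fastforce
  with * have "lsec u s" "s (q e) = e"
    unfolding lsec_def homeomorphism_def by auto
  then show ?thesis using that *(3) by blast
qed

lemma ex_lsec': "x \<in> X \<Longrightarrow> \<exists>U s. lsec U s \<and> x \<in> U"
  using q_surj ex_lsec by metis

lemma openin_preimage:
  assumes "lsec U s" "openin (top_of_set C) T"
  shows "openX {y\<in>U. s y \<in> T}"
proof -
  have "openin (top_of_set U) (U \<inter> s -` T)"
    by (rule continuous_openin_preimage[OF lsecD(2)[OF assms(1)] _ assms(2)]) (use lsecD(3)[OF assms(1)] in auto)
  moreover have "U \<inter> s -` T = {y\<in>U. s y \<in> T}" by auto
  ultimately show ?thesis using lsecD(1)[OF assms(1)] openin_trans by metis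
qed

text \<open>The translate of one local section by \<open>b\<close> passes through the same point as
  the other. Near that point both take values in a single sheet, on which \<open>q\<close> is
  injective, so they coincide.\<close>

lemma lsec_agree:
  assumes 1: "lsec U s" and 2: "lsec U' s'" and x: "x \<in> U" "x \<in> U'" and b: "b \<in> H" "s' x = act D (s x) b"
  obtains V where "x \<in> V" "V \<subseteq> U" "V \<subseteq> U'" "openX V" "\<And>y. y \<in> V \<Longrightarrow> s' y = act D (s y) b"
proof -
  have 3: "lsec U (\<lambda>y. act D (s y) b)"
    unfolding lsec_def
  proof (intro conjI)
    show "continuous_on U (\<lambda>y. act D (s y) b)"
      by (rule continuous_on_compose2[OF continuous_act[OF H_carrier[OF b(1)]] lsecD(2)[OF 1]])
        (use lsecD(3)[OF 1] in auto)
  qed (use 1 b in \<open>auto simp: lsecD q_act act_closed H_carrier\<close>)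
  obtain T u r where T: "s' x \<in> T" "openin (top_of_set C) T" "homeomorphism T u q r"
    using covering_space_local_homeomorphism[OF cov lsecD(3)[OF 2 x(2)]] by metis
  let ?V = "{y\<in>U. act D (s y) b \<in> T} \<inter> {y\<in>U'. s' y \<in> T}"
  show ?thesis
  proof
    show "openX ?V"
      by (intro openin_Int openin_preimage[OF 2 T(2)] openin_preimage[OF 3 T(2)])
    show "s' y = act D (s y) b" if "y \<in> ?V" for y
      using that T(3) lsecD(4)[OF 2, of y] lsecD(4)[OF 3, of y] unfolding homeomorphism_def by (metis (no_types, lifting) IntE mem_Collect_eq)
  qed (use x b T in auto)
qed

abbreviation "LS reg \<equiv> local_sections D H q X reg"

lemma LS_fibre: "\<eta> \<in> LS reg \<Longrightarrow> x \<in> X \<Longrightarrow> \<eta> x \<in> fibre x"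
  unfolding local_sections_def fibre_def by blast

lemma LS_I:
  assumes "\<And>x. x \<in> X \<Longrightarrow> \<exists>U s. lsec U s \<and> x \<in> U \<and> reg U (\<lambda>y. coord (s y) (\<eta> y))"
    and "\<And>x. x \<in> X \<Longrightarrow> \<eta> x \<in> fibre x"
  shows "\<eta> \<in> LS reg"
  unfolding local_sections_def
proof (intro CollectI ballI)
  fix x assume "x \<in> X"
  then obtain U s where U: "lsec U s" "x \<in> U" "reg U (\<lambda>y. coord (s y) (\<eta> y))" using assms(1) by blast
  have "\<eta> y = chi D H (s y) (coord (s y) (\<eta> y))" if "y \<in> U" for y
    using lsecD[OF U(1)] that assms(2)[of y] by (metis chi_coord)
  then show "\<exists>U s f. x \<in> U \<and> openX U \<and> continuous_on U s \<and> s ` U \<subseteq> C \<and>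
      reg U f \<and> (\<forall>y\<in>U. q (s y) = y \<and> \<eta> y = chi D H (s y) (f y))"
    using U unfolding lsec_def by blast
qed

text \<open>Membership in \<open>local_sections\<close> provides some trivialisation around each
  point, but arguments need a prescribed one. Near the point the two differ by a fixed element of
  \<open>H\<close>, so the coordinates differ by a constant linear map, which preserves
  regularity.\<close>

lemma LS_coord:
  assumes reg: "regularity X reg" and \<eta>: "\<eta> \<in> LS reg" and s: "lsec U s" and x: "x \<in> U"
  shows "\<exists>V. x \<in> V \<and> V \<subseteq> U \<and> openX V \<and> reg V (\<lambda>y. coord (s y) (\<eta> y))"
proof -
  have xX: "x \<in> X" using lsecD(5)[OF s x] .
  obtain U' s' f where U': "x \<in> U'" "openX U'" "continuous_on U' s'" "s' ` U' \<subseteq> C"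
    "reg U' f" "\<forall>y\<in>U'. q (s' y) = y \<and> \<eta> y = chi D H (s' y) (f y)"
    using \<eta> xX unfolding local_sections_def by blast
  have s': "lsec U' s'" using U' unfolding lsec_def by blast
  obtain b where b: "b \<in> H" "s x = act D (s' x) b"
    using orbit[of "s' x" "s x"] lsecD(3,4)[OF s x] lsecD(3,4)[OF s' U'(1)] by metis
  obtain V where V: "x \<in> V" "V \<subseteq> U'" "V \<subseteq> U" "openX V" "\<And>y. y \<in> V \<Longrightarrow> s y = act D (s' y) b"
    using lsec_agree[OF s' s U'(1) x b] by blast
  have eq: "coord (s y) (\<eta> y) = rep D (binv b) (f y)" if "y \<in> V" for y
  proof -
    have y: "y \<in> U'" "s' y \<in> C" using V(2) that lsecD(3)[OF s'] by auto
    have "coord (s y) (\<eta> y) = rep D (binv b) (coord (s' y) (\<eta> y))"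
      using V(5)[OF that] coord_act[OF y(2) b(1)] LS_fibre[OF \<eta>, of y] lsecD(4,5)[OF s' y(1)] by metis
    then show ?thesis using U'(6) y by simp
  qed
  have "reg U' (\<lambda>y. rep D (binv b) (f y))"
    using b(1) by (intro regularityD(4)[OF reg, OF U'(2) _ U'(5)] linear_rep) (simp add: H_carrier)
  then have "reg V (\<lambda>y. coord (s y) (\<eta> y))"
    by (rule regularityD(1)[OF reg, OF U'(2) V(4,2) _ eq])
  then show ?thesis using V by blast
qed

text \<open>A relation and not an operation, tested in every frame. Sums, differences, multiples,
  the average over permutations, the rescaled pullback and, with empty index set, the zero section
  all become instances, so regularity and norm bounds are proved once.\<close>

definition lincomb :: "'i set \<Rightarrow> ('i \<Rightarrow> complex) \<Rightarrow> ('i \<Rightarrow> 'x \<Rightarrow> ('e, 'k) orbit) \<Rightarrow>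
    ('x \<Rightarrow> ('e, 'k) orbit) \<Rightarrow> bool" where
  "lincomb I c \<eta> \<zeta> \<longleftrightarrow> (\<forall>e\<in>C. \<zeta> (q e) \<in> fibre (q e) \<and>
     coord e (\<zeta> (q e)) = (\<Sum>i\<in>I. c i *s coord e (\<eta> i (q e))))"

lemma lincombD:
  assumes "lincomb I c \<eta> \<zeta>" "e \<in> C" "q e = x"
  shows "\<zeta> x \<in> fibre (q e)" "coord e (\<zeta> x) = (\<Sum>i\<in>I. c i *s coord e (\<eta> i x))"
  using assms unfolding lincomb_def by auto

lemma linear_vscale: "linear ((*s) (c::complex) :: complex^'k \<Rightarrow> complex^'k)"
  by (rule linearI) (simp_all add: vec_eq_iff algebra_simps scaleR_conv_of_real)

text \<open>All summands are read in one trivialisation, whose domain shrinks with each of them;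
  finiteness of \<open>I\<close> keeps the final domain open.\<close>

lemma LS_lincomb:
  assumes reg: "regularity X reg" and I: "finite I" and \<eta>: "\<And>i. i \<in> I \<Longrightarrow> \<eta> i \<in> LS reg"
    and \<zeta>: "lincomb I c \<eta> \<zeta>"
  shows "\<zeta> \<in> LS reg"
proof (rule LS_I)
  show "\<zeta> x \<in> fibre x" if x: "x \<in> X" for x
    using \<zeta> q_surj[OF that] by (auto simp: lincomb_def)
  fix x assume "x \<in> X"
  then obtain U s where s: "lsec U s" "x \<in> U" using ex_lsec' by blast
  have "\<exists>V. x \<in> V \<and> V \<subseteq> U \<and> openX V \<and> reg V (\<lambda>y. \<Sum>i\<in>I. c i *s coord (s y) (\<eta> i y))"
    using I \<eta>
  proof (induction I)
    case empty
    then show ?case using s lsecD(1)[OF s(1)] regularityD(2)[OF reg, OF lsecD(1)[OF s(1)]] by auto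
  next
    case (insert i I)
    obtain V where V: "x \<in> V" "V \<subseteq> U" "openX V" "reg V (\<lambda>y. \<Sum>i\<in>I. c i *s coord (s y) (\<eta> i y))"
      using insert by auto
    obtain W where W: "x \<in> W" "W \<subseteq> U" "openX W" "reg W (\<lambda>y. coord (s y) (\<eta> i y))"
      using LS_coord[OF reg _ s, of "\<eta> i"] insert.prems by auto
    have o: "openX (V \<inter> W)" using V W by blast
    note rV = regularity_mono[OF reg, OF V(3) o Int_lower1 V(4)]
    note rW = regularityD(4)[OF reg, OF o linear_vscale regularity_mono[OF reg, OF W(3) o Int_lower2 W(4)]]
    have "reg (V \<inter> W) (\<lambda>y. c i *s coord (s y) (\<eta> i y) + (\<Sum>i\<in>I. c i *s coord (s y) (\<eta> i y)))"
      by (rule regularityD(3)[OF reg, OF o rW rV])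
    then show ?case using insert.hyps V W o by (intro exI[of _ "V \<inter> W"]) auto
  qed
  then obtain V where V: "x \<in> V" "V \<subseteq> U" "openX V"
    "reg V (\<lambda>y. \<Sum>i\<in>I. c i *s coord (s y) (\<eta> i y))" by blast
  have "reg V (\<lambda>y. coord (s y) (\<zeta> y))"
  proof (rule regularityD(1)[OF reg, OF V(3) V(3) _ V(4)])
    fix y assume "y \<in> V"
    then have "s y \<in> C" "q (s y) = y" using lsecD[OF s(1)] V(2) by auto
    then show "coord (s y) (\<zeta> y) = (\<Sum>i\<in>I. c i *s coord (s y) (\<eta> i y))"
      by (rule lincombD(2)[OF \<zeta>])
  qed simp
  then show "\<exists>U s. lsec U s \<and> x \<in> U \<and> reg U (\<lambda>y. coord (s y) (\<zeta> y))"
    using V lsec_subset[OF s(1)] by blast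
qed

text \<open>Measurability can be patched together from countably many pieces only, so a countable
  subcover is extracted by the Lindelof property.\<close>

lemma borel_measurable_locally:
  fixes h :: "'x \<Rightarrow> 'y::topological_space"
  assumes "\<And>x. x \<in> X \<Longrightarrow> \<exists>U. x \<in> U \<and> openX U \<and> h \<in> borel_measurable (restrict_space borel U)"
  shows "h \<in> borel_measurable \<mu>"
proof -
  obtain N where N: "\<And>x. x \<in> X \<Longrightarrow> x \<in> N x \<and> openX (N x) \<and>
      h \<in> borel_measurable (restrict_space borel (N x))"
    using assms by metis
  have "\<Union>(N ` X) = X" using N openin_subset by fastforce
  moreover have "openX U" if "U \<in> N ` X" for U using N that by blast
  ultimately obtain \<V> where V: "countable \<V>" "\<V> \<subseteq> N ` X" "\<Union>\<V> = X"
    using Lindelof_spaceD[OF lindelof, of "N ` X"] by auto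
  show ?thesis
  proof (rule measurable_piecewise_restrict[OF V(1)])
    fix W assume "W \<in> \<V>"
    then obtain x where x: "x \<in> X" "W = N x" using V(2) by blast
    then have W: "openX W" "h \<in> borel_measurable (restrict_space borel W)" "W \<subseteq> X"
      using N[OF x(1)] openin_subset[of "top_of_set X" "N x"] by auto
    show "W \<inter> space \<mu> \<in> sets \<mu>"
      using sets_restrict_borel_openin[OF W(1)] W(3) by (simp add: sets_base[symmetric] Int_absorb2)
    have "sets (restrict_space \<mu> W) = sets (restrict_space borel W)"
      by (subst sets_restrict_space_cong[OF sets_base]) (simp add: sets_restrict_restrict_space Int_absorb1 W(3))
    then show "h \<in> borel_measurable (restrict_space \<mu> W)"
      using W(2) by (subst measurable_cong_sets[OF _ refl])
  qed (use V in simp)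
qed

lemma borel_measurable_finner:
  assumes "\<eta> \<in> LS borel_reg" "\<theta> \<in> LS borel_reg"
  shows "(\<lambda>x. finner B (\<eta> x) (\<theta> x)) \<in> borel_measurable \<mu>"
proof (rule borel_measurable_locally)
  fix x assume "x \<in> X"
  then obtain U s where s: "lsec U s" "x \<in> U" using ex_lsec' by blast
  obtain V where V: "x \<in> V" "V \<subseteq> U" "openX V" "borel_reg V (\<lambda>y. coord (s y) (\<eta> y))"
    using LS_coord[OF regularity_borel assms(1) s] by blast
  obtain W where W: "x \<in> W" "W \<subseteq> U" "openX W" "borel_reg W (\<lambda>y. coord (s y) (\<theta> y))"
    using LS_coord[OF regularity_borel assms(2) s] by blast
  have o: "openX (V \<inter> W)" using V W by blast
  have m: "borel_reg (V \<inter> W) (\<lambda>y. coord (s y) (\<eta> y))" "borel_reg (V \<inter> W) (\<lambda>y. coord (s y) (\<theta> y))"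
    by (rule regularity_mono[OF regularity_borel, OF V(3) o _ V(4)], blast)
      (rule regularity_mono[OF regularity_borel, OF W(3) o _ W(4)], blast)
  have c: "continuous_on UNIV (\<lambda>z::(complex^'k)\<times>(complex^'k). hinner (fst z) (snd z))"
    unfolding hinner_def by (intro continuous_intros)
  have "(\<lambda>y. hinner (coord (s y) (\<eta> y)) (coord (s y) (\<theta> y))) \<in> borel_measurable (restrict_space borel (V \<inter> W))"
    by (rule borel_measurable_continuous_Pair[OF m c])
  moreover have "finner B (\<eta> y) (\<theta> y) = hinner (coord (s y) (\<eta> y)) (coord (s y) (\<theta> y))" if "y \<in> V \<inter> W" for y
  proof -
    have y: "s y \<in> C" "q (s y) = y" "y \<in> X" using lsecD[OF s(1)] V(2) that by auto
    show ?thesis using finner_coord[of "s y" "\<eta> y" "\<theta> y"] LS_fibre[OF assms(1) y(3)] LS_fibre[OF assms(2) y(3)] y by simp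
  qed
  ultimately have "(\<lambda>y. finner B (\<eta> y) (\<theta> y)) \<in> borel_measurable (restrict_space borel (V \<inter> W))"
    by (subst measurable_cong[of _ _ "\<lambda>y. hinner (coord (s y) (\<eta> y)) (coord (s y) (\<theta> y))"])
      (auto simp: space_restrict_space)
  then show "\<exists>U. x \<in> U \<and> openX U \<and>
      (\<lambda>x. finner B (\<eta> x) (\<theta> x)) \<in> borel_measurable (restrict_space borel U)"
    using V W o by blast
qed

section \<open>Square integrable sections and their squared distance\<close>

abbreviation "sqint \<equiv> sq_integrable B"

definition nsq :: "('e, 'k) orbit \<Rightarrow> real" where
  "nsq v = Re (finner B v v)"

lemma nsq_coord: "e \<in> C \<Longrightarrow> v \<in> fibre (q e) \<Longrightarrow> nsq v = (norm (coord e v))\<^sup>2"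
  unfolding nsq_def by (simp add: finner_coord norm_vec_sq_hinner del: of_real_power)

lemma sqint_iff: "\<eta> \<in> sqint \<longleftrightarrow> \<eta> \<in> LS borel_reg \<and> integrable \<mu> (\<lambda>x. nsq (\<eta> x))"
  by (simp add: sq_integrable_def measurable_sections_B nsq_def)

lemma sqint_integrable: "\<eta> \<in> sqint \<Longrightarrow> integrable \<mu> (\<lambda>x. nsq (\<eta> x))"
  by (simp add: sqint_iff)

lemma sqint_fibre: "\<eta> \<in> sqint \<Longrightarrow> x \<in> X \<Longrightarrow> \<eta> x \<in> fibre x"
  using LS_fibre sqint_iff by blast

lemma sqint_fibre_q: "\<eta> \<in> sqint \<Longrightarrow> e \<in> C \<Longrightarrow> \<eta> (q e) \<in> fibre (q e)"
  using sqint_fibre q_in by blast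

lemma nsq_nonneg: "x \<in> X \<Longrightarrow> v \<in> fibre x \<Longrightarrow> 0 \<le> nsq v"
  using q_surj[of x] nsq_coord by fastforce

text \<open>Triangle inequality, then Cauchy-Schwarz against the vector with all entries 1, which is
  the origin of \<open>card I\<close>.\<close>

lemma norm_lincomb:
  assumes I: "finite I"
  shows "(norm (\<Sum>i\<in>I. c i *s (f i :: complex^'k)))\<^sup>2 \<le> real (card I) * (\<Sum>i\<in>I. (cmod (c i))\<^sup>2 * (norm (f i))\<^sup>2)"
proof -
  have n: "norm (c *s g) = cmod c * norm g" for c and g :: "complex^'k"
    by (simp add: norm_vec_def L2_set_def norm_mult power_mult_distrib sum_distrib_left[symmetric] real_sqrt_mult)
  have "norm (\<Sum>i\<in>I. c i *s f i) \<le> (\<Sum>i\<in>I. cmod (c i) * norm (f i))"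
    by (rule order_trans[OF norm_sum]) (simp add: n)
  then have "(norm (\<Sum>i\<in>I. c i *s f i))\<^sup>2 \<le> (\<Sum>i\<in>I. cmod (c i) * norm (f i))\<^sup>2"
    by (intro power_mono) auto
  also have "\<dots> \<le> (\<Sum>i\<in>I. (cmod (c i) * norm (f i))\<^sup>2) * card I"
    by (rule sum_squared_le_sum_of_squares)
  finally show ?thesis by (simp add: power_mult_distrib mult.commute)
qed

lemma nsq_lincomb:
  assumes I: "finite I" and \<eta>: "\<And>i. i \<in> I \<Longrightarrow> \<eta> i x \<in> fibre x" and \<zeta>: "lincomb I c \<eta> \<zeta>" and x: "x \<in> X"
  shows "nsq (\<zeta> x) \<le> real (card I) * (\<Sum>i\<in>I. (cmod (c i))\<^sup>2 * nsq (\<eta> i x))"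
proof -
  obtain e where e: "e \<in> C" "q e = x" using q_surj[OF x] by blast
  have "nsq (\<zeta> x) = (norm (\<Sum>i\<in>I. c i *s coord e (\<eta> i x)))\<^sup>2"
    using nsq_coord[OF e(1) lincombD(1)[OF \<zeta> e]] lincombD(2)[OF \<zeta> e] by simp
  also have "\<dots> \<le> real (card I) * (\<Sum>i\<in>I. (cmod (c i))\<^sup>2 * (norm (coord e (\<eta> i x)))\<^sup>2)"
    by (rule norm_lincomb[OF I])
  also have "(\<Sum>i\<in>I. (cmod (c i))\<^sup>2 * (norm (coord e (\<eta> i x)))\<^sup>2) = (\<Sum>i\<in>I. (cmod (c i))\<^sup>2 * nsq (\<eta> i x))"
    using e \<eta> nsq_coord by (intro sum.cong refl) metis
  finally show ?thesis .
qed

lemma borel_measurable_nsq: "\<eta> \<in> LS borel_reg \<Longrightarrow> (\<lambda>x. nsq (\<eta> x)) \<in> borel_measurable \<mu>"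
  unfolding nsq_def
  by (rule measurable_compose[OF borel_measurable_finner borel_measurable_Re])

lemma sqint_borel_measurable: "\<eta> \<in> sqint \<Longrightarrow> (\<lambda>x. nsq (\<eta> x)) \<in> borel_measurable \<mu>"
  using borel_measurable_nsq sqint_iff by blast

lemma sqint_lincomb:
  assumes I: "finite I" and \<eta>: "\<And>i. i \<in> I \<Longrightarrow> \<eta> i \<in> sqint" and \<zeta>: "lincomb I c \<eta> \<zeta>"
  shows "\<zeta> \<in> sqint"
proof -
  have 1: "\<zeta> \<in> LS borel_reg"
    by (rule LS_lincomb[OF regularity_borel I _ \<zeta>]) (use \<eta> sqint_iff in blast)
  have "integrable \<mu> (\<lambda>x. nsq (\<zeta> x))"
  proof (rule Bochner_Integration.integrable_bound)
    show "integrable \<mu> (\<lambda>x. real (card I) * (\<Sum>i\<in>I. (cmod (c i))\<^sup>2 * nsq (\<eta> i x)))"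
      using \<eta> sqint_iff by (intro integrable_mult_right Bochner_Integration.integrable_sum) auto
    show "AE x in \<mu>. norm (nsq (\<zeta> x)) \<le> norm (real (card I) * (\<Sum>i\<in>I. (cmod (c i))\<^sup>2 * nsq (\<eta> i x)))"
    proof (rule AE_I2)
      fix x assume x: "x \<in> X"
      have "nsq (\<zeta> x) \<le> real (card I) * (\<Sum>i\<in>I. (cmod (c i))\<^sup>2 * nsq (\<eta> i x))"
        by (rule nsq_lincomb[OF I _ \<zeta> x]) (use \<eta> x sqint_fibre in blast)
      then show "norm (nsq (\<zeta> x)) \<le> norm (real (card I) * (\<Sum>i\<in>I. (cmod (c i))\<^sup>2 * nsq (\<eta> i x)))"
        using nsq_nonneg[OF x LS_fibre[OF 1 x]] by simp
    qed
  qed (rule borel_measurable_nsq[OF 1])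
  with 1 show ?thesis using sqint_iff by blast
qed

abbreviation "diff \<eta> \<theta> \<equiv> \<lambda>x. fadd B (\<eta> x) (fscale B (-1) (\<theta> x))"

lemma dist_sq_diff: "dist_sq B \<eta> \<theta> = (LINT x|\<mu>. nsq (diff \<eta> \<theta> x))"
  by (simp add: dist_sq_def nsq_def)

lemma lincomb_diff:
  assumes "\<And>x. x \<in> X \<Longrightarrow> \<eta> x \<in> fibre x" "\<And>x. x \<in> X \<Longrightarrow> \<theta> x \<in> fibre x"
  shows "lincomb UNIV (\<lambda>b. if b then 1 else -1) (\<lambda>b. if b then \<eta> else \<theta>) (diff \<eta> \<theta>)"
  using assms unfolding lincomb_def
  by (auto simp: UNIV_bool q_in fadd_fibre fscale_fibre coord_fadd coord_fscale)

lemma diff_sqint: "\<eta> \<in> sqint \<Longrightarrow> \<theta> \<in> sqint \<Longrightarrow> diff \<eta> \<theta> \<in> sqint"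
  by (rule sqint_lincomb[OF _ _ lincomb_diff[OF sqint_fibre sqint_fibre]]) simp_all

lemma coord_diff:
  "e \<in> C \<Longrightarrow> v \<in> fibre (q e) \<Longrightarrow> w \<in> fibre (q e) \<Longrightarrow>
    coord e (fadd B v (fscale B (-1) w)) = coord e v - coord e w"
  by (simp add: fscale_fibre coord_fadd coord_fscale)

lemma nsq_diff:
  "e \<in> C \<Longrightarrow> v \<in> fibre (q e) \<Longrightarrow> w \<in> fibre (q e) \<Longrightarrow>
    nsq (fadd B v (fscale B (-1) w)) = (norm (coord e v - coord e w))\<^sup>2"
  by (subst nsq_coord[of e]) (simp_all add: coord_diff fadd_fibre fscale_fibre)

lemma integral_nsq_nonneg: "\<eta> \<in> sqint \<Longrightarrow> 0 \<le> (LINT x|\<mu>. nsq (\<eta> x))"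
  by (rule Bochner_Integration.integral_nonneg) (rule nsq_nonneg[OF _ sqint_fibre])

lemma dist_sq_nonneg: "\<eta> \<in> sqint \<Longrightarrow> \<theta> \<in> sqint \<Longrightarrow> 0 \<le> dist_sq B \<eta> \<theta>"
  unfolding dist_sq_diff by (intro integral_nsq_nonneg diff_sqint)

text \<open>The difference of two combinations with equal coefficients is the combination of the
  differences, so the pointwise bound \<open>nsq_lincomb\<close> integrates to this one.\<close>

lemma dist_sq_lincomb:
  assumes I: "finite I" and \<eta>: "\<And>i. i \<in> I \<Longrightarrow> \<eta> i \<in> sqint" and \<theta>: "\<And>i. i \<in> I \<Longrightarrow> \<theta> i \<in> sqint"
    and 1: "lincomb I c \<eta> \<zeta>" and 2: "lincomb I c \<theta> \<xi>"
  shows "dist_sq B \<zeta> \<xi> \<le> real (card I) * (\<Sum>i\<in>I. (cmod (c i))\<^sup>2 * dist_sq B (\<eta> i) (\<theta> i))"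
proof -
  have z: "\<zeta> \<in> sqint" "\<xi> \<in> sqint" using sqint_lincomb[OF I _ 1] sqint_lincomb[OF I _ 2] \<eta> \<theta> by blast+
  have d: "lincomb I c (\<lambda>i. diff (\<eta> i) (\<theta> i)) (diff \<zeta> \<xi>)"
    unfolding lincomb_def
  proof (intro ballI conjI)
    fix e assume e: "e \<in> C"
    have f: "\<zeta> (q e) \<in> fibre (q e)" "\<xi> (q e) \<in> fibre (q e)" using e z sqint_fibre_q by auto
    show "fadd B (\<zeta> (q e)) (fscale B (-1) (\<xi> (q e))) \<in> fibre (q e)"
      using f e by (simp add: fadd_fibre fscale_fibre)
    have "coord e (fadd B (\<zeta> (q e)) (fscale B (-1) (\<xi> (q e))))
        = (\<Sum>i\<in>I. c i *s coord e (\<eta> i (q e))) - (\<Sum>i\<in>I. c i *s coord e (\<theta> i (q e)))"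
      using 1 2 e f by (simp add: coord_diff lincomb_def)
    also have "\<dots> = (\<Sum>i\<in>I. c i *s (coord e (\<eta> i (q e)) - coord e (\<theta> i (q e))))"
      by (simp add: sum_subtractf vec_eq_iff algebra_simps)
    also have "\<dots> = (\<Sum>i\<in>I. c i *s coord e (fadd B (\<eta> i (q e)) (fscale B (-1) (\<theta> i (q e)))))"
      using e \<eta> \<theta> by (intro sum.cong refl) (simp add: coord_diff sqint_fibre_q)
    finally show "coord e (fadd B (\<zeta> (q e)) (fscale B (-1) (\<xi> (q e)))) = \<dots>" .
  qed
  have i: "integrable \<mu> (\<lambda>x. nsq (diff (\<eta> i) (\<theta> i) x))" if "i \<in> I" for i
    by (rule sqint_integrable[OF diff_sqint[OF \<eta>[OF that] \<theta>[OF that]]])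
  have "dist_sq B \<zeta> \<xi> \<le> (LINT x|\<mu>. real (card I) * (\<Sum>i\<in>I. (cmod (c i))\<^sup>2 * nsq (diff (\<eta> i) (\<theta> i) x)))"
    unfolding dist_sq_diff
  proof (rule integral_mono)
    show "integrable \<mu> (\<lambda>x. nsq (diff \<zeta> \<xi> x))" by (rule sqint_integrable[OF diff_sqint[OF z]])
    show "integrable \<mu> (\<lambda>x. real (card I) * (\<Sum>i\<in>I. (cmod (c i))\<^sup>2 * nsq (diff (\<eta> i) (\<theta> i) x)))"
      using i by (intro integrable_mult_right Bochner_Integration.integrable_sum) auto
    show "nsq (diff \<zeta> \<xi> x) \<le> real (card I) * (\<Sum>i\<in>I. (cmod (c i))\<^sup>2 * nsq (diff (\<eta> i) (\<theta> i) x))"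
      if x: "x \<in> X" for x
      by (rule nsq_lincomb[OF I _ d x]) (use diff_sqint \<eta> \<theta> sqint_fibre x in blast)
  qed
  also have "\<dots> = real (card I) * (\<Sum>i\<in>I. (cmod (c i))\<^sup>2 * dist_sq B (\<eta> i) (\<theta> i))"
    using i unfolding dist_sq_diff by (simp add: Bochner_Integration.integral_sum)
  finally show ?thesis .
qed

text \<open>Distances occur squared, so the triangle inequality is used as |a-b|^2 \<le> 2|s-a|^2 +
  2|s-b|^2. The integral of the non-negative function |a-b|^2 then vanishes, hence so does the
  function almost everywhere.\<close>

lemma dist_sq_limit_unique:
  assumes \<sigma>: "\<And>k::nat. \<sigma> k \<in> sqint" and "\<eta> \<in> sqint" "\<theta> \<in> sqint"
    and 1: "(\<lambda>k. dist_sq B (\<sigma> k) \<eta>) \<longlonglongrightarrow> 0" and 2: "(\<lambda>k. dist_sq B (\<sigma> k) \<theta>) \<longlonglongrightarrow> 0"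
  shows "AE x in \<mu>. \<eta> x = \<theta> x"
proof -
  have int: "integrable \<mu> (\<lambda>x. nsq (diff \<alpha> \<beta> x))" if "\<alpha> \<in> sqint" "\<beta> \<in> sqint" for \<alpha> \<beta>
    by (rule sqint_integrable[OF diff_sqint[OF that]])
  have le: "dist_sq B \<eta> \<theta> \<le> 2 * dist_sq B (\<sigma> k) \<eta> + 2 * dist_sq B (\<sigma> k) \<theta>" for k
  proof -
    have "dist_sq B \<eta> \<theta> \<le> (LINT x|\<mu>. 2 * nsq (diff (\<sigma> k) \<eta> x) + 2 * nsq (diff (\<sigma> k) \<theta> x))"
      unfolding dist_sq_diff
    proof (rule integral_mono)
      fix x assume x: "x \<in> X"
      obtain e where e: "e \<in> C" "q e = x" using q_surj[OF x] by blast
      have f: "\<sigma> k x \<in> fibre (q e)" "\<eta> x \<in> fibre (q e)" "\<theta> x \<in> fibre (q e)"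
        using assms x sqint_fibre e by auto
      let ?s = "coord e (\<sigma> k x)" and ?a = "coord e (\<eta> x)" and ?b = "coord e (\<theta> x)"
      have "(norm (?a - ?b))\<^sup>2 \<le> (norm (?s - ?a) + norm (?s - ?b))\<^sup>2"
        using norm_triangle_ineq4[of "?s - ?b" "?s - ?a"] by (intro power_mono) auto
      also have "\<dots> \<le> 2 * (norm (?s - ?a))\<^sup>2 + 2 * (norm (?s - ?b))\<^sup>2"
        using sum_squares_bound[of "norm (?s - ?a)" "norm (?s - ?b)"] by (simp add: power2_sum)
      finally show "nsq (diff \<eta> \<theta> x) \<le> 2 * nsq (diff (\<sigma> k) \<eta> x) + 2 * nsq (diff (\<sigma> k) \<theta> x)"
        using e f by (simp add: nsq_diff[OF e(1)])
    qed (use int assms in auto)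
    also have "\<dots> = 2 * dist_sq B (\<sigma> k) \<eta> + 2 * dist_sq B (\<sigma> k) \<theta>"
      using int assms by (simp add: dist_sq_diff)
    finally show ?thesis .
  qed
  have "(\<lambda>k. 2 * dist_sq B (\<sigma> k) \<eta> + 2 * dist_sq B (\<sigma> k) \<theta>) \<longlonglongrightarrow> 2 * 0 + 2 * 0"
    by (intro tendsto_intros 1 2)
  then have "dist_sq B \<eta> \<theta> \<le> 0"
    using le by (intro LIMSEQ_le_const[of _ 0]) auto
  then have 0: "(LINT x|\<mu>. nsq (diff \<eta> \<theta> x)) = 0"
    using dist_sq_nonneg[of \<eta> \<theta>] assms(2,3) by (simp add: dist_sq_diff)
  have "AE x in \<mu>. nsq (diff \<eta> \<theta> x) = 0"
    by (subst integral_nonneg_eq_0_iff_AE[symmetric])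
      (use 0 int assms nsq_nonneg[OF _ sqint_fibre[OF diff_sqint[OF assms(2,3)]]] in auto)
  then show ?thesis
  proof (rule AE_mp, intro AE_I2 impI)
    fix x assume x: "x \<in> X" and 0: "nsq (diff \<eta> \<theta> x) = 0"
    obtain e where e: "e \<in> C" "q e = x" using q_surj[OF x] by blast
    have f: "\<eta> x \<in> fibre (q e)" "\<theta> x \<in> fibre (q e)" using assms x sqint_fibre e by auto
    have "coord e (\<eta> x) = coord e (\<theta> x)" using 0 nsq_diff[OF e(1) f] by simp
    then show "\<eta> x = \<theta> x" using fibre_eqI[OF e(1) f] by blast
  qed
qed

section \<open>Classes modulo null sets and closures\<close>

lemma ae_class_self: "\<eta> \<in> sqint \<Longrightarrow> \<eta> \<in> ae_class B \<eta>"
  by (simp add: ae_class_def)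

lemma ae_classD: "\<theta> \<in> ae_class B \<eta> \<Longrightarrow> \<theta> \<in> sqint" "\<theta> \<in> ae_class B \<eta> \<Longrightarrow> AE x in \<mu>. \<theta> x = \<eta> x"
  unfolding ae_class_def base_B by blast+

lemma ae_class_cong:
  assumes "AE x in \<mu>. \<eta> x = \<theta> x"
  shows "ae_class B \<eta> = ae_class B \<theta>"
proof -
  have "(AE x in \<mu>. \<zeta> x = \<eta> x) \<longleftrightarrow> (AE x in \<mu>. \<zeta> x = \<theta> x)" for \<zeta>
    by (rule eventually_subst) (rule AE_mp[OF assms], auto)
  then show ?thesis by (simp only: ae_class_def base_B)
qed

lemma ae_class_eqD: "\<eta> \<in> sqint \<Longrightarrow> ae_class B \<eta> = ae_class B \<theta> \<Longrightarrow> AE x in \<mu>. \<eta> x = \<theta> x"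
  using ae_class_self ae_classD(2) by blast

text \<open>The operation is a union over representatives; changing these on null sets changes the
  sum on a null set only, so all members of the union agree.\<close>

lemma L2_add_class:
  assumes "\<eta> \<in> sqint" "\<theta> \<in> sqint"
  shows "L2_add B (ae_class B \<eta>) (ae_class B \<theta>) = ae_class B (\<lambda>x. fadd B (\<eta> x) (\<theta> x))"
proof -
  have "ae_class B (\<lambda>x. fadd B (\<eta>' x) (\<theta>' x)) = ae_class B (\<lambda>x. fadd B (\<eta> x) (\<theta> x))"
    if "\<eta>' \<in> ae_class B \<eta>" "\<theta>' \<in> ae_class B \<theta>" for \<eta>' \<theta>'
    using ae_classD(2)[OF that(1)] ae_classD(2)[OF that(2)] by (intro ae_class_cong) auto
  then have "L2_add B (ae_class B \<eta>) (ae_class B \<theta>) =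
      (\<Union>\<eta>'\<in>ae_class B \<eta>. \<Union>\<theta>'\<in>ae_class B \<theta>. ae_class B (\<lambda>x. fadd B (\<eta> x) (\<theta> x)))"
    unfolding L2_add_def by (intro SUP_cong refl) auto
  then show ?thesis using ae_class_self[OF assms(1)] ae_class_self[OF assms(2)] by auto
qed

lemma L2_scale_class:
  assumes "\<eta> \<in> sqint"
  shows "L2_scale B c (ae_class B \<eta>) = ae_class B (\<lambda>x. fscale B c (\<eta> x))"
proof -
  have "ae_class B (\<lambda>x. fscale B c (\<eta>' x)) = ae_class B (\<lambda>x. fscale B c (\<eta> x))"
    if "\<eta>' \<in> ae_class B \<eta>" for \<eta>'
    using ae_classD(2)[OF that] by (intro ae_class_cong) auto
  then have "L2_scale B c (ae_class B \<eta>) = (\<Union>\<eta>'\<in>ae_class B \<eta>. ae_class B (\<lambda>x. fscale B c (\<eta> x)))"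
    unfolding L2_scale_def by (intro SUP_cong refl) auto
  then show ?thesis using ae_class_self[OF assms] by auto
qed

lemma L2_inner_class:
  assumes "\<eta> \<in> sqint" "\<theta> \<in> sqint"
  shows "L2_inner B (ae_class B \<eta>) (ae_class B \<theta>) = (LINT x|\<mu>. finner B (\<eta> x) (\<theta> x))"
  unfolding L2_inner_def
proof (rule the_equality)
  show "\<exists>\<eta>'\<in>ae_class B \<eta>. \<exists>\<theta>'\<in>ae_class B \<theta>.
      (LINT x|\<mu>. finner B (\<eta> x) (\<theta> x)) = (LINT x|base B. finner B (\<eta>' x) (\<theta>' x))"
    using ae_class_self assms by auto
  fix c assume "\<exists>\<eta>'\<in>ae_class B \<eta>. \<exists>\<theta>'\<in>ae_class B \<theta>. c = (LINT x|base B. finner B (\<eta>' x) (\<theta>' x))"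
  then obtain \<eta>' \<theta>' where *: "\<eta>' \<in> ae_class B \<eta>" "\<theta>' \<in> ae_class B \<theta>"
    "c = (LINT x|\<mu>. finner B (\<eta>' x) (\<theta>' x))" by auto
  have "(LINT x|\<mu>. finner B (\<eta>' x) (\<theta>' x)) = (LINT x|\<mu>. finner B (\<eta> x) (\<theta> x))"
    using ae_classD[OF *(1)] ae_classD[OF *(2)] assms
    by (intro integral_cong_AE borel_measurable_finner) (auto simp: sqint_iff)
  then show "c = (LINT x|\<mu>. finner B (\<eta> x) (\<theta> x))" using *(3) by simp
qed

lemma L2_closureI:
  assumes "\<eta> \<in> sqint" "\<And>k::nat. \<sigma> k \<in> S" "(\<lambda>k. dist_sq B (\<sigma> k) \<eta>) \<longlonglongrightarrow> 0"
  shows "ae_class B \<eta> \<in> L2_closure B S"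
  using assms unfolding L2_closure_def by blast

lemma L2_closureE:
  assumes "Y \<in> L2_closure B S"
  obtains \<eta> \<sigma> where "\<eta> \<in> sqint" "Y = ae_class B \<eta>" "\<And>k::nat. \<sigma> k \<in> S" "(\<lambda>k. dist_sq B (\<sigma> k) \<eta>) \<longlonglongrightarrow> 0"
  using assms unfolding L2_closure_def by blast

lemma lincomb_add:
  assumes "\<And>x. x \<in> X \<Longrightarrow> \<eta> x \<in> fibre x" "\<And>x. x \<in> X \<Longrightarrow> \<theta> x \<in> fibre x"
  shows "lincomb UNIV (\<lambda>b. 1) (\<lambda>b. if b then \<eta> else \<theta>) (\<lambda>x. fadd B (\<eta> x) (\<theta> x))"
  using assms unfolding lincomb_def by (auto simp: UNIV_bool q_in fadd_fibre coord_fadd)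

lemma lincomb_scale:
  assumes "\<And>x. x \<in> X \<Longrightarrow> \<eta> x \<in> fibre x"
  shows "lincomb (UNIV::unit set) (\<lambda>_. c) (\<lambda>_. \<eta>) (\<lambda>x. fscale B c (\<eta> x))"
  using assms unfolding lincomb_def by (auto simp: q_in fscale_fibre coord_fscale)

text \<open>The same combination applied to the approximants approximates the combination of the
  limits, by \<open>dist_sq_lincomb\<close>. The condition on \<open>\<tau>\<close> is where
  closedness of \<open>S\<close> under the operation enters.\<close>

lemma L2_closure_lincomb:
  assumes S: "S \<subseteq> sqint" and I: "finite I" and \<eta>: "\<And>i. i \<in> I \<Longrightarrow> \<eta> i \<in> sqint"
    and \<sigma>: "\<And>i k. i \<in> I \<Longrightarrow> \<sigma> i k \<in> S" and lim: "\<And>i. i \<in> I \<Longrightarrow> (\<lambda>k::nat. dist_sq B (\<sigma> i k) (\<eta> i)) \<longlonglongrightarrow> 0"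
    and \<zeta>: "lincomb I c \<eta> \<zeta>" and \<tau>: "\<And>k. lincomb I c (\<lambda>i. \<sigma> i k) (\<tau> k)" "\<And>k. \<tau> k \<in> S"
  shows "ae_class B \<zeta> \<in> L2_closure B S"
proof (rule L2_closureI[OF _ \<tau>(2)])
  show sq: "\<zeta> \<in> sqint" by (rule sqint_lincomb[OF I \<eta> \<zeta>])
  have le: "dist_sq B (\<tau> k) \<zeta> \<le> real (card I) * (\<Sum>i\<in>I. (cmod (c i))\<^sup>2 * dist_sq B (\<sigma> i k) (\<eta> i))" for k
    by (rule dist_sq_lincomb[OF I _ \<eta> \<tau>(1) \<zeta>]) (use \<sigma> S in auto)
  have "(\<lambda>k. real (card I) * (\<Sum>i\<in>I. (cmod (c i))\<^sup>2 * dist_sq B (\<sigma> i k) (\<eta> i)))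
      \<longlonglongrightarrow> real (card I) * (\<Sum>i\<in>I. (cmod (c i))\<^sup>2 * 0)"
    by (intro tendsto_mult_left tendsto_sum lim)
  then have 0: "(\<lambda>k. real (card I) * (\<Sum>i\<in>I. (cmod (c i))\<^sup>2 * dist_sq B (\<sigma> i k) (\<eta> i))) \<longlonglongrightarrow> 0"
    by simp
  show "(\<lambda>k. dist_sq B (\<tau> k) \<zeta>) \<longlonglongrightarrow> 0"
    by (rule tendsto_zero_squeeze[OF dist_sq_nonneg[OF subsetD[OF S \<tau>(2)] sq] le 0])
qed

lemma L2_closure_add:
  assumes S: "S \<subseteq> sqint" "\<And>\<eta> \<theta>. \<eta> \<in> S \<Longrightarrow> \<theta> \<in> S \<Longrightarrow> (\<lambda>x. fadd B (\<eta> x) (\<theta> x)) \<in> S"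
    and Y: "Y \<in> L2_closure B S" "Z \<in> L2_closure B S"
  shows "L2_add B Y Z \<in> L2_closure B S"
proof -
  obtain \<eta> \<sigma> where 1: "\<eta> \<in> sqint" "Y = ae_class B \<eta>" "\<And>k::nat. \<sigma> k \<in> S" "(\<lambda>k. dist_sq B (\<sigma> k) \<eta>) \<longlonglongrightarrow> 0"
    using L2_closureE[OF Y(1)] by metis
  obtain \<theta> \<tau> where 2: "\<theta> \<in> sqint" "Z = ae_class B \<theta>" "\<And>k::nat. \<tau> k \<in> S" "(\<lambda>k. dist_sq B (\<tau> k) \<theta>) \<longlonglongrightarrow> 0"
    using L2_closureE[OF Y(2)] by metis
  have st: "\<sigma> k \<in> sqint" "\<tau> k \<in> sqint" for k using S(1) 1(3) 2(3) by auto
  show ?thesis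
    unfolding 1(2) 2(2) L2_add_class[OF 1(1) 2(1)]
    by (rule L2_closure_lincomb[where \<sigma> = "\<lambda>b k. if b then \<sigma> k else \<tau> k", OF S(1) _ _ _ _
          lincomb_add[OF sqint_fibre[OF 1(1)] sqint_fibre[OF 2(1)]]
          lincomb_add[OF sqint_fibre[OF st(1)] sqint_fibre[OF st(2)]] S(2)[OF 1(3) 2(3)]])
      (simp_all add: 1 2)
qed

lemma L2_closure_scale:
  assumes S: "S \<subseteq> sqint" "\<And>\<eta>. \<eta> \<in> S \<Longrightarrow> (\<lambda>x. fscale B c (\<eta> x)) \<in> S"
    and Y: "Y \<in> L2_closure B S"
  shows "L2_scale B c Y \<in> L2_closure B S"
proof -
  obtain \<eta> \<sigma> where 1: "\<eta> \<in> sqint" "Y = ae_class B \<eta>" "\<And>k::nat. \<sigma> k \<in> S" "(\<lambda>k. dist_sq B (\<sigma> k) \<eta>) \<longlonglongrightarrow> 0"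
    using L2_closureE[OF Y] by metis
  have st: "\<sigma> k \<in> sqint" for k using S(1) 1(3) by auto
  show ?thesis
    unfolding 1(2) L2_scale_class[OF 1(1)]
    by (rule L2_closure_lincomb[where \<sigma> = "\<lambda>_. \<sigma>", OF S(1) _ _ _ _ lincomb_scale[OF sqint_fibre[OF 1(1)]]
          lincomb_scale[OF sqint_fibre[OF st]] S(2)[OF 1(3)]])
      (simp_all add: 1)
qed

text \<open>A frame over each base point is picked by choice. The coordinate 0 in one frame is 0 in
  all frames, since the representation is linear. This section witnesses that the invariant subspace
  is inhabited.\<close>

lemma zero_section:
  obtains \<zeta> where "lincomb {} (\<lambda>_::unit. 0) (\<lambda>_. \<zeta>) \<zeta>"
proof
  let ?e = "\<lambda>x. SOME e. e \<in> C \<and> q e = x"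
  show "lincomb {} (\<lambda>_::unit. 0) (\<lambda>_. \<lambda>x. chi D H (?e x) 0) (\<lambda>x. chi D H (?e x) 0)"
    unfolding lincomb_def
  proof (intro ballI conjI)
    fix e assume e: "e \<in> C"
    have *: "?e (q e) \<in> C" "q (?e (q e)) = q e" using someI[of "\<lambda>e'. e' \<in> C \<and> q e' = q e" e] e by auto
    then show f: "chi D H (?e (q e)) 0 \<in> fibre (q e)" by (auto simp: fibre_def)
    obtain b where b: "b \<in> H" "e = act D (?e (q e)) b" using orbit[OF *(1) e] * by auto
    have "coord (act D (?e (q e)) b) (chi D H (?e (q e)) 0) = 0"
      by (subst coord_act[OF *(1) b(1)])
        (use * f b in \<open>simp_all add: H_carrier linear_0[OF linear_rep] H_inv\<close>)
    then show "coord e (chi D H (?e (q e)) 0) = (\<Sum>i\<in>{}. 0 *s coord e (chi D H (?e (q e)) 0))"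
      using b(2) by simp
  qed
qed

lemma smooth_lincomb:
  "finite I \<Longrightarrow> (\<And>i. i \<in> I \<Longrightarrow> \<eta> i \<in> smooth_sections B) \<Longrightarrow> lincomb I c \<eta> \<zeta> \<Longrightarrow> \<zeta> \<in> smooth_sections B"
  unfolding smooth_sections_B by (rule LS_lincomb[OF smooth])

end

section \<open>Momentum spaces and the measures on configurations\<close>

text \<open>All that is used about the one-particle space: sigma-finiteness for the product measure,
  measurability of the point set for restricting to configurations, continuity of the
  parametrisation for open coordinate domains.\<close>

definition momentum_ok :: "('a::euclidean_space) momentum_space \<Rightarrow> bool" where
  "momentum_ok M \<longleftrightarrow> continuous_on UNIV (param M) \<and> range (param M) \<subseteq> points M \<and>
     points M \<in> sets borel \<and> sets (vol M) = sets borel \<and> sigma_finite_measure (vol M)"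

lemma momentum_okD:
  assumes "momentum_ok M"
  shows "continuous_on UNIV (param M)" "range (param M) \<subseteq> points M" "points M \<in> sets borel"
    "sets (vol M) = sets borel" "sigma_finite_measure (vol M)"
  using assms by (simp_all add: momentum_ok_def)

lemma momentum_ok_plane: "momentum_ok plane"
  by (simp add: momentum_ok_def plane_def sigma_finite_lborel)

lemma continuous_shell_param: "continuous_on A (shell_param m)"
  unfolding shell_param_def
proof (rule continuous_on_vec_lambda)
  fix i :: 3
  show "continuous_on A (\<lambda>q. if i = 0 then sqrt ((q$1)\<^sup>2 + (q$2)\<^sup>2 + m\<^sup>2) else if i = 1 then q$1 else q$2)"
    by (cases "i = 0"; cases "i = 1") (auto intro!: continuous_intros)
qed

text \<open>Forgetting the energy component shortens a vector, so the parametrisation pulls balls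
  back to bounded sets.\<close>

lemma norm_shell_param: "norm q \<le> norm (shell_param m q)"
proof -
  have "(norm q)\<^sup>2 = (q$1)\<^sup>2 + (q$2)\<^sup>2"
    by (simp add: norm_vec_def L2_set_def UNIV_2)
  also have "\<dots> = (\<Sum>i\<in>{1, 2}. (shell_param m q $ i)\<^sup>2)"
    by (simp add: shell_param_def)
  also have "\<dots> \<le> (\<Sum>i\<in>UNIV. (shell_param m q $ i)\<^sup>2)"
    by (rule sum_mono2) auto
  also have "\<dots> = (norm (shell_param m q))\<^sup>2"
    by (simp add: norm_vec_def L2_set_def sum_nonneg)
  finally show ?thesis by (rule power2_le_imp_le) simp
qed

text \<open>The substantial point is sigma-finiteness, by exhaustion with balls of integer radius:
  the density is bounded, and the part of the plane parametrising a ball is contained in a disc of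
  finite Lebesgue measure.\<close>

lemma momentum_ok_mass_shell:
  assumes m: "0 < m"
  shows "momentum_ok (mass_shell m)"
proof -
  let ?d = "density lborel (\<lambda>q::real^2. ennreal (1 / (2 * sqrt ((q$1)\<^sup>2 + (q$2)\<^sup>2 + m\<^sup>2))))"
  let ?v = "distr ?d borel (shell_param m)"
  have meas: "shell_param m \<in> borel_measurable borel"
    by (rule borel_measurable_continuous_onI[OF continuous_shell_param])
  have dm: "(\<lambda>q::real^2. ennreal (1 / (2 * sqrt ((q$1)\<^sup>2 + (q$2)\<^sup>2 + m\<^sup>2)))) \<in> borel_measurable borel"
    using m by (intro measurable_compose[OF _ measurable_ennreal] borel_measurable_continuous_onI continuous_intros)
      (smt (verit) not_sum_power2_lt_zero real_sqrt_eq_zero_cancel_iff zero_less_power)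
  have fin: "emeasure ?v (cball 0 (real k)) \<noteq> \<infinity>" for k
  proof -
    have sub: "shell_param m -` cball 0 (real k) \<subseteq> cball 0 (real k)"
      using norm_shell_param order_trans by (fastforce simp: dist_norm)
    have c: "cball 0 (real k) \<in> sets (borel :: (real^3) measure)" by simp
    have pre: "shell_param m -` cball 0 (real k) \<in> sets borel"
      using measurable_sets[OF meas c] by simp
    \<comment> \<open>The energy is at least the mass, so the density is largest at zero momentum;
      positivity of \<open>m\<close> makes this value finite.\<close>
    have bound: "1 / (2 * sqrt ((q$1)\<^sup>2 + (q$2)\<^sup>2 + m\<^sup>2)) \<le> 1 / (2 * m)" for q :: "real^2"
    proof -
      have "m \<le> sqrt ((q$1)\<^sup>2 + (q$2)\<^sup>2 + m\<^sup>2)"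
        by (rule real_le_rsqrt) simp
      with m show ?thesis by (intro divide_left_mono mult_pos_pos) linarith+
    qed
    have "emeasure ?v (cball 0 (real k)) = emeasure ?d (shell_param m -` cball 0 (real k))"
      using meas by (subst emeasure_distr) auto
    also have "\<dots> = (\<integral>\<^sup>+q. ennreal (1 / (2 * sqrt ((q$1)\<^sup>2 + (q$2)\<^sup>2 + m\<^sup>2))) *
        indicator (shell_param m -` cball 0 (real k)) q \<partial>lborel)"
      using dm pre by (intro emeasure_density) auto
    also have "\<dots> \<le> (\<integral>\<^sup>+q. ennreal (1 / (2 * m)) * indicator (cball 0 (real k)) (q :: real^2) \<partial>lborel)"
    proof (rule nn_integral_mono)
      fix q :: "real^2"
      have "indicator (shell_param m -` cball 0 (real k)) q \<le> (indicator (cball 0 (real k)) q :: ennreal)"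
        using sub by (auto split: split_indicator)
      then show "ennreal (1 / (2 * sqrt ((q$1)\<^sup>2 + (q$2)\<^sup>2 + m\<^sup>2))) * indicator (shell_param m -` cball 0 (real k)) q
          \<le> ennreal (1 / (2 * m)) * indicator (cball 0 (real k)) q"
        by (intro mult_mono ennreal_leI bound) auto
    qed
    also have "\<dots> = ennreal (1 / (2 * m)) * emeasure lborel (cball (0::real^2) (real k))"
      by (simp add: nn_integral_cmult_indicator)
    also have "\<dots> < \<infinity>"
      using emeasure_lborel_cball_finite[of "0::real^2" "real k"] by (simp add: ennreal_mult_less_top)
    finally show ?thesis by simp
  qed
  have sf: "sigma_finite_measure ?v"
  proof
    show "\<exists>A. countable A \<and> A \<subseteq> sets ?v \<and> \<Union>A = space ?v \<and> (\<forall>a\<in>A. emeasure ?v a \<noteq> \<infinity>)"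
    proof (intro exI[of _ "range (\<lambda>k::nat. cball 0 (real k))"] conjI)
      show "\<Union>(range (\<lambda>k::nat. cball (0::real^3) (real k))) = space ?v"
        by (auto simp: dist_norm) (meson real_arch_simple)
    qed (use fin in auto)
  qed
  have cl: "closed {p::real^3. p$0 = sqrt ((p$1)\<^sup>2 + (p$2)\<^sup>2 + m\<^sup>2)}"
    by (intro closed_Collect_eq continuous_intros)
  show ?thesis
    unfolding momentum_ok_def mass_shell_def momentum_space.simps
    using sf borel_closed[OF cl] continuous_shell_param[of UNIV m] by (auto simp: shell_param_def)
qed

section \<open>The product measure and its invariance under permutations\<close>

lemma measurable_vec_lambda:
  assumes "sets (N :: 'a::euclidean_space measure) = sets borel"
  shows "(\<lambda>p. \<chi> i. p i) \<in> borel_measurable (\<Pi>\<^sub>M i\<in>(UNIV::'n::finite set). N)"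
proof (subst borel_measurable_euclidean_space, intro ballI)
  fix b :: "'a^'n" assume "b \<in> Basis"
  then obtain j u where b: "b = axis j u" "u \<in> Basis" by (auto simp: Basis_vec_def)
  have "(\<lambda>p. p j) \<in> measurable (\<Pi>\<^sub>M i\<in>(UNIV::'n set). N) N"
    by (rule measurable_component_singleton) simp
  then have "(\<lambda>p. p j) \<in> borel_measurable (\<Pi>\<^sub>M i\<in>(UNIV::'n set). N)"
    using measurable_cong_sets[OF refl assms] by blast
  then have "(\<lambda>p. p j \<bullet> u) \<in> borel_measurable (\<Pi>\<^sub>M i\<in>(UNIV::'n set). N)"
    by measurable
  then show "(\<lambda>p. (\<chi> i. p i) \<bullet> b) \<in> borel_measurable (\<Pi>\<^sub>M i\<in>(UNIV::'n set). N)"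
    by (simp add: b inner_axis)
qed

text \<open>A product measure is determined by its values on boxes. The preimage of a box has the
  same sides in an order given by the inverse permutation, and a finite product does not see the
  order.\<close>

lemma distr_PiM_permute:
  fixes N :: "'a measure" and \<pi> :: "'n::finite \<Rightarrow> 'n"
  assumes N: "sigma_finite_measure N" and \<pi>: "\<pi> \<in> perms"
  shows "distr (\<Pi>\<^sub>M i\<in>UNIV. N) (\<Pi>\<^sub>M i\<in>UNIV. N) (\<lambda>p i. p (\<pi> i)) = (\<Pi>\<^sub>M i\<in>UNIV. N)"
proof -
  interpret product_sigma_finite "\<lambda>_::'n. N"
    by (rule product_sigma_finite.intro) (rule N)
  have meas: "(\<lambda>p i. p (\<pi> i)) \<in> measurable (\<Pi>\<^sub>M i\<in>UNIV. N) (\<Pi>\<^sub>M i\<in>UNIV. N)"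
    by (rule measurable_PiM_single') (auto simp: space_PiM)
  let ?\<sigma> = "inv_into UNIV \<pi>"
  have inv: "?\<sigma> (\<pi> i) = i" "\<pi> (?\<sigma> i) = i" for i
    using perms_inv_comp[OF \<pi>] by (auto simp: fun_eq_iff)
  show ?thesis
  proof (rule PiM_eqI)
    fix A :: "'n \<Rightarrow> 'a set" assume A: "\<And>i. i \<in> UNIV \<Longrightarrow> A i \<in> sets N"
    have "(\<lambda>p i. p (\<pi> i)) -` (\<Pi>\<^sub>E i\<in>UNIV. A i) \<inter> space (\<Pi>\<^sub>M i\<in>UNIV. N) = (\<Pi>\<^sub>E i\<in>UNIV. A (?\<sigma> i))"
    proof (intro Set.set_eqI iffI)
      fix p assume "p \<in> (\<lambda>p i. p (\<pi> i)) -` (\<Pi>\<^sub>E i\<in>UNIV. A i) \<inter> space (\<Pi>\<^sub>M i\<in>UNIV. N)"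
      then have "p (\<pi> j) \<in> A j" for j by auto
      from this[of "?\<sigma> i" for i] show "p \<in> (\<Pi>\<^sub>E i\<in>UNIV. A (?\<sigma> i))" by (auto simp: inv)
    next
      fix p assume p: "p \<in> (\<Pi>\<^sub>E i\<in>UNIV. A (?\<sigma> i))"
      then have pa: "p i \<in> A (?\<sigma> i)" for i by auto
      have "p \<in> space (\<Pi>\<^sub>M i\<in>UNIV. N)"
        using pa A[THEN sets.sets_into_space] by (auto simp: space_PiM)
      moreover have "p (\<pi> j) \<in> A j" for j using pa[of "\<pi> j"] by (simp add: inv)
      ultimately show "p \<in> (\<lambda>p i. p (\<pi> i)) -` (\<Pi>\<^sub>E i\<in>UNIV. A i) \<inter> space (\<Pi>\<^sub>M i\<in>UNIV. N)" by auto
    qed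
    then have "emeasure (distr (\<Pi>\<^sub>M i\<in>UNIV. N) (\<Pi>\<^sub>M i\<in>UNIV. N) (\<lambda>p i. p (\<pi> i))) (\<Pi>\<^sub>E i\<in>UNIV. A i)
        = emeasure (\<Pi>\<^sub>M i\<in>UNIV. N) (\<Pi>\<^sub>E i\<in>UNIV. A (?\<sigma> i))"
      using A by (subst emeasure_distr[OF meas]) (auto intro!: sets_PiM_I_finite)
    also have "\<dots> = (\<Prod>i\<in>UNIV. emeasure N (A (?\<sigma> i)))"
      using A by (intro emeasure_PiM) auto
    also have "\<dots> = (\<Prod>i\<in>UNIV. emeasure N (A i))"
      using perms_inv[OF \<pi>] by (intro prod.reindex_bij_betw[of ?\<sigma> UNIV UNIV "\<lambda>i. emeasure N (A i)"])
        (simp add: perms_def)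
    finally show "emeasure (distr (\<Pi>\<^sub>M i\<in>UNIV. N) (\<Pi>\<^sub>M i\<in>UNIV. N) (\<lambda>p i. p (\<pi> i))) (\<Pi>\<^sub>E i\<in>UNIV. A i)
        = (\<Prod>i\<in>UNIV. emeasure N (A i))" .
  qed simp_all
qed

lemma open_distinct_entries: "open {p::'a::euclidean_space^'n::finite. \<not> (\<exists>i j. i \<noteq> j \<and> p$i = p$j)}"
proof -
  have "{p::'a^'n. \<not> (\<exists>i j. i \<noteq> j \<and> p$i = p$j)} = (\<Inter>i. \<Inter>j. if i = j then UNIV else {p. p$i \<noteq> p$j})"
    by (auto split: if_splits)
  moreover have "open (if i = j then UNIV else {p::'a^'n. p$i \<noteq> p$j})" for i j
    by (auto intro!: open_Collect_neq continuous_intros)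
  ultimately show ?thesis by (simp only:) (intro open_INT ballI finite)
qed

lemma conf_borel:
  assumes "momentum_ok M"
  shows "(conf M :: ('a::euclidean_space^'n::finite) set) \<in> sets borel"
proof -
  have "conf M = (\<Inter>i. (\<lambda>p. p$i) -` points M) \<inter> {p::'a^'n. \<not> (\<exists>i j. i \<noteq> j \<and> p$i = p$j)}"
    by (auto simp: conf_def)
  moreover have "(\<lambda>p::'a^'n. p$i) -` points M \<in> sets borel" for i
  proof -
    have "(\<lambda>p::'a^'n. p$i) \<in> borel_measurable borel"
      by (intro borel_measurable_continuous_onI continuous_intros)
    from measurable_sets[OF this momentum_okD(3)[OF assms]] show ?thesis by simp
  qed
  ultimately show ?thesis
    using borel_open[OF open_distinct_entries] by (auto intro!: sets.Int sets.countable_INT'')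
qed

lemma space_conf_measure: "space (conf_measure M) = conf M"
  and sets_conf_measure: "sets (conf_measure M) = sets (restrict_space borel (conf M))"
  by (simp_all add: conf_measure_def space_restrict_space sets_restrict_space)

lemma measurable_permute_conf:
  assumes \<pi>: "\<pi> \<in> perms"
  shows "(\<lambda>p. permute p \<pi>) \<in> measurable (conf_measure M) (conf_measure (M :: 'a::euclidean_space momentum_space) :: ('a^'n::finite) measure)"
proof -
  have "(\<lambda>p. permute p \<pi>) \<in> measurable (restrict_space borel (conf M)) (restrict_space borel (conf M :: ('a^'n) set))"
    using conf_permute[OF _ \<pi>]
    by (intro measurable_restrict_space3 borel_measurable_continuous_onI continuous_on_permute) auto
  then show ?thesis
    using measurable_cong_sets[OF sets_conf_measure sets_conf_measure] by blast
qed

text \<open>Invariance is carried from functions on the index set to vectors, where it survives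
  restriction because \<open>conf M\<close> is itself stable under permutations.\<close>

lemma distr_permute_conf:
  assumes M: "momentum_ok M" and \<pi>: "\<pi> \<in> perms"
  shows "distr (conf_measure M) (conf_measure M) (\<lambda>p. permute p \<pi>)
    = (conf_measure (M :: 'a::euclidean_space momentum_space) :: ('a^'n::finite) measure)"
proof -
  let ?P = "\<Pi>\<^sub>M i\<in>(UNIV::'n set). vol M" and ?v = "\<lambda>p. (\<chi> i. p i) :: 'a^'n"
  let ?N = "distr ?P borel ?v" and ?f = "\<lambda>p::'a^'n. permute p \<pi>"
  have v: "?v \<in> borel_measurable ?P" by (rule measurable_vec_lambda[OF momentum_okD(4)[OF M]])
  have f: "?f \<in> borel_measurable borel"
    by (intro borel_measurable_continuous_onI continuous_on_permute)
  have r: "(\<lambda>p i. p (\<pi> i)) \<in> measurable ?P ?P"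
    by (rule measurable_PiM_single') (auto simp: space_PiM)
  have "distr ?N borel ?f = distr ?P borel (?f \<circ> ?v)"
    by (rule distr_distr[OF f v])
  also have "?f \<circ> ?v = ?v \<circ> (\<lambda>p i. p (\<pi> i))"
    by (simp add: fun_eq_iff permute_def)
  also have "distr ?P borel (?v \<circ> (\<lambda>p i. p (\<pi> i))) = distr (distr ?P ?P (\<lambda>p i. p (\<pi> i))) borel ?v"
    by (rule distr_distr[OF v r, symmetric])
  also have "distr ?P ?P (\<lambda>p i. p (\<pi> i)) = ?P"
    by (rule distr_PiM_permute[OF momentum_okD(5)[OF M] \<pi>])
  finally have N: "distr ?N borel ?f = ?N" .
  have cb: "conf M \<inter> space ?N \<in> sets ?N" using conf_borel[OF M] by simp
  show ?thesis
  proof (rule measure_eqI)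
    fix A assume "A \<in> sets (distr (conf_measure M) (conf_measure M) ?f)"
    then have A: "A \<in> sets (conf_measure M)" by simp
    then have Ac: "A \<subseteq> conf M" "A \<in> sets borel"
      using sets_restrict_space_iff[OF cb] by (auto simp: conf_measure_def)
    have pre: "?f -` A \<subseteq> conf M" using Ac(1) conf_permute_iff[OF \<pi>, of _ M] by blast
    have "emeasure (distr (conf_measure M) (conf_measure M) ?f) A = emeasure (conf_measure M) (?f -` A)"
      using pre by (subst emeasure_distr[OF measurable_permute_conf[OF \<pi>] A])
        (simp add: space_conf_measure Int_absorb2)
    also have "\<dots> = emeasure ?N (?f -` A)"
      unfolding conf_measure_def using pre by (intro emeasure_restrict_space cb)
    also have "\<dots> = emeasure (distr ?N borel ?f) A"
      using f Ac(2) by (subst emeasure_distr) auto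
    also have "\<dots> = emeasure (conf_measure M) A"
      unfolding N unfolding conf_measure_def using Ac by (intro emeasure_restrict_space[symmetric] cb)
    finally show "emeasure (distr (conf_measure M) (conf_measure M) ?f) A = emeasure (conf_measure M) A" .
  qed simp
qed

lemma
  fixes h :: "'a::euclidean_space^'n::finite \<Rightarrow> real"
  assumes M: "momentum_ok M" and \<pi>: "\<pi> \<in> perms" and h: "h \<in> borel_measurable (conf_measure M)"
  shows integrable_permute: "integrable (conf_measure M) (\<lambda>p. h (permute p \<pi>)) \<longleftrightarrow> integrable (conf_measure M) h"
    and integral_permute: "(LINT p|conf_measure M. h (permute p \<pi>)) = (LINT p|conf_measure M. h p)"
  using integrable_distr_eq[OF measurable_permute_conf[OF \<pi>] h]
    integral_distr[OF measurable_permute_conf[OF \<pi>] h]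
  by (simp_all add: distr_permute_conf[OF M \<pi>])

lemma AE_permute:
  assumes M: "momentum_ok M" and \<pi>: "\<pi> \<in> perms"
    and P: "AE p in (conf_measure M :: ('a::euclidean_space^'n::finite) measure). P p"
  shows "AE p in conf_measure M. P (permute p \<pi>)"
  using AE_distrD[OF measurable_permute_conf[OF \<pi>], of P M] P by (simp only: distr_permute_conf[OF M \<pi>])

section \<open>The quotient map as a local homeomorphism\<close>

lemma pr_conf_iff: "pr (p :: 'a^'n::finite) \<in> nconf M \<longleftrightarrow> p \<in> conf M"
proof
  assume "pr p \<in> nconf M"
  then obtain p' where p': "p' \<in> conf M" "pr p' = pr p" by (auto simp: nconf_def)
  then obtain \<pi> where "\<pi> \<in> perms" "p = permute p' \<pi>" using pr_eq_iff by blast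
  then show "p \<in> conf M" using conf_permute p'(1) by simp
qed (simp add: nconf_def)

text \<open>The saturation of a set is the union of its preimages under the permutations, each of
  which acts continuously.\<close>

lemma open_pr_image:
  assumes "open (S :: ('a::topological_space^'n::finite) set)"
  shows "open (pr ` S)"
proof -
  have "p \<in> pr -` pr ` S \<longleftrightarrow> (\<exists>\<pi>\<in>perms. permute p \<pi> \<in> S)" for p
    using pr_eq_iff[of p] by (auto simp: image_iff)
  then have "pr -` pr ` S = (\<Union>\<pi>\<in>perms. (\<lambda>p. permute p \<pi>) -` S)" by blast
  moreover have "open ((\<lambda>p. permute p \<pi>) -` S)" for \<pi>
    using assms by (rule open_vimage) (rule continuous_on_permute)
  ultimately show ?thesis by (auto simp: open_sym_power_def)
qed

abbreviation "open_conf M \<equiv> openin (top_of_set (conf M))"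
abbreviation "open_nconf M \<equiv> openin (top_of_set (nconf M))"

lemma openin_pr_image:
  assumes "open_conf M (V :: ('a::euclidean_space^'n::finite) set)"
  shows "open_nconf M (pr ` V)"
proof -
  obtain T where T: "open T" "V = conf M \<inter> T" using assms by (auto simp: openin_open)
  have "pr ` V = nconf M \<inter> pr ` T"
  proof
    show "nconf M \<inter> pr ` T \<subseteq> pr ` V" using T(2) pr_conf_iff by blast
  qed (auto simp: T(2) nconf_def)
  then show ?thesis using open_pr_image[OF T(1)] by (auto simp: openin_open)
qed

lemma openin_pr_vimage:
  assumes "open_nconf M U"
  shows "open_conf M (conf M \<inter> pr -` U)"
  by (rule continuous_openin_preimage[OF continuous_on_pr _ assms]) (auto simp: nconf_def)

lemma openin_permute_vimage:
  assumes \<pi>: "\<pi> \<in> perms" and V: "open_conf M (V :: ('a::euclidean_space^'n::finite) set)"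
  shows "open_conf M ((\<lambda>p. permute p \<pi>) -` V)"
proof -
  have "open_conf M (conf M \<inter> (\<lambda>p. permute p \<pi>) -` V)"
    by (rule continuous_openin_preimage[OF continuous_on_permute _ V]) (use conf_permute[OF _ \<pi>] in auto)
  moreover have "V \<subseteq> conf M" using V openin_subset by fastforce
  then have "conf M \<inter> (\<lambda>p. permute p \<pi>) -` V = (\<lambda>p. permute p \<pi>) -` V"
    using conf_permute_iff[OF \<pi>, of _ M] by blast
  ultimately show ?thesis by simp
qed

text \<open>By freeness, \<open>p\<close> differs from each of its finitely many proper
  rearrangements and can be separated from all of them. Two points of the resulting neighbourhood
  can then be related by the identity only.\<close>

lemma ex_injective_nbhd:
  fixes p :: "'a::euclidean_space^'n::finite"
  assumes U: "open_conf M U" and p: "p \<in> U"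
  obtains V where "p \<in> V" "V \<subseteq> U" "open_conf M V" "inj_on pr V"
proof -
  have pc: "p \<in> conf M" using openin_subset[OF U] p by auto
  have "\<exists>A B. open A \<and> open B \<and> p \<in> A \<and> permute p \<pi> \<in> B \<and> A \<inter> B = {}"
    if "\<pi> \<in> perms - {id}" for \<pi>
  proof -
    have "permute p \<pi> \<noteq> permute p id" using permute_inj_on_conf[OF pc] that by blast
    then show ?thesis using hausdorff[of p "permute p \<pi>"] by simp
  qed
  then obtain A B where "\<forall>\<pi>\<in>perms - {id}.
      open (A \<pi>) \<and> open (B \<pi>) \<and> p \<in> A \<pi> \<and> permute p \<pi> \<in> B \<pi> \<and> A \<pi> \<inter> B \<pi> = {}"
    by metis
  then have AB: "open (A \<pi>)" "open (B \<pi>)" "p \<in> A \<pi>" "permute p \<pi> \<in> B \<pi>" "A \<pi> \<inter> B \<pi> = {}"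
    if "\<pi> \<in> perms - {id}" for \<pi>
    using that by blast+
  let ?O = "\<Inter>\<pi>\<in>perms - {id}. A \<pi> \<inter> (\<lambda>p. permute p \<pi>) -` B \<pi>"
  have "open ?O"
    by (intro open_INT ballI open_Int open_vimage continuous_on_permute finite AB(1,2))
  then have 1: "open_conf M (U \<inter> ?O)"
    by (rule openin_Int_open[OF U])
  have 2: "inj_on pr (U \<inter> ?O)"
  proof (rule inj_onI)
    fix x y assume xy: "x \<in> U \<inter> ?O" "y \<in> U \<inter> ?O" "pr x = pr y"
    obtain \<pi> where \<pi>: "\<pi> \<in> perms" "y = permute x \<pi>" using xy(3) pr_eq_iff by blast
    have "\<pi> = id"
    proof (rule ccontr)
      assume "\<pi> \<noteq> id"
      then have "\<pi> \<in> perms - {id}" using \<pi> by simp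
      moreover from this have "permute x \<pi> \<in> B \<pi>" "y \<in> A \<pi>"
        using xy(1,2) unfolding INT_iff Int_iff vimage_eq by blast+
      ultimately show False using \<pi>(2) AB(5)[of \<pi>] by blast
    qed
    then show "x = y" using \<pi>(2) by simp
  qed
  have "p \<in> U \<inter> ?O"
    using p AB(3,4) unfolding INT_iff Int_iff vimage_eq by blast
  then show ?thesis by (rule that[OF _ Int_lower1 1 2])
qed

text \<open>Openness of \<open>pr\<close> is continuity of its inverse on any open set where it is
  injective.\<close>

lemma continuous_on_the_inv_pr:
  assumes V: "open_conf M (V :: ('a::euclidean_space^'n::finite) set)" and inj: "inj_on pr V"
  shows "continuous_on (pr ` V) (the_inv_into V pr)"
proof -
  have "openin (top_of_set (pr ` V)) (pr ` V \<inter> the_inv_into V pr -` W)" if W: "open W" for W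
  proof -
    have "pr ` V \<inter> the_inv_into V pr -` W = pr ` (V \<inter> W)"
      using inj by (auto simp: the_inv_into_f_f)
    moreover have "open_conf M (V \<inter> W)" using V W by (rule openin_Int_open)
    then have "open_nconf M (pr ` (V \<inter> W))" by (rule openin_pr_image)
    ultimately show ?thesis
      using openin_subset_trans[of "nconf M" "pr ` (V \<inter> W)" "pr ` V"] openin_subset[OF openin_pr_image[OF V]]
      by auto
  qed
  then show ?thesis by (simp add: continuous_on_open_gen continuous_openin_preimage_eq)
qed

section \<open>Integration over unordered configurations\<close>

lemma measurable_pr: "pr \<in> measurable (conf_measure M) (restrict_space borel (nconf M))"
proof -
  have "pr \<in> measurable (restrict_space borel (conf M)) (restrict_space borel (nconf M))"
    by (intro measurable_restrict_space3 borel_measurable_continuous_onI continuous_on_pr) (auto simp: nconf_def)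
  then show ?thesis using measurable_cong_sets[OF sets_conf_measure refl] by blast
qed

lemma space_nconf_measure: "space (nconf_measure M) = nconf M"
  and sets_nconf_measure: "sets (nconf_measure M) = sets (restrict_space borel (nconf M))"
  by (simp_all add: nconf_measure_def space_scale_measure space_restrict_space)

lemma integrable_scaleR_iff:
  fixes h :: "'x \<Rightarrow> 'b::{banach, second_countable_topology}"
  assumes "c \<noteq> 0"
  shows "integrable N (\<lambda>x. c *\<^sub>R h x) \<longleftrightarrow> integrable N h"
  using integrable_scaleR_right[of "inverse c" N "\<lambda>x. c *\<^sub>R h x"] assms by auto

text \<open>A scaled measure is a measure with constant density, and in this form the transformation
  rules for integrals apply.\<close>

lemma nconf_measure_density:
  "(nconf_measure M :: ('a::euclidean_space, 'n::finite) sym_power measure) =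
     density (distr (conf_measure M) (restrict_space borel (nconf M)) pr) (\<lambda>_. ennreal (1 / fact CARD('n)))"
  unfolding nconf_measure_def by (rule measure_eqI) (simp_all add: emeasure_density_const)

lemma
  fixes h :: "('a::euclidean_space, 'n::finite) sym_power \<Rightarrow> 'b::{banach, second_countable_topology}"
  assumes h: "h \<in> borel_measurable (nconf_measure M)"
  shows integrable_nconf: "integrable (nconf_measure M) h \<longleftrightarrow> integrable (conf_measure M) (\<lambda>p. h (pr p))"
    and integral_nconf: "(LINT x|nconf_measure M. h x) = (1 / fact CARD('n)) *\<^sub>R (LINT p|conf_measure M. h (pr p))"
proof -
  have h': "h \<in> borel_measurable (restrict_space borel (nconf M))"
    using h measurable_cong_sets[OF sets_nconf_measure refl] by blast
  then have h'': "h \<in> borel_measurable (distr (conf_measure M) (restrict_space borel (nconf M)) pr)" by simp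
  show "integrable (nconf_measure M) h \<longleftrightarrow> integrable (conf_measure M) (\<lambda>p. h (pr p))"
    unfolding nconf_measure_density
    by (subst integrable_density[OF h''])
      (simp_all add: integrable_distr_eq[OF measurable_pr h'] integrable_scaleR_iff)
  show "(LINT x|nconf_measure M. h x) = (1 / fact CARD('n)) *\<^sub>R (LINT p|conf_measure M. h (pr p))"
    unfolding nconf_measure_density
    by (subst integral_density[OF h'']) (simp_all add: integral_distr[OF measurable_pr h'])
qed

lemma AE_nconf:
  assumes "AE x in (nconf_measure M :: ('a::euclidean_space, 'n::finite) sym_power measure). P x"
  shows "AE p in conf_measure M. P (pr p)"
proof (rule AE_distrD[OF measurable_pr])
  show "AE x in distr (conf_measure M) (restrict_space borel (nconf M)) pr. P x"
    using assms unfolding nconf_measure_density by (subst (asm) AE_density) simp_all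
qed

lemma Lindelof_space_top_of_set: "Lindelof_space (top_of_set (S :: 'b::second_countable_topology set))"
  unfolding Lindelof_space_def
proof (intro allI impI, elim conjE)
  fix \<U> assume "\<forall>U\<in>\<U>. openin (top_of_set S) U" "\<Union>\<U> = topspace (top_of_set S)"
  then show "\<exists>\<V>. countable \<V> \<and> \<V> \<subseteq> \<U> \<and> \<Union>\<V> = topspace (top_of_set S)"
    using Lindelof_openin[of \<U> S] by metis
qed

text \<open>The quotient is treated as a bare topological space. The Lindelof property passes to
  continuous images, so it comes from \<open>conf M\<close>, a subspace of a second countable
  space.\<close>

lemma Lindelof_nconf: "Lindelof_space (top_of_set (nconf (M :: 'a::euclidean_space momentum_space) :: ('a, 'n::finite) sym_power set))"
proof (rule Lindelof_space_continuous_map_image[OF Lindelof_space_top_of_set[of "conf M"]])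
  show "continuous_map (top_of_set (conf M)) (top_of_set (nconf M)) (pr :: 'a^'n \<Rightarrow> _)"
    using continuous_on_pr by (auto simp: nconf_def)
qed (simp add: nconf_def)

section \<open>Smoothness of coordinate functions\<close>

lemma Ck_on_subset: "Ck_on k U f \<Longrightarrow> V \<subseteq> U \<Longrightarrow> Ck_on k V f"
proof (induction k arbitrary: f)
  case 0
  then show ?case by (auto intro: continuous_on_subset)
next
  case (Suc k)
  then show ?case by (auto intro: differentiable_on_subset)
qed

text \<open>Openness enters because \<open>frechet_derivative\<close> at a point sees the function
  in a full neighbourhood.\<close>

lemma Ck_on_cong:
  assumes "open U"
  shows "Ck_on k U f \<Longrightarrow> (\<And>x. x \<in> U \<Longrightarrow> f x = g x) \<Longrightarrow> Ck_on k U g"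
proof (induction k arbitrary: f g)
  case 0
  then show ?case using continuous_on_cong[of U U f g] by simp
next
  case (Suc k)
  have d: "f differentiable at x" if "x \<in> U" for x
    using Suc.prems(1) that by (simp add: differentiable_on_eq_differentiable_at[OF assms])
  have eq: "frechet_derivative f (at x) = frechet_derivative g (at x)" if "x \<in> U" for x
    using frechet_derivative_transform_within_open[OF d[OF that] assms that] Suc.prems(2) by blast
  have "g differentiable at x" if "x \<in> U" for x
    using d[OF that] has_derivative_transform_within_open[OF _ assms that, of f _ UNIV g] Suc.prems(2)
    unfolding differentiable_def by blast
  moreover have "Ck_on k U (\<lambda>x. frechet_derivative g (at x) v)" for v
    by (rule Suc.IH[of "\<lambda>x. frechet_derivative f (at x) v"]) (use Suc.prems(1) eq in auto)
  ultimately show ?case by (simp add: differentiable_on_eq_differentiable_at[OF assms])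
qed

lemma Ck_on_const: "Ck_on k U (\<lambda>_. c)"
  by (induction k arbitrary: c) simp_all

lemma Ck_on_add:
  assumes "open U"
  shows "Ck_on k U f \<Longrightarrow> Ck_on k U g \<Longrightarrow> Ck_on k U (\<lambda>x. f x + g x)"
proof (induction k arbitrary: f g)
  case 0
  then show ?case by (auto intro: continuous_on_add)
next
  case (Suc k)
  have "Ck_on k U (\<lambda>x. frechet_derivative (\<lambda>x. f x + g x) (at x) v)" for v
  proof (rule Ck_on_cong[OF assms])
    show "Ck_on k U (\<lambda>x. frechet_derivative f (at x) v + frechet_derivative g (at x) v)"
      using Suc by simp
    fix x assume "x \<in> U"
    then have "f differentiable at x" "g differentiable at x"
      using Suc.prems by (simp_all add: differentiable_on_eq_differentiable_at[OF assms])
    then have "((\<lambda>x. f x + g x) has_derivative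
        (\<lambda>v. frechet_derivative f (at x) v + frechet_derivative g (at x) v)) (at x)"
      by (intro has_derivative_add) (simp_all add: frechet_derivative_works)
    from frechet_derivative_at[OF this]
    show "frechet_derivative f (at x) v + frechet_derivative g (at x) v
        = frechet_derivative (\<lambda>x. f x + g x) (at x) v" by metis
  qed
  then show ?case using Suc.prems by (simp add: differentiable_on_add)
qed

lemma Ck_on_bounded_linear:
  assumes "open U" and A: "bounded_linear A"
  shows "Ck_on k U f \<Longrightarrow> Ck_on k U (\<lambda>x. A (f x))"
proof (induction k arbitrary: f)
  case 0
  then show ?case using bounded_linear.continuous_on[OF A] by simp
next
  case (Suc k)
  have d: "((\<lambda>x. A (f x)) has_derivative (\<lambda>v. A (frechet_derivative f (at x) v))) (at x)" if "x \<in> U" for x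
    using Suc.prems that
    by (intro bounded_linear.has_derivative[OF A])
      (simp add: differentiable_on_eq_differentiable_at[OF assms(1)] frechet_derivative_works)
  have "Ck_on k U (\<lambda>x. frechet_derivative (\<lambda>x. A (f x)) (at x) v)" for v
  proof (rule Ck_on_cong[OF assms(1)])
    show "Ck_on k U (\<lambda>x. A (frechet_derivative f (at x) v))"
      using Suc by simp
    show "A (frechet_derivative f (at x) v) = frechet_derivative (\<lambda>x. A (f x)) (at x) v" if "x \<in> U" for x
      using frechet_derivative_at[OF d[OF that]] by metis
  qed
  moreover have "(\<lambda>x. A (f x)) differentiable_on U"
    using d unfolding differentiable_on_eq_differentiable_at[OF assms(1)] differentiable_def by blast
  ultimately show ?case by simp
qed

text \<open>By the chain rule the derivative of the composite in direction \<open>v\<close> is again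
  a composite with \<open>A\<close>, of the derivative of \<open>f\<close> in the fixed direction
  \<open>A v\<close>; so the induction runs over all \<open>f\<close>.\<close>

lemma Ck_on_compose_bounded_linear:
  assumes "open U" and A: "bounded_linear A"
  shows "Ck_on k U f \<Longrightarrow> Ck_on k (A -` U) (\<lambda>x. f (A x))"
proof (induction k arbitrary: f)
  case 0
  then show ?case
    using continuous_on_compose2[of U f "A -` U" A] linear_continuous_on[OF A] by auto
next
  case (Suc k)
  have o: "open (A -` U)"
    by (rule open_vimage[OF assms(1) linear_continuous_on[OF A]])
  have d: "((\<lambda>x. f (A x)) has_derivative (\<lambda>v. frechet_derivative f (at (A x)) (A v))) (at x)"
    if "x \<in> A -` U" for x
  proof (rule has_derivative_compose[of A A])
    show "(A has_derivative A) (at x)" by (rule bounded_linear_imp_has_derivative[OF A])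
    show "(f has_derivative frechet_derivative f (at (A x))) (at (A x))"
      using Suc.prems that by (simp add: differentiable_on_eq_differentiable_at[OF assms(1)] frechet_derivative_works)
  qed
  have "Ck_on k (A -` U) (\<lambda>x. frechet_derivative (\<lambda>x. f (A x)) (at x) v)" for v
  proof (rule Ck_on_cong[OF o])
    show "Ck_on k (A -` U) (\<lambda>x. frechet_derivative f (at (A x)) (A v))"
      using Suc.prems by (intro Suc.IH[of "\<lambda>y. frechet_derivative f (at y) (A v)"]) simp
    show "frechet_derivative f (at (A x)) (A v) = frechet_derivative (\<lambda>x. f (A x)) (at x) v" if "x \<in> A -` U" for x
      using frechet_derivative_at[OF d[OF that]] by metis
  qed
  moreover have "(\<lambda>x. f (A x)) differentiable_on (A -` U)"
    using d unfolding differentiable_on_eq_differentiable_at[OF o] differentiable_def by blast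
  ultimately show ?case by simp
qed

lemma Ck_on_UN:
  assumes "\<And>i. i \<in> I \<Longrightarrow> open (U i)"
  shows "(\<And>i. i \<in> I \<Longrightarrow> Ck_on k (U i) f) \<Longrightarrow> Ck_on k (\<Union>i\<in>I. U i) f"
proof (induction k arbitrary: f)
  case 0
  then show ?case using continuous_on_open_UN[of I U f] assms by simp
next
  case (Suc k)
  have o: "open (\<Union>i\<in>I. U i)" using assms by blast
  have "f differentiable_on (\<Union>i\<in>I. U i)"
    unfolding differentiable_on_eq_differentiable_at[OF o]
    using Suc.prems assms differentiable_on_eq_differentiable_at by fastforce
  then show ?case using Suc by simp
qed

section \<open>Smoothness through the global parametrisation\<close>

definition conf_param :: "('a::euclidean_space) momentum_space \<Rightarrow> (real^2)^'n \<Rightarrow> 'a^'n" where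
  "conf_param M q = (\<chi> i. param M (q$i))"

lemma smooth_on_conf_iff:
  "smooth_on_conf M U f \<longleftrightarrow> (\<forall>k. Ck_on k (conf_param M -` U) (\<lambda>q. f (conf_param M q)))"
  by (simp add: smooth_on_conf_def smooth_on_def conf_param_def vimage_def)

text \<open>The parametrisation lands in \<open>points M\<close>, so the preimage is cut out by two
  open conditions, distinctness of entries and membership in \<open>T\<close>, although
  \<open>conf M\<close> may fail to be open in the ambient space.\<close>

lemma open_conf_param_vimage:
  assumes M: "momentum_ok M" and U: "open_conf M (U :: ('a::euclidean_space^'n::finite) set)"
  shows "open (conf_param M -` U)"
proof -
  obtain T where T: "open T" "U = conf M \<inter> T" using U by (auto simp: openin_open)
  have c: "continuous_on UNIV (conf_param M :: (real^2)^'n \<Rightarrow> _)"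
    unfolding conf_param_def
    by (intro continuous_on_vec_lambda continuous_on_compose2[OF momentum_okD(1)[OF M]] continuous_intros) auto
  have "param M x \<in> points M" for x using momentum_okD(2)[OF M] by auto
  then have "conf_param M -` U = conf_param M -` ({p. \<not> (\<exists>i j. i \<noteq> j \<and> p$i = p$j)} \<inter> T)"
    using T(2) by (auto simp: conf_def conf_param_def)
  then show ?thesis
    using open_vimage[OF open_Int[OF open_distinct_entries T(1)] c] by simp
qed

lemma regularity_smooth_conf:
  assumes M: "momentum_ok (M :: 'a::euclidean_space momentum_space)"
  shows "regularity (conf M :: ('a^'n::finite) set) (smooth_on_conf M :: _ \<Rightarrow> (_ \<Rightarrow> complex^'k::finite) \<Rightarrow> _)"
  unfolding regularity_def smooth_on_conf_iff
proof (intro conjI allI impI; (elim conjE)?)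
  fix U V :: "('a^'n) set" and f g :: "'a^'n \<Rightarrow> complex^'k" and k
  assume *: "open_conf M V" "V \<subseteq> U" "\<forall>k. Ck_on k (conf_param M -` U) (\<lambda>q. f (conf_param M q))"
    "\<forall>y\<in>V. g y = f y"
  have "Ck_on k (conf_param M -` V) (\<lambda>q. f (conf_param M q))"
    by (rule Ck_on_subset[OF *(3)[rule_format]]) (use *(2) in blast)
  then show "Ck_on k (conf_param M -` V) (\<lambda>q. g (conf_param M q))"
    by (rule Ck_on_cong[OF open_conf_param_vimage[OF M *(1)]]) (use *(4) in simp)
next
  fix U :: "('a^'n) set" and f g :: "'a^'n \<Rightarrow> complex^'k" and k
  assume *: "open_conf M U" "\<forall>k. Ck_on k (conf_param M -` U) (\<lambda>q. f (conf_param M q))"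
    "\<forall>k. Ck_on k (conf_param M -` U) (\<lambda>q. g (conf_param M q))"
  show "Ck_on k (conf_param M -` U) (\<lambda>q. f (conf_param M q) + g (conf_param M q))"
    by (rule Ck_on_add[OF open_conf_param_vimage[OF M *(1)] *(2,3)[rule_format]])
next
  fix U :: "('a^'n) set" and f :: "'a^'n \<Rightarrow> complex^'k" and k and A :: "complex^'k \<Rightarrow> complex^'k"
  assume *: "open_conf M U" "\<forall>k. Ck_on k (conf_param M -` U) (\<lambda>q. f (conf_param M q))" "linear A"
  show "Ck_on k (conf_param M -` U) (\<lambda>q. A (f (conf_param M q)))"
    by (rule Ck_on_bounded_linear[OF open_conf_param_vimage[OF M *(1)]
          *(3)[unfolded linear_conv_bounded_linear] *(2)[rule_format]])
qed (rule Ck_on_const)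

lemma regularity_smooth_nconf:
  assumes M: "momentum_ok (M :: 'a::euclidean_space momentum_space)"
  shows "regularity (nconf M :: ('a, 'n::finite) sym_power set) (smooth_on_nconf M :: _ \<Rightarrow> (_ \<Rightarrow> complex^'k::finite) \<Rightarrow> _)"
  unfolding regularity_def smooth_on_nconf_def
proof (intro conjI allI impI; (elim conjE)?)
  note reg = regularity_smooth_conf[OF M]
  fix U V :: "('a, 'n) sym_power set" and f g :: "('a, 'n) sym_power \<Rightarrow> complex^'k"
  assume *: "open_nconf M U" "open_nconf M V" "V \<subseteq> U"
    "smooth_on_conf M (conf M \<inter> pr -` U) (\<lambda>p. f (pr p))" "\<forall>y\<in>V. g y = f y"
  show "smooth_on_conf M (conf M \<inter> pr -` V) (\<lambda>p. g (pr p))"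
    by (rule regularityD(1)[OF reg, OF openin_pr_vimage[OF *(1)] openin_pr_vimage[OF *(2)] _ *(4)])
      (use *(3,5) in auto)
next
  fix U :: "('a, 'n) sym_power set"
  assume "open_nconf M U"
  then show "smooth_on_conf M (conf M \<inter> pr -` U) (\<lambda>p::'a^'n. 0 :: complex^'k)"
    by (intro regularityD(2)[OF regularity_smooth_conf[OF M]] openin_pr_vimage)
next
  fix U :: "('a, 'n) sym_power set" and f g :: "('a, 'n) sym_power \<Rightarrow> complex^'k"
  assume *: "open_nconf M U" "smooth_on_conf M (conf M \<inter> pr -` U) (\<lambda>p. f (pr p))"
    "smooth_on_conf M (conf M \<inter> pr -` U) (\<lambda>p. g (pr p))"
  show "smooth_on_conf M (conf M \<inter> pr -` U) (\<lambda>p. f (pr p) + g (pr p))"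
    by (rule regularityD(3)[OF regularity_smooth_conf[OF M], OF openin_pr_vimage[OF *(1)] *(2,3)])
next
  fix U :: "('a, 'n) sym_power set" and f :: "('a, 'n) sym_power \<Rightarrow> complex^'k"
    and A :: "complex^'k \<Rightarrow> complex^'k"
  assume *: "open_nconf M U" "smooth_on_conf M (conf M \<inter> pr -` U) (\<lambda>p. f (pr p))" "linear A"
  show "smooth_on_conf M (conf M \<inter> pr -` U) (\<lambda>p. A (f (pr p)))"
    by (rule regularityD(4)[OF regularity_smooth_conf[OF M], OF openin_pr_vimage[OF *(1)] *(3,2)])
qed

text \<open>The last three clauses are the transfers behind the three operations on sections:
  pulling back along \<open>pr\<close>, permuting entries, and descending along an inverse of
  \<open>pr\<close> on one sheet. They belong to \<open>pullback_LS\<close>, \<open>U_LS\<close> and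
  \<open>descend_LS\<close> in turn.\<close>

definition compatible ::
    "('a::euclidean_space) momentum_space \<Rightarrow> (('a^'n::finite) set \<Rightarrow> ('a^'n \<Rightarrow> complex^'k) \<Rightarrow> bool) \<Rightarrow>
     (('a, 'n) sym_power set \<Rightarrow> (('a, 'n) sym_power \<Rightarrow> complex^'k) \<Rightarrow> bool) \<Rightarrow> bool" where
  "compatible M reg regT \<longleftrightarrow> regularity (conf M) reg \<and> regularity (nconf M) regT \<and>
     (\<forall>U f. open_nconf M U \<and> regT U f \<longrightarrow> reg (conf M \<inter> pr -` U) (\<lambda>p. f (pr p))) \<and>
     (\<forall>U f \<pi>. open_conf M U \<and> \<pi> \<in> perms \<and> reg U f \<longrightarrow>
        reg ((\<lambda>p. permute p \<pi>) -` U) (\<lambda>p. f (permute p \<pi>))) \<and>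
     (\<forall>V f. open_conf M V \<and> inj_on pr V \<and> reg V f \<longrightarrow>
        regT (pr ` V) (\<lambda>x. f (the_inv_into V pr x)))"

lemma compatibleD:
  assumes "compatible M reg regT"
  shows "regularity (conf M) reg" "regularity (nconf M) regT"
    "open_nconf M U \<Longrightarrow> regT U f \<Longrightarrow> reg (conf M \<inter> pr -` U) (\<lambda>p. f (pr p))"
    "open_conf M V \<Longrightarrow> \<pi> \<in> perms \<Longrightarrow> reg V g \<Longrightarrow>
       reg ((\<lambda>p. permute p \<pi>) -` V) (\<lambda>p. g (permute p \<pi>))"
    "open_conf M V \<Longrightarrow> inj_on pr V \<Longrightarrow> reg V g \<Longrightarrow>
       regT (pr ` V) (\<lambda>x. g (the_inv_into V pr x))"
  using assms unfolding compatible_def by simp_all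

text \<open>All particles share one parametrisation, so a permutation of entries is a linear map of
  the parameters.\<close>

lemma smooth_on_conf_permute:
  fixes f :: "'a::euclidean_space^'n::finite \<Rightarrow> complex^'k::finite"
  assumes M: "momentum_ok M" and U: "open_conf M U" and f: "smooth_on_conf M U f"
  shows "smooth_on_conf M ((\<lambda>p. permute p \<pi>) -` U) (\<lambda>p. f (permute p \<pi>))"
  unfolding smooth_on_conf_iff
proof
  fix k
  let ?A = "\<lambda>q :: (real^2)^'n. permute q \<pi>"
  have A: "bounded_linear ?A"
    by (rule linear_conv_bounded_linear[THEN iffD1], rule linearI) (simp_all add: permute_def vec_eq_iff)
  have c: "conf_param M (?A q) = permute (conf_param M q) \<pi>" for q
    by (simp add: conf_param_def permute_def)
  have "Ck_on k (?A -` conf_param M -` U) (\<lambda>q. f (conf_param M (?A q)))"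
    by (rule Ck_on_compose_bounded_linear[OF open_conf_param_vimage[OF M U] A])
      (use f in \<open>simp add: smooth_on_conf_iff\<close>)
  moreover have "?A -` conf_param M -` U = conf_param M -` (\<lambda>p. permute p \<pi>) -` U"
    using c by auto
  ultimately show "Ck_on k (conf_param M -` (\<lambda>p. permute p \<pi>) -` U) (\<lambda>q. f (permute (conf_param M q) \<pi>))"
    by (simp add: c)
qed

text \<open>Descending is the clause with content. Smoothness below is defined on the full preimage,
  which is a union of permuted copies of \<open>V\<close>; on the copy belonging to
  \<open>\<pi>\<close> the function is \<open>f\<close> composed with that permutation.\<close>

lemma compatible_smooth:
  assumes M: "momentum_ok M"
  shows "compatible M (smooth_on_conf M :: ('a::euclidean_space^'n::finite) set \<Rightarrow> (_ \<Rightarrow> complex^'k::finite) \<Rightarrow> _)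
    (smooth_on_nconf M)"
  unfolding compatible_def
proof (intro conjI allI impI; (elim conjE)?)
  fix V :: "('a^'n) set" and f :: "'a^'n \<Rightarrow> complex^'k"
  assume V: "open_conf M V" and inj: "inj_on pr V" and f: "smooth_on_conf M V f"
  let ?i = "\<lambda>p. the_inv_into V pr (pr p)" and ?W = "\<lambda>\<pi>. (\<lambda>p. permute p \<pi>) -` V"
  have Vc: "V \<subseteq> conf M" using openin_subset[OF V] by simp
  have i: "?i p = permute p \<pi>" if "\<pi> \<in> perms" "permute p \<pi> \<in> V" for p \<pi>
    using the_inv_into_f_f[OF inj that(2)] pr_permute[OF that(1), of p] by simp
  have eq: "conf M \<inter> pr -` pr ` V = (\<Union>\<pi>\<in>perms. ?W \<pi>)"
  proof (intro Set.set_eqI iffI)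
    fix p assume "p \<in> conf M \<inter> pr -` pr ` V"
    then obtain p' where "p' \<in> V" "pr p = pr p'" by auto
    then show "p \<in> (\<Union>\<pi>\<in>perms. ?W \<pi>)" using pr_eq_iff[of p p'] by auto
  next
    fix p assume "p \<in> (\<Union>\<pi>\<in>perms. ?W \<pi>)"
    then obtain \<pi> where \<pi>: "\<pi> \<in> perms" "permute p \<pi> \<in> V" by auto
    then have "pr p \<in> pr ` V" using pr_permute[OF \<pi>(1), of p] by (metis imageI)
    then show "p \<in> conf M \<inter> pr -` pr ` V" using \<pi> Vc conf_permute_iff[OF \<pi>(1)] by auto
  qed
  show "smooth_on_nconf M (pr ` V) (\<lambda>x. f (the_inv_into V pr x))"
    unfolding smooth_on_nconf_def eq smooth_on_conf_iff vimage_UN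
  proof (intro allI Ck_on_UN)
    fix \<pi> :: "'n \<Rightarrow> 'n" and k assume \<pi>: "\<pi> \<in> perms"
    show o: "open (conf_param M -` ?W \<pi>)"
      by (rule open_conf_param_vimage[OF M openin_permute_vimage[OF \<pi> V]])
    have "Ck_on k (conf_param M -` ?W \<pi>) (\<lambda>q. f (permute (conf_param M q) \<pi>))"
      using smooth_on_conf_permute[OF M V f, of \<pi>] by (simp add: smooth_on_conf_iff)
    then show "Ck_on k (conf_param M -` ?W \<pi>) (\<lambda>q. f (?i (conf_param M q)))"
      by (rule Ck_on_cong[OF o]) (simp add: i[OF \<pi>])
  qed
qed (use regularity_smooth_conf[OF M] regularity_smooth_nconf[OF M] smooth_on_conf_permute[OF M]
  in \<open>auto simp: smooth_on_nconf_def\<close>)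

lemma borel_measurable_restrict_compose:
  assumes "f \<in> borel_measurable (restrict_space borel U)" "continuous_on V g" "g ` V \<subseteq> U"
  shows "(\<lambda>x. f (g x)) \<in> borel_measurable (restrict_space borel V)"
proof (rule measurable_compose[OF _ assms(1)])
  show "g \<in> measurable (restrict_space borel V) (restrict_space borel U)"
    using assms(2,3) by (intro measurable_restrict_space2 borel_measurable_continuous_on_restrict)
      (auto simp: space_restrict_space)
qed

lemma compatible_borel:
  "compatible (M :: 'a::euclidean_space momentum_space)
     (borel_reg :: ('a^'n::finite) set \<Rightarrow> (_ \<Rightarrow> complex^'k::finite) \<Rightarrow> _) borel_reg"
  unfolding compatible_def
proof (intro conjI allI impI; (elim conjE)?)
  fix U :: "('a, 'n) sym_power set" and f :: "('a, 'n) sym_power \<Rightarrow> complex^'k"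
  assume "borel_reg U f"
  then show "borel_reg (conf M \<inter> pr -` U) (\<lambda>p. f (pr p))"
    by (rule borel_measurable_restrict_compose) (auto intro: continuous_on_pr)
next
  fix U :: "('a^'n) set" and f :: "'a^'n \<Rightarrow> complex^'k" and \<pi>
  assume "borel_reg U f"
  then show "borel_reg ((\<lambda>p. permute p \<pi>) -` U) (\<lambda>p. f (permute p \<pi>))"
    by (rule borel_measurable_restrict_compose) (auto intro: continuous_on_permute)
next
  fix V :: "('a^'n) set" and f :: "'a^'n \<Rightarrow> complex^'k"
  assume V: "open_conf M V" and inj: "inj_on pr V" and f: "borel_reg V f"
  show "borel_reg (pr ` V) (\<lambda>x. f (the_inv_into V pr x))"
    by (rule borel_measurable_restrict_compose[OF f continuous_on_the_inv_pr[OF V inj]])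
      (simp add: the_inv_into_onto[OF inj])
qed (rule regularity_borel)+

section \<open>Bundle map and permutation operators in coordinates\<close>

locale braid_model = braid_geometry D
  for D :: "('a::euclidean_space, 'n::finite, 'e::topological_space, 'k::finite) braid_data" +
  assumes ok: "momentum_ok (mom D)"

text \<open>\<open>T\<close> is the theory over unordered configurations with all braids,
  \<open>TT\<close> below the one over ordered configurations with pure braids. Each point of the
  cover is a frame for both bundles, which makes their coordinates comparable.\<close>

sublocale braid_model \<subseteq> T: assoc D "carrier (braid_group D)" "prt D" "nconf_measure (mom D)"
    "smooth_on_nconf (mom D)"
proof (intro assoc.intro assoc_axioms.intro braid_geometry_axioms, unfold space_nconf_measure)
  show "subgroup (carrier G) G" by (rule braid.subgroup_self)
  show "sets (nconf_measure M) = sets (restrict_space borel (nconf M))" by (rule sets_nconf_measure)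
  show "regularity (nconf M) (smooth_on_nconf M)" by (rule regularity_smooth_nconf[OF ok])
qed (use cov_t prt_fibre_iff Lindelof_nconf in auto)

sublocale braid_model \<subseteq> TT: assoc D "pure_braids D" "prtt D" "conf_measure (mom D)"
    "smooth_on_conf (mom D)"
proof (intro assoc.intro assoc_axioms.intro braid_geometry_axioms, unfold space_conf_measure)
  show "subgroup (pure_braids D) G" by (rule subgroup_pure)
  show "sets (conf_measure M) = sets (restrict_space borel (conf M))" by (rule sets_conf_measure)
  show "regularity (conf M) (smooth_on_conf M)" by (rule regularity_smooth_conf[OF ok])
qed (use cov_tt prtt_fibre_iff Lindelof_space_top_of_set in auto)

context braid_model
begin

lemma bundle_t: "bundle_t D = T.B" and bundle_tt: "bundle_tt D = TT.B"
  by (simp_all add: bundle_t_def bundle_tt_def)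

lemma fibre_tt: "fibre_tt D = TT.fibre"
  by (rule ext) (simp add: fibre_tt_def TT.fibre_def)

abbreviation "PB \<equiv> pure_braids D"

lemma conf_lift: "p \<in> conf M \<Longrightarrow> \<exists>e\<in>C. prtt D e = p"
  using TT.q_surj by (simp add: space_conf_measure)

definition tsection :: "(('a, 'n) sym_power \<Rightarrow> ('e, 'k) orbit) \<Rightarrow> bool" where
  "tsection \<xi> \<longleftrightarrow> (\<forall>x\<in>nconf M. \<xi> x \<in> T.fibre x)"

definition ttsection :: "('a^'n \<Rightarrow> ('e, 'k) orbit) \<Rightarrow> bool" where
  "ttsection \<eta> \<longleftrightarrow> (\<forall>p\<in>conf M. \<eta> p \<in> TT.fibre p)"

lemma tsectionD: "tsection \<xi> \<Longrightarrow> e \<in> C \<Longrightarrow> \<xi> (prt D e) \<in> T.fibre (prt D e)"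
  and ttsectionD: "ttsection \<eta> \<Longrightarrow> e \<in> C \<Longrightarrow> \<eta> (prtt D e) \<in> TT.fibre (prtt D e)"
  by (simp_all add: tsection_def ttsection_def prt_in prtt_in)

lemma tsection_LS: "\<xi> \<in> T.LS reg \<Longrightarrow> tsection \<xi>" and ttsection_LS: "\<eta> \<in> TT.LS reg' \<Longrightarrow> ttsection \<eta>"
  using T.LS_fibre TT.LS_fibre by (auto simp: tsection_def ttsection_def space_conf_measure space_nconf_measure)

lemma tsection_sqint: "\<xi> \<in> T.sqint \<Longrightarrow> tsection \<xi>" and ttsection_sqint: "\<eta> \<in> TT.sqint \<Longrightarrow> ttsection \<eta>"
  using tsection_LS ttsection_LS T.sqint_iff TT.sqint_iff by blast+

section \<open>The bundle map and the permutation operators in frames\<close>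

lemma Pr_chi:
  assumes e: "e \<in> C"
  shows "Pr D (chi D PB e f) = chi D (carrier G) e f"
  unfolding Pr_def
proof (rule the_equality)
  show "\<exists>e'\<in>C. \<exists>f'. chi D PB e f = chi D PB e' f' \<and> chi D (carrier G) e f = chi D (carrier G) e' f'"
    using e by blast
  fix u assume "\<exists>e'\<in>C. \<exists>f'. chi D PB e f = chi D PB e' f' \<and> u = chi D (carrier G) e' f'"
  then obtain e' f' where *: "e' \<in> C" "chi D PB e f = chi D PB e' f'" "u = chi D (carrier G) e' f'" by blast
  then obtain b where b: "b \<in> PB" "e' = act D e b" "f' = rep D (binv b) f"
    using TT.chi_eq_iff[OF e *(1)] by blast
  then show "u = chi D (carrier G) e f" using *(3) T.chi_act[OF e TT.H_carrier[OF b(1)]] by simp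
qed

text \<open>In a common frame the bundle map is the identity on coordinates; uniqueness of the
  preimage is then uniqueness of coordinates downstairs.\<close>

lemma Pr_pullback_chi:
  assumes e: "e \<in> C" and \<xi>: "\<xi> (prt D e) \<in> T.fibre (prt D e)"
  shows "Pr_pullback D \<xi> (prtt D e) = chi D PB e (T.coord e (\<xi> (prt D e)))"
  unfolding Pr_pullback_def pr_prtt[OF e] fibre_tt
proof (rule the_equality)
  show "chi D PB e (T.coord e (\<xi> (prt D e))) \<in> TT.fibre (prtt D e) \<and>
      Pr D (chi D PB e (T.coord e (\<xi> (prt D e)))) = \<xi> (prt D e)"
    using e \<xi> by (simp add: TT.chi_fibre Pr_chi T.chi_coord)
  fix v assume v: "v \<in> TT.fibre (prtt D e) \<and> Pr D v = \<xi> (prt D e)"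
  then obtain f where f: "v = chi D PB e f" using TT.fibre_chi e by metis
  then have "\<xi> (prt D e) = chi D (carrier G) e f" using v Pr_chi[OF e] by simp
  then show "v = chi D PB e (T.coord e (\<xi> (prt D e)))" using f e by simp
qed

lemma
  assumes \<xi>: "tsection \<xi>" and e: "e \<in> C"
  shows pullback_fibre: "Pr_pullback D \<xi> (prtt D e) \<in> TT.fibre (prtt D e)"
    and pullback_coord: "TT.coord e (Pr_pullback D \<xi> (prtt D e)) = T.coord e (\<xi> (prt D e))"
  using Pr_pullback_chi[where \<xi> = \<xi>, OF e tsectionD[OF \<xi> e]] e by (simp_all add: TT.chi_fibre)

text \<open>Braids with equal permutations differ by a pure braid on the right, and the pure orbit
  absorbs it.\<close>

lemma chi_tau_eq:
  assumes e: "e \<in> C" and b: "b \<in> carrier G" "c \<in> carrier G" "tau D b = tau D c"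
  shows "chi D PB (act D e b) (rep D (binv b) f) = chi D PB (act D e c) (rep D (binv c) f)"
proof -
  let ?d = "binv b \<cdot> c"
  have d: "?d \<in> carrier G" using b by simp
  have "tau D ?d = id" using b tau_inv[of b] by (simp add: tau_mult)
  then have dP: "?d \<in> PB" using d by (simp add: pure_iff)
  have c: "c = b \<cdot> ?d" using b by (simp add: braid.m_assoc[symmetric])
  have "act D e c = act D (act D e b) ?d" using act_mult[OF e b(1) d] c by simp
  moreover have "rep D (binv c) f = rep D (binv ?d) (rep D (binv b) f)"
    using b d c by (metis braid.inv_mult_group braid.inv_closed rep_mult)
  ultimately show ?thesis
    using TT.chi_act[OF act_closed[OF e b(1)] dP] by simp
qed

text \<open>Another representative of the orbit brings in a pure braid \<open>c\<close>, another
  braid over \<open>\<pi>\<close> a second ambiguity. Both sit in the product of \<open>c\<close>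
  with \<open>b'\<close>, whose permutation is still \<open>\<pi>\<close>.\<close>

lemma S_op_chi:
  assumes e: "e \<in> C" and b: "b \<in> carrier G" "tau D b = \<pi>"
  shows "S_op D \<pi> (chi D PB e f) = chi D PB (act D e b) (rep D (binv b) f)"
  unfolding S_op_def
proof (rule the_equality)
  show "\<exists>e'\<in>C. \<exists>f'. \<exists>b'\<in>carrier G. tau D b' = \<pi> \<and> chi D PB e f = chi D PB e' f' \<and>
      chi D PB (act D e b) (rep D (binv b) f) = chi D PB (act D e' b') (rep D (binv b') f')"
    using e b by blast
  fix u assume "\<exists>e'\<in>C. \<exists>f'. \<exists>b'\<in>carrier G. tau D b' = \<pi> \<and> chi D PB e f = chi D PB e' f' \<and>
      u = chi D PB (act D e' b') (rep D (binv b') f')"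
  then obtain e' f' b' where *: "e' \<in> C" "b' \<in> carrier G" "tau D b' = \<pi>" "chi D PB e f = chi D PB e' f'"
    "u = chi D PB (act D e' b') (rep D (binv b') f')" by blast
  obtain c where c: "c \<in> PB" "e' = act D e c" "f' = rep D (binv c) f"
    using TT.chi_eq_iff[OF e *(1)] *(4) by blast
  have cG: "c \<in> carrier G" "tau D c = id" using c(1) by (auto simp: pure_iff)
  have "u = chi D PB (act D e (c \<cdot> b')) (rep D (binv (c \<cdot> b')) f)"
    using *(2,5) c cG e by (simp add: act_mult rep_mult braid.inv_mult_group)
  also have "\<dots> = chi D PB (act D e b) (rep D (binv b) f)"
    using *(2,3) cG b by (intro chi_tau_eq[OF e]) (simp_all add: tau_mult)
  finally show "u = chi D PB (act D e b) (rep D (binv b) f)" .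
qed

lemma total_tt: "(\<Union>p\<in>conf M. fibre_tt D p) = {chi D PB e f |e f. e \<in> C}"
  unfolding fibre_tt TT.fibre_def using prtt_in by auto

text \<open>The operator of the inverse permutation is a left inverse. Injectivity turns the
  \<open>inv_into\<close> inside \<open>U_op\<close> into a genuine inverse.\<close>

lemma inj_S_op:
  assumes "\<pi> \<in> perms"
  shows "inj_on (S_op D \<pi>) (\<Union>p\<in>conf M. fibre_tt D p)"
proof (rule inj_on_inverseI)
  fix v assume "v \<in> (\<Union>p\<in>conf M. fibre_tt D p)"
  then obtain e f where e: "e \<in> C" "v = chi D PB e f" unfolding total_tt by blast
  obtain b where b: "b \<in> carrier G" "tau D b = \<pi>" using tau_surj[OF assms] by blast
  have "tau D (binv b) = inv_into UNIV \<pi>"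
    using tau_inv[OF b(1)] perms_inv_comp[OF assms] b(2) by (metis comp_assoc comp_id id_comp)
  then show "S_op D (inv_into UNIV \<pi>) (S_op D \<pi> v) = v"
    using e b by (simp add: S_op_chi[of _ b] S_op_chi[of _ "binv b"] act_closed act_inv rep_inv')
qed

text \<open>The claimed orbit is the preimage under \<open>S_op D \<pi>\<close>: applying the latter
  moves the frame to \<open>act D e b\<close> and cancels \<open>rep D b\<close>, leaving the value
  of \<open>\<eta>\<close> at the permuted configuration.\<close>

lemma U_op_chi:
  assumes \<eta>: "ttsection \<eta>" and e: "e \<in> C" and b: "b \<in> carrier G" "tau D b = \<pi>"
  shows "U_op D \<pi> \<eta> (prtt D e) = chi D PB e (rep D b (TT.coord (act D e b) (\<eta> (prtt D (act D e b)))))"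
proof -
  have \<pi>: "\<pi> \<in> perms" using tau_base(1)[OF b(1)] b(2) by simp
  have eb: "act D e b \<in> C" using e b by (simp add: act_closed)
  let ?f = "TT.coord (act D e b) (\<eta> (prtt D (act D e b)))"
  have "S_op D \<pi> (chi D PB e (rep D b ?f)) = \<eta> (prtt D (act D e b))"
    using e b eb TT.chi_coord[OF eb ttsectionD[OF \<eta> eb]] by (simp add: S_op_chi[OF e b] rep_inv)
  moreover have "chi D PB e (rep D b ?f) \<in> (\<Union>p\<in>conf M. fibre_tt D p)"
    unfolding total_tt using e by blast
  moreover have "permute (prtt D e) \<pi> = prtt D (act D e b)" using e b by (simp add: prtt_act)
  ultimately show ?thesis
    unfolding U_op_def by (metis inv_into_f_eq[OF inj_S_op[OF \<pi>]])
qed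

lemma
  assumes \<eta>: "ttsection \<eta>" and e: "e \<in> C"
  shows U_fibre: "\<pi> \<in> perms \<Longrightarrow> U_op D \<pi> \<eta> (prtt D e) \<in> TT.fibre (prtt D e)"
    and U_coord: "b \<in> carrier G \<Longrightarrow> TT.coord e (U_op D (tau D b) \<eta> (prtt D e)) =
      rep D b (TT.coord (act D e b) (\<eta> (prtt D (act D e b))))"
  using U_op_chi[OF \<eta> e] e by (metis TT.chi_fibre tau_surj, simp)

lemma U_section: "ttsection \<eta> \<Longrightarrow> \<pi> \<in> perms \<Longrightarrow> ttsection (U_op D \<pi> \<eta>)"
  using U_fibre conf_lift unfolding ttsection_def by metis

text \<open>On equivariant functions, two steps give \<open>rep D b\<close> applied to
  \<open>rep D c\<close> at the point moved by \<open>b\<close> and then \<open>c\<close>, which is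
  the single step for the product braid.\<close>

lemma U_comp:
  assumes \<eta>: "ttsection \<eta>" and \<pi>: "\<pi> \<in> perms" "\<sigma> \<in> perms" and p: "p \<in> conf M"
  shows "U_op D \<pi> (U_op D \<sigma> \<eta>) p = U_op D (\<pi> \<circ> \<sigma>) \<eta> p"
proof -
  obtain e where e: "e \<in> C" "prtt D e = p" using conf_lift[OF p] by blast
  obtain b where b: "b \<in> carrier G" "tau D b = \<pi>" using tau_surj[OF \<pi>(1)] by blast
  obtain c where c: "c \<in> carrier G" "tau D c = \<sigma>" using tau_surj[OF \<pi>(2)] by blast
  have eb: "act D e b \<in> C" using e b by (simp add: act_closed)
  have "TT.coord e (U_op D \<pi> (U_op D \<sigma> \<eta>) p) = TT.coord e (U_op D (\<pi> \<circ> \<sigma>) \<eta> p)"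
    using U_coord[OF U_section[OF \<eta> \<pi>(2)] e(1) b(1)] U_coord[OF \<eta> eb c(1)]
      U_coord[OF \<eta> e(1) mult_closed[OF b(1) c(1)]] b c e
    by (simp add: tau_mult act_mult rep_mult)
  then show ?thesis
    using U_fibre[OF U_section[OF \<eta> \<pi>(2)] e(1) \<pi>(1)] U_fibre[OF \<eta> e(1) perms_comp[OF \<pi>]] e
    by (intro TT.fibre_eqI[OF e(1)]) simp_all
qed

text \<open>In coordinates, invariance under all \<open>U_op D \<pi>\<close> is equivariance under the whole braid group.\<close>

definition invariant :: "('a^'n \<Rightarrow> ('e, 'k) orbit) \<Rightarrow> bool" where
  "invariant \<eta> \<longleftrightarrow> (\<forall>\<pi>\<in>perms. \<forall>p\<in>conf M. U_op D \<pi> \<eta> p = \<eta> p)"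

lemma invariant_coord:
  assumes "ttsection \<eta>" "invariant \<eta>" "e \<in> C" "b \<in> carrier G"
  shows "TT.coord e (\<eta> (prtt D e)) = rep D b (TT.coord (act D e b) (\<eta> (prtt D (act D e b))))"
proof -
  have "U_op D (tau D b) \<eta> (prtt D e) = \<eta> (prtt D e)"
    using assms(2) tau_base(1)[OF assms(4)] prtt_in[OF assms(3)] unfolding invariant_def by blast
  then show ?thesis using U_coord[OF assms(1,3,4)] by simp
qed

lemma invariantI:
  assumes \<eta>: "ttsection \<eta>"
    and eq: "\<And>e b. e \<in> C \<Longrightarrow> b \<in> carrier G \<Longrightarrow>
      TT.coord e (\<eta> (prtt D e)) = rep D b (TT.coord (act D e b) (\<eta> (prtt D (act D e b))))"
  shows "invariant \<eta>"
  unfolding invariant_def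
proof (intro ballI)
  fix \<pi> :: "'n \<Rightarrow> 'n" and p :: "'a^'n" assume \<pi>: "\<pi> \<in> perms" and p: "p \<in> conf M"
  obtain e where e: "e \<in> C" "prtt D e = p" using conf_lift[OF p] by blast
  obtain b where b: "b \<in> carrier G" "tau D b = \<pi>" using tau_surj[OF \<pi>(1)] by blast
  have "TT.coord e (U_op D \<pi> \<eta> (prtt D e)) = TT.coord e (\<eta> (prtt D e))"
    using eq[OF e(1) b(1)] U_coord[OF \<eta> e(1) b(1)] b(2) by simp
  then have "U_op D \<pi> \<eta> (prtt D e) = \<eta> (prtt D e)"
    by (rule TT.fibre_eqI[OF e(1) U_fibre[OF \<eta> e(1) \<pi>] ttsectionD[OF \<eta> e(1)]])
  then show "U_op D \<pi> \<eta> p = \<eta> p" using e(2) by simp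
qed

text \<open>The inverse of the pullback on invariant sections. The chosen point over
  \<open>x\<close> fixes both an ordering of the particles and a frame; invariance makes the
  resulting orbit independent of that choice.\<close>

definition descend :: "('a^'n \<Rightarrow> ('e, 'k) orbit) \<Rightarrow> ('a, 'n) sym_power \<Rightarrow> ('e, 'k) orbit" where
  "descend \<eta> x = (let e = SOME e. e \<in> C \<and> prt D e = x in chi D (carrier G) e (TT.coord e (\<eta> (prtt D e))))"

lemma descend_chi:
  assumes \<eta>: "ttsection \<eta>" "invariant \<eta>" and e: "e \<in> C"
  shows "descend \<eta> (prt D e) = chi D (carrier G) e (TT.coord e (\<eta> (prtt D e)))"
proof -
  define e' where "e' = (SOME e'. e' \<in> C \<and> prt D e' = prt D e)"
  have e': "e' \<in> C" "prt D e' = prt D e"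
    using someI[of "\<lambda>e'. e' \<in> C \<and> prt D e' = prt D e" e] e unfolding e'_def by auto
  then obtain b where b: "b \<in> carrier G" "e' = act D e b" using prt_fibre[OF e] by blast
  have "TT.coord e' (\<eta> (prtt D e')) = rep D (binv b) (TT.coord e (\<eta> (prtt D e)))"
    using invariant_coord[OF \<eta> e b(1)] b by (simp add: rep_inv)
  then show ?thesis
    using T.chi_act[OF e b(1)] b(2) by (simp add: descend_def Let_def e'_def[symmetric])
qed

lemma
  assumes \<eta>: "ttsection \<eta>" "invariant \<eta>" and e: "e \<in> C"
  shows descend_fibre: "descend \<eta> (prt D e) \<in> T.fibre (prt D e)"
    and descend_coord: "T.coord e (descend \<eta> (prt D e)) = TT.coord e (\<eta> (prtt D e))"
  using descend_chi[OF assms] e by (simp_all add: T.chi_fibre)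

lemma descend_section: "ttsection \<eta> \<Longrightarrow> invariant \<eta> \<Longrightarrow> tsection (descend \<eta>)"
  unfolding tsection_def covering_space_imp_surjective[OF cov_t, symmetric] using descend_fibre by blast

section \<open>Regularity of pulled back, permuted and descended sections\<close>

lemma pullback_LS:
  assumes c: "compatible M reg regT" and \<xi>: "\<xi> \<in> T.LS regT"
  shows "Pr_pullback D \<xi> \<in> TT.LS reg"
proof (rule TT.LS_I)
  note sec = tsection_LS[OF \<xi>]
  fix p :: "'a^'n" assume "p \<in> space (conf_measure M)"
  then have p: "p \<in> conf M" by (simp add: space_conf_measure)
  then obtain e where e: "e \<in> C" "prtt D e = p" using conf_lift by blast
  have pe: "pr p = prt D e" using e pr_prtt by blast
  show "Pr_pullback D \<xi> p \<in> TT.fibre p" using pullback_fibre[OF sec e(1)] e(2) by simp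
  obtain U s where s: "T.lsec U s" "prt D e \<in> U" "s (prt D e) = e" using T.ex_lsec[OF e(1)] by blast
  obtain V where V: "prt D e \<in> V" "V \<subseteq> U" "open_nconf M V" "regT V (\<lambda>y. T.coord (s y) (\<xi> y))"
    using T.LS_coord[of regT \<xi> U s "prt D e"] compatibleD(2)[OF c] \<xi> s
    by (auto simp: space_nconf_measure)
  let ?Y = "conf M \<inter> pr -` V"
  have Y: "open_conf M ?Y" by (rule openin_pr_vimage[OF V(3)])
  have sC: "s (pr y) \<in> C" "prt D (s (pr y)) = pr y" if "y \<in> ?Y" for y
    using T.lsecD(3,4)[OF s(1), of "pr y"] that V(2) by auto
  have cs: "continuous_on ?Y (\<lambda>y. s (pr y))"
    by (rule continuous_on_compose2[OF T.lsecD(2)[OF s(1)] continuous_on_pr]) (use V(2) in auto)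
  have cps: "continuous_on ?Y (\<lambda>y. prtt D (s (pr y)))"
    by (rule continuous_on_compose2[OF continuous_prtt cs]) (use sC in auto)
  \<comment> \<open>\<open>s (pr y)\<close> has the right unordered image, but its ordering may
    differ from that of \<open>y\<close>. Where the orderings agree is an open set, and it contains
    \<open>p\<close> because \<open>s\<close> was chosen through \<open>e\<close>.\<close>
  let ?W = "{y\<in>?Y. prtt D (s (pr y)) = permute (id y) id}"
  have "openin (top_of_set ?Y) ?W"
    using cps by (intro openin_permute_level[where M = M]) (auto simp: pr_prtt sC)
  then have W: "open_conf M ?W" using Y openin_trans by blast
  have 1: "TT.lsec ?W (\<lambda>y. s (pr y))"
    unfolding TT.lsec_def space_conf_measure
    using W cs sC by (auto intro: continuous_on_subset)
  have "reg ?Y (\<lambda>y. T.coord (s (pr y)) (\<xi> (pr y)))"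
    by (rule compatibleD(3)[OF c, OF V(3,4)])
  then have 2: "reg ?W (\<lambda>y. TT.coord (s (pr y)) (Pr_pullback D \<xi> y))"
  proof (rule regularityD(1)[OF compatibleD(1)[OF c], OF Y W, rotated])
    fix y assume "y \<in> ?W"
    then show "TT.coord (s (pr y)) (Pr_pullback D \<xi> y) = T.coord (s (pr y)) (\<xi> (pr y))"
      using pullback_coord[OF sec sC(1), of y] sC(2)[of y] by simp
  qed auto
  have "p \<in> ?W" using p V(1) s(3) e(2) pe by simp
  then show "\<exists>U s. TT.lsec U s \<and> p \<in> U \<and> reg U (\<lambda>y. TT.coord (s y) (Pr_pullback D \<xi> y))"
    using 1 2 by blast
qed

lemma U_LS:
  assumes c: "compatible M reg regT" and \<eta>: "\<eta> \<in> TT.LS reg" and \<pi>: "\<pi> \<in> perms"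
  shows "U_op D \<pi> \<eta> \<in> TT.LS reg"
proof (rule TT.LS_I)
  note sec = ttsection_LS[OF \<eta>]
  fix p :: "'a^'n" assume "p \<in> space (conf_measure M)"
  then have p: "p \<in> conf M" by (simp add: space_conf_measure)
  then obtain e where e: "e \<in> C" "prtt D e = p" using conf_lift by blast
  show "U_op D \<pi> \<eta> p \<in> TT.fibre p" using U_fibre[OF sec e(1) \<pi>] e(2) by simp
  obtain b where b: "b \<in> carrier G" "tau D b = \<pi>" using tau_surj[OF \<pi>(1)] by blast
  have eb: "act D e b \<in> C" "prtt D (act D e b) = permute p \<pi>" using e b by (simp_all add: act_closed prtt_act)
  obtain U s where s: "TT.lsec U s" "permute p \<pi> \<in> U" using TT.ex_lsec[OF eb(1)] eb(2) by metis
  obtain V where V: "permute p \<pi> \<in> V" "V \<subseteq> U" "open_conf M V" "reg V (\<lambda>y. TT.coord (s y) (\<eta> y))"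
    using TT.LS_coord[of reg \<eta> U s "permute p \<pi>"] compatibleD(1)[OF c] \<eta> s
    by (auto simp: space_conf_measure)
  \<comment> \<open>The section \<open>s\<close> lives near the permuted configuration; translation
    by the inverse braid moves it back near \<open>p\<close>, and there \<open>U_op\<close> acts on
    coordinates as the constant linear map \<open>rep D b\<close>.\<close>
  let ?W = "(\<lambda>p. permute p \<pi>) -` V" and ?t = "\<lambda>y. act D (s (permute y \<pi>)) (binv b)"
  have W: "open_conf M ?W" by (rule openin_permute_vimage[OF \<pi> V(3)])
  have sC: "s (permute y \<pi>) \<in> C" "prtt D (s (permute y \<pi>)) = permute y \<pi>" if "y \<in> ?W" for y
    using TT.lsecD(3,4)[OF s(1), of "permute y \<pi>"] that V(2) by auto
  have cs: "continuous_on ?W (\<lambda>y. s (permute y \<pi>))"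
    by (rule continuous_on_compose2[OF TT.lsecD(2)[OF s(1)] continuous_on_permute]) (use V(2) in auto)
  have ct: "continuous_on ?W ?t"
    by (rule continuous_on_compose2[OF continuous_act cs]) (use b sC in auto)
  have tb: "\<pi> \<circ> tau D (binv b) = id"
    using tau_inv[of "binv b"] b by simp
  have t: "?t y \<in> C" "prtt D (?t y) = y" "act D (?t y) b = s (permute y \<pi>)" if "y \<in> ?W" for y
    using sC[OF that] b tb by (simp_all add: act_closed prtt_act permute_comp act_inv')
  have 1: "TT.lsec ?W ?t"
    unfolding TT.lsec_def space_conf_measure using W ct t by auto
  have "reg ?W (\<lambda>y. TT.coord (s (permute y \<pi>)) (\<eta> (permute y \<pi>)))"
    by (rule compatibleD(4)[OF c, OF V(3) \<pi> V(4)])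
  then have "reg ?W (\<lambda>y. rep D b (TT.coord (s (permute y \<pi>)) (\<eta> (permute y \<pi>))))"
    by (rule regularityD(4)[OF compatibleD(1)[OF c], OF W linear_rep[OF b(1)]])
  then have 2: "reg ?W (\<lambda>y. TT.coord (?t y) (U_op D \<pi> \<eta> y))"
  proof (rule regularityD(1)[OF compatibleD(1)[OF c], OF W W, rotated])
    fix y assume y: "y \<in> ?W"
    show "TT.coord (?t y) (U_op D \<pi> \<eta> y) = rep D b (TT.coord (s (permute y \<pi>)) (\<eta> (permute y \<pi>)))"
      using U_coord[OF sec t(1)[OF y] b(1)] t[OF y] sC[OF y] b(2) by simp
  qed auto
  have "p \<in> ?W" using V(1) by simp
  then show "\<exists>U s. TT.lsec U s \<and> p \<in> U \<and> reg U (\<lambda>y. TT.coord (s y) (U_op D \<pi> \<eta> y))"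
    using 1 2 by blast
qed

lemma descend_LS:
  assumes c: "compatible M reg regT" and \<eta>: "\<eta> \<in> TT.LS reg" and inv: "invariant \<eta>"
  shows "descend \<eta> \<in> T.LS regT"
proof (rule T.LS_I)
  note sec = ttsection_LS[OF \<eta>]
  fix x :: "('a, 'n) sym_power" assume "x \<in> space (nconf_measure M)"
  then have x: "x \<in> nconf M" by (simp add: space_nconf_measure)
  then show "descend \<eta> x \<in> T.fibre x" using descend_section[OF sec inv] by (simp add: tsection_def)
  obtain p where p: "p \<in> conf M" "x = pr p" using x by (auto simp: nconf_def)
  then obtain e where e: "e \<in> C" "prtt D e = p" using conf_lift by blast
  obtain U s where s: "TT.lsec U s" "p \<in> U" using TT.ex_lsec[OF e(1)] e(2) by metis
  obtain V0 where V0: "p \<in> V0" "V0 \<subseteq> U" "open_conf M V0" "reg V0 (\<lambda>y. TT.coord (s y) (\<eta> y))"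
    using TT.LS_coord[of reg \<eta> U s p] compatibleD(1)[OF c] \<eta> s
    by (auto simp: space_conf_measure)
  \<comment> \<open>On a single sheet \<open>pr\<close> has a continuous inverse, and composition
    with it turns the local section of \<open>prtt\<close> into one of \<open>prt\<close>.\<close>
  obtain V where V: "p \<in> V" "V \<subseteq> V0" "open_conf M V" "inj_on pr V"
    using ex_injective_nbhd[OF V0(3,1)] by blast
  have regV: "reg V (\<lambda>y. TT.coord (s y) (\<eta> y))"
    by (rule regularity_mono[OF compatibleD(1)[OF c], OF V0(3) V(3,2) V0(4)])
  let ?i = "the_inv_into V pr"
  have W: "open_nconf M (pr ` V)" by (rule openin_pr_image[OF V(3)])
  have i: "?i y \<in> V" "pr (?i y) = y" if "y \<in> pr ` V" for y
    using that V(4) by (auto simp: the_inv_into_into f_the_inv_into_f)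
  have sC: "s (?i y) \<in> C" "prtt D (s (?i y)) = ?i y" "prt D (s (?i y)) = y" if "y \<in> pr ` V" for y
    using TT.lsecD(3,4)[OF s(1), of "?i y"] i[OF that] V(2) V0(2) pr_prtt[of "s (?i y)"] by auto
  have cs: "continuous_on (pr ` V) (\<lambda>y. s (?i y))"
    by (rule continuous_on_compose2[OF TT.lsecD(2)[OF s(1)] continuous_on_the_inv_pr[OF V(3,4)]])
      (use i V(2) V0(2) in blast)
  have 1: "T.lsec (pr ` V) (\<lambda>y. s (?i y))"
    unfolding T.lsec_def space_nconf_measure using W cs sC by auto
  have "regT (pr ` V) (\<lambda>y. TT.coord (s (?i y)) (\<eta> (?i y)))"
    by (rule compatibleD(5)[OF c, OF V(3,4) regV])
  then have 2: "regT (pr ` V) (\<lambda>y. T.coord (s (?i y)) (descend \<eta> y))"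
  proof (rule regularityD(1)[OF compatibleD(2)[OF c], OF W W, rotated])
    fix y assume y: "y \<in> pr ` V"
    show "T.coord (s (?i y)) (descend \<eta> y) = TT.coord (s (?i y)) (\<eta> (?i y))"
      using descend_coord[OF sec inv sC(1)[OF y]] sC[OF y] by simp
  qed auto
  show "\<exists>U s. T.lsec U s \<and> x \<in> U \<and> regT U (\<lambda>y. T.coord (s y) (descend \<eta> y))"
    using 1 2 V(1) p(2) by blast
qed

section \<open>The average over permutations\<close>

lemma P_op_chi:
  assumes \<eta>: "ttsection \<eta>" and e: "e \<in> C"
  shows "P_op D \<eta> (prtt D e) = chi D PB e ((1 / fact CARD('n)) *s (\<Sum>\<pi>\<in>perms. TT.coord e (U_op D \<pi> \<eta> (prtt D e))))"
  unfolding P_op_def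
proof (rule the_equality)
  have U: "U_op D \<pi> \<eta> (prtt D e) = chi D PB e (TT.coord e (U_op D \<pi> \<eta> (prtt D e)))" if "\<pi> \<in> perms" for \<pi>
    using TT.chi_coord[OF e U_fibre[OF \<eta> e that]] by simp
  then show "\<exists>e'\<in>C. \<exists>f. prtt D e' = prtt D e \<and> (\<forall>\<pi>\<in>perms. U_op D \<pi> \<eta> (prtt D e) = chi D PB e' (f \<pi>)) \<and>
      chi D PB e ((1 / fact CARD('n)) *s (\<Sum>\<pi>\<in>perms. TT.coord e (U_op D \<pi> \<eta> (prtt D e)))) =
      chi D PB e' ((1 / fact CARD('n)) *s (\<Sum>\<pi>\<in>perms. f \<pi>))"
    using e by (intro bexI[of _ e] exI[of _ "\<lambda>\<pi>. TT.coord e (U_op D \<pi> \<eta> (prtt D e))"]) auto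
  fix u assume "\<exists>e'\<in>C. \<exists>f. prtt D e' = prtt D e \<and> (\<forall>\<pi>\<in>perms. U_op D \<pi> \<eta> (prtt D e) = chi D PB e' (f \<pi>)) \<and>
      u = chi D PB e' ((1 / fact CARD('n)) *s (\<Sum>\<pi>\<in>perms. f \<pi>))"
  then obtain e' f where *: "e' \<in> C" "prtt D e' = prtt D e"
    "\<And>\<pi>. \<pi> \<in> perms \<Longrightarrow> U_op D \<pi> \<eta> (prtt D e) = chi D PB e' (f \<pi>)"
    "u = chi D PB e' ((1 / fact CARD('n)) *s (\<Sum>\<pi>\<in>perms. f \<pi>))" by blast
  obtain b where b: "b \<in> PB" "e' = act D e b" using prtt_fibre_iff[OF e *(1)] *(2) by auto
  have bi: "binv b \<in> carrier G" using TT.H_carrier[OF b(1)] by simp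
  have "f \<pi> = rep D (binv b) (TT.coord e (U_op D \<pi> \<eta> (prtt D e)))" if "\<pi> \<in> perms" for \<pi>
    using TT.coord_act[OF e b(1) U_fibre[OF \<eta> e that]] *(1,3) that b(2) TT.coord_chi[OF *(1), of "f \<pi>"] by metis
  then have "(\<Sum>\<pi>\<in>perms. f \<pi>) = rep D (binv b) (\<Sum>\<pi>\<in>perms. TT.coord e (U_op D \<pi> \<eta> (prtt D e)))"
    by (simp add: rep_sum[OF bi])
  then show "u = chi D PB e ((1 / fact CARD('n)) *s (\<Sum>\<pi>\<in>perms. TT.coord e (U_op D \<pi> \<eta> (prtt D e))))"
    using *(4) b(2) TT.chi_act[OF e b(1)] by (simp add: rep_scale[OF bi, symmetric])
qed

lemma P_lincomb:
  assumes \<eta>: "ttsection \<eta>"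
  shows "TT.lincomb perms (\<lambda>_. (1 / fact CARD('n))) (\<lambda>\<pi>. U_op D \<pi> \<eta>) (P_op D \<eta>)"
  unfolding TT.lincomb_def
  by (auto simp: P_op_chi[OF \<eta>] TT.chi_fibre vec.scale_sum_right)

lemma P_section: "ttsection \<eta> \<Longrightarrow> ttsection (P_op D \<eta>)"
  using TT.lincombD(1)[OF P_lincomb] conf_lift unfolding ttsection_def by metis

text \<open>Acting with one more permutation is composition on the left, by \<open>U_comp\<close>,
  and this merely reindexes the sum over the group.\<close>

lemma P_invariant:
  assumes \<eta>: "ttsection \<eta>"
  shows "invariant (P_op D \<eta>)"
proof (rule invariantI[OF P_section[OF \<eta>]])
  fix e b assume e: "e \<in> C" and b: "b \<in> carrier G"
  have eb: "act D e b \<in> C" using e b by (simp add: act_closed)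
  let ?\<pi> = "tau D b"
  have \<pi>: "?\<pi> \<in> perms" by (rule tau_base(1)[OF b])
  have "rep D b (TT.coord (act D e b) (P_op D \<eta> (prtt D (act D e b)))) =
      (\<Sum>\<sigma>\<in>perms. (1 / fact CARD('n)) *s rep D b (TT.coord (act D e b) (U_op D \<sigma> \<eta> (prtt D (act D e b)))))"
    by (simp add: TT.lincombD(2)[OF P_lincomb[OF \<eta>] eb refl] rep_sum[OF b] rep_scale[OF b])
  also have "\<dots> = (\<Sum>\<sigma>\<in>perms. (1 / fact CARD('n)) *s TT.coord e (U_op D (?\<pi> \<circ> \<sigma>) \<eta> (prtt D e)))"
    using U_coord[OF U_section[OF \<eta>] e b] U_comp[OF \<eta> \<pi> _ prtt_in[OF e]]
    by (intro sum.cong refl) metis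
  also have "\<dots> = (\<Sum>\<sigma>\<in>perms. (1 / fact CARD('n)) *s TT.coord e (U_op D \<sigma> \<eta> (prtt D e)))"
  proof (rule sum.reindex_bij_betw[of "(\<circ>) ?\<pi>" perms perms "\<lambda>\<sigma>. (1 / fact CARD('n)) *s TT.coord e (U_op D \<sigma> \<eta> (prtt D e))"])
    show "bij_betw ((\<circ>) ?\<pi>) perms perms"
      by (rule bij_betwI[of _ _ _ "(\<circ>) (inv_into UNIV ?\<pi>)"])
        (auto simp: perms_comp[OF \<pi>] perms_comp[OF perms_inv[OF \<pi>]] comp_assoc[symmetric] perms_inv_comp[OF \<pi>])
  qed
  also have "\<dots> = TT.coord e (P_op D \<eta> (prtt D e))"
    by (simp add: TT.lincombD(2)[OF P_lincomb[OF \<eta>] e refl])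
  finally show "TT.coord e (P_op D \<eta> (prtt D e)) =
      rep D b (TT.coord (act D e b) (P_op D \<eta> (prtt D (act D e b))))" by simp
qed

text \<open>Only the value of \<open>\<eta>\<close> and of its transforms at the one configuration
  \<open>p\<close> matters, so the lemma also serves sections that are invariant merely almost
  everywhere.\<close>

lemma P_fixes:
  assumes \<eta>: "ttsection \<eta>" and p: "p \<in> conf M" and inv: "\<And>\<pi>. \<pi> \<in> perms \<Longrightarrow> U_op D \<pi> \<eta> p = \<eta> p"
  shows "P_op D \<eta> p = \<eta> p"
proof -
  obtain e where e: "e \<in> C" "prtt D e = p" using conf_lift[OF p] by blast
  have "TT.coord e (P_op D \<eta> p) = (\<Sum>\<pi>\<in>(perms :: ('n \<Rightarrow> 'n) set). (1 / fact CARD('n)) *s TT.coord e (\<eta> p))"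
    using TT.lincombD(2)[OF P_lincomb[OF \<eta>] e] inv by (auto intro: sum.cong)
  also have "\<dots> = TT.coord e (\<eta> p)"
    unfolding vec_eq_iff sum_component vector_smult_component
    unfolding sum_constant card_perms by simp
  finally show ?thesis
    using TT.lincombD(1)[OF P_lincomb[OF \<eta>] e] ttsectionD[OF \<eta> e(1)] e(2)
    by (intro TT.fibre_eqI[OF e(1)]) simp_all
qed

end

section \<open>The unitary equivalence\<close>

context assoc
begin

lemma dist_sq_cong:
  "(\<And>x. x \<in> X \<Longrightarrow> \<eta> x = \<eta>' x) \<Longrightarrow> (\<And>x. x \<in> X \<Longrightarrow> \<theta> x = \<theta>' x) \<Longrightarrow> dist_sq B \<eta> \<theta> = dist_sq B \<eta>' \<theta>'"
  unfolding dist_sq_diff by (intro Bochner_Integration.integral_cong refl) simp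

lemma dist_sq_self:
  assumes "\<eta> \<in> sqint"
  shows "dist_sq B \<eta> \<eta> = 0"
proof -
  have "nsq (diff \<eta> \<eta> x) = 0" if x: "x \<in> X" for x
  proof -
    obtain e where e: "e \<in> C" "q e = x" using q_surj[OF x] by blast
    show ?thesis using nsq_diff[OF e(1), of "\<eta> x" "\<eta> x"] sqint_fibre[OF assms x] e(2) by simp
  qed
  then have "dist_sq B \<eta> \<eta> = (LINT x|\<mu>. 0)"
    unfolding dist_sq_diff by (intro Bochner_Integration.integral_cong refl) simp
  then show ?thesis by simp
qed

lemma dist_sq_cong_AE:
  assumes "\<eta> \<in> sqint" "\<theta> \<in> sqint" "\<theta>' \<in> sqint" and ae: "AE x in \<mu>. \<theta> x = \<theta>' x"
  shows "dist_sq B \<eta> \<theta> = dist_sq B \<eta> \<theta>'"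
  unfolding dist_sq_diff
proof (rule integral_cong_AE)
  show "AE x in \<mu>. nsq (diff \<eta> \<theta> x) = nsq (diff \<eta> \<theta>' x)"
    by (rule AE_mp[OF ae]) simp
qed (use assms sqint_borel_measurable diff_sqint in auto)

lemma AE_eq_of_dist_sq_zero:
  assumes "\<eta> \<in> sqint" "\<theta> \<in> sqint" "dist_sq B \<eta> \<theta> = 0"
  shows "AE x in \<mu>. \<eta> x = \<theta> x"
  using dist_sq_limit_unique[of "\<lambda>_. \<eta>" \<eta> \<theta>] assms dist_sq_self by simp

end

text \<open>This is 1/sqrt(n!) for \<open>N = CARD('n)\<close>, kept as the product of the rescaling
  and the prefactor of the pullback. Its squared modulus 1/n! compensates the n! sheets of
  \<open>pr\<close>.\<close>

definition kappa :: "nat \<Rightarrow> complex" where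
  "kappa N = complex_of_real (sqrt (fact N)) * (1 / fact N)"

lemma kappa_nonzero: "kappa N \<noteq> 0"
  by (simp add: kappa_def)

lemma kappa_sq: "cnj (kappa N) * kappa N = complex_of_real (1 / fact N)"
proof -
  have "cnj (kappa N) * kappa N =
      complex_of_real (sqrt (fact N)) * complex_of_real (sqrt (fact N)) * ((1 / fact N) * (1 / fact N))"
    by (simp add: kappa_def)
  also have "complex_of_real (sqrt (fact N)) * complex_of_real (sqrt (fact N)) = fact N"
    unfolding of_real_mult[symmetric] by simp
  finally show ?thesis by simp
qed

lemma hinner_scale: "hinner (c *s f) (c *s g) = cnj c * c * hinner f g"
  by (simp add: hinner_def sum_distrib_left algebra_simps)

lemma norm_kappa: "(norm (kappa N *s f))\<^sup>2 = 1 / fact N * (norm f)\<^sup>2"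
proof -
  have "complex_of_real ((norm (kappa N *s f))\<^sup>2) = complex_of_real (1 / fact N * (norm f)\<^sup>2)"
    unfolding norm_vec_sq_hinner[symmetric] hinner_scale kappa_sq
    by (simp add: norm_vec_sq_hinner)
  then show ?thesis by (simp only: of_real_eq_iff)
qed

context braid_model
begin

text \<open>The rescaled pullback on actual sections; the map on classes is later computed from
  it.\<close>

definition J :: "(('a, 'n) sym_power \<Rightarrow> ('e, 'k) orbit) \<Rightarrow> 'a^'n \<Rightarrow> ('e, 'k) orbit" where
  "J \<xi> p = fscale TT.B (complex_of_real (sqrt (fact CARD('n)))) (fscale TT.B (1 / fact CARD('n)) (Pr_pullback D \<xi> p))"

lemma
  assumes \<xi>: "tsection \<xi>" and e: "e \<in> C"
  shows J_fibre: "J \<xi> (prtt D e) \<in> TT.fibre (prtt D e)"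
    and J_coord: "TT.coord e (J \<xi> (prtt D e)) = kappa CARD('n) *s T.coord e (\<xi> (prt D e))"
  using pullback_fibre[OF assms] pullback_coord[OF assms] e
  by (simp_all add: J_def kappa_def TT.fscale_fibre TT.coord_fscale vector_smult_assoc)

lemma J_section: "tsection \<xi> \<Longrightarrow> ttsection (J \<xi>)"
  using J_fibre conf_lift unfolding ttsection_def by metis

lemma J_lincomb:
  assumes "tsection \<xi>"
  shows "TT.lincomb (UNIV::unit set) (\<lambda>_. kappa CARD('n)) (\<lambda>_. Pr_pullback D \<xi>) (J \<xi>)"
  unfolding TT.lincomb_def using assms by (auto simp: J_fibre J_coord pullback_coord)

lemma
  assumes "compatible M reg regT"
  shows compatible_regularity: "regularity TT.X reg" "regularity T.X regT"
  using compatibleD(1,2)[OF assms] by (simp_all add: space_conf_measure space_nconf_measure)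

lemma J_LS:
  assumes c: "compatible M reg regT" and \<xi>: "\<xi> \<in> T.LS regT"
  shows "J \<xi> \<in> TT.LS reg"
  by (rule TT.LS_lincomb[OF compatible_regularity(1)[OF c] _ pullback_LS[OF c \<xi>] J_lincomb[OF tsection_LS[OF \<xi>]]]) simp

text \<open>In each frame the coordinate of \<open>J \<xi>\<close> is a fixed multiple of that of
  \<open>\<xi>\<close>, which is equivariant under all braids and not only the pure ones.\<close>

lemma J_invariant:
  assumes \<xi>: "tsection \<xi>"
  shows "invariant (J \<xi>)"
proof (rule invariantI[OF J_section[OF \<xi>]])
  fix e b assume e: "e \<in> C" and b: "b \<in> carrier G"
  have eb: "act D e b \<in> C" "prt D (act D e b) = prt D e" using e b by (simp_all add: act_closed prt_act)
  show "TT.coord e (J \<xi> (prtt D e)) = rep D b (TT.coord (act D e b) (J \<xi> (prtt D (act D e b))))"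
    using T.coord_act[OF e b tsectionD[OF \<xi> e]] b
    by (simp add: J_coord[OF \<xi> e] J_coord[OF \<xi> eb(1)] eb(2) rep_scale rep_inv')
qed

lemma finner_J:
  assumes \<xi>: "tsection \<xi>" and \<zeta>: "tsection \<zeta>" and p: "p \<in> conf M"
  shows "finner TT.B (J \<xi> p) (J \<zeta> p) = (1 / fact CARD('n)) *\<^sub>R finner T.B (\<xi> (pr p)) (\<zeta> (pr p))"
proof -
  obtain e where e: "e \<in> C" "prtt D e = p" using conf_lift[OF p] by blast
  have pe: "pr p = prt D e" using e pr_prtt by blast
  have "finner TT.B (J \<xi> p) (J \<zeta> p) = cnj (kappa CARD('n)) * kappa CARD('n) *
      hinner (T.coord e (\<xi> (prt D e))) (T.coord e (\<zeta> (prt D e)))"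
    using TT.finner_coord[OF e(1) J_fibre[OF \<xi> e(1)] J_fibre[OF \<zeta> e(1)]]
    by (simp add: J_coord[OF \<xi> e(1)] J_coord[OF \<zeta> e(1)] hinner_scale e(2)[symmetric])
  also have "\<dots> = (1 / fact CARD('n)) *\<^sub>R finner T.B (\<xi> (pr p)) (\<zeta> (pr p))"
    unfolding kappa_sq pe T.finner_coord[OF e(1) tsectionD[OF \<xi> e(1)] tsectionD[OF \<zeta> e(1)]]
    by (simp add: scaleR_conv_of_real)
  finally show ?thesis .
qed

lemma nsq_J: "tsection \<xi> \<Longrightarrow> p \<in> conf M \<Longrightarrow> TT.nsq (J \<xi> p) = 1 / fact CARD('n) * T.nsq (\<xi> (pr p))"
  unfolding TT.nsq_def T.nsq_def by (simp add: finner_J)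

lemma J_sqint:
  assumes \<xi>: "\<xi> \<in> T.sqint"
  shows "J \<xi> \<in> TT.sqint"
proof -
  have "integrable (conf_measure M) (\<lambda>p. 1 / fact CARD('n) * T.nsq (\<xi> (pr p)))"
    using T.sqint_integrable[OF \<xi>] integrable_nconf[OF T.sqint_borel_measurable[OF \<xi>]]
    by (intro integrable_mult_right) simp
  then have "integrable (conf_measure M) (\<lambda>p. TT.nsq (J \<xi> p))"
    by (subst Bochner_Integration.integrable_cong[OF refl nsq_J[OF tsection_sqint[OF \<xi>]]])
      (simp_all add: space_conf_measure)
  then show ?thesis
    using J_LS[OF compatible_borel] \<xi> unfolding TT.sqint_iff T.sqint_iff by blast
qed

text \<open>The pointwise factor 1/n! from \<open>finner_J\<close> is exactly the weight that
  relates an integral over \<open>nconf M\<close> to that of the pulled back function.\<close>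

lemma integral_J:
  assumes \<xi>: "\<xi> \<in> T.sqint" and \<zeta>: "\<zeta> \<in> T.sqint"
  shows "(LINT p|conf_measure M. finner TT.B (J \<xi> p) (J \<zeta> p)) = (LINT x|nconf_measure M. finner T.B (\<xi> x) (\<zeta> x))"
proof -
  have "(LINT p|conf_measure M. finner TT.B (J \<xi> p) (J \<zeta> p)) =
      (LINT p|conf_measure M. (1 / fact CARD('n)) *\<^sub>R finner T.B (\<xi> (pr p)) (\<zeta> (pr p)))"
    by (intro Bochner_Integration.integral_cong refl finner_J tsection_sqint \<xi> \<zeta>) (simp add: space_conf_measure)
  also have "\<dots> = (LINT x|nconf_measure M. finner T.B (\<xi> x) (\<zeta> x))"
    by (subst integral_nconf[OF T.borel_measurable_finner]) (use \<xi> \<zeta> in \<open>simp_all add: T.sqint_iff\<close>)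
  finally show ?thesis .
qed

lemma dist_J:
  assumes \<xi>: "\<xi> \<in> T.sqint" and \<zeta>: "\<zeta> \<in> T.sqint"
  shows "dist_sq TT.B (J \<xi>) (J \<zeta>) = dist_sq T.B \<xi> \<zeta>"
proof -
  note sec = tsection_sqint[OF \<xi>] tsection_sqint[OF \<zeta>]
  have "TT.nsq (TT.diff (J \<xi>) (J \<zeta>) p) = (1 / fact CARD('n)) *\<^sub>R T.nsq (T.diff \<xi> \<zeta> (pr p))"
    if p: "p \<in> conf M" for p
  proof -
    obtain e where e: "e \<in> C" "prtt D e = p" using conf_lift[OF p] by blast
    have pe: "pr p = prt D e" using e pr_prtt by blast
    have "TT.nsq (TT.diff (J \<xi>) (J \<zeta>) p) =
        (norm (kappa CARD('n) *s (T.coord e (\<xi> (prt D e)) - T.coord e (\<zeta> (prt D e)))))\<^sup>2"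
      using TT.nsq_diff[OF e(1) J_fibre[OF sec(1) e(1)] J_fibre[OF sec(2) e(1)]]
      by (simp add: J_coord[OF sec(1) e(1)] J_coord[OF sec(2) e(1)] vector_ssub_ldistrib e(2)[symmetric])
    also have "\<dots> = (1 / fact CARD('n)) *\<^sub>R T.nsq (T.diff \<xi> \<zeta> (pr p))"
      unfolding norm_kappa pe T.nsq_diff[OF e(1) tsectionD[OF sec(1) e(1)] tsectionD[OF sec(2) e(1)]]
      by simp
    finally show ?thesis .
  qed
  then have "dist_sq TT.B (J \<xi>) (J \<zeta>) = (LINT p|conf_measure M. (1 / fact CARD('n)) *\<^sub>R T.nsq (T.diff \<xi> \<zeta> (pr p)))"
    unfolding TT.dist_sq_diff by (intro Bochner_Integration.integral_cong refl) (simp add: space_conf_measure)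
  also have "\<dots> = dist_sq T.B \<xi> \<zeta>"
    unfolding T.dist_sq_diff
    by (subst integral_nconf[OF T.sqint_borel_measurable[OF T.diff_sqint[OF \<xi> \<zeta>]]]) simp
  finally show ?thesis .
qed

section \<open>Norm estimates for the permutation operators and their average\<close>

lemma nsq_U:
  assumes \<eta>: "ttsection \<eta>" and \<pi>: "\<pi> \<in> perms" and p: "p \<in> conf M"
  shows "TT.nsq (U_op D \<pi> \<eta> p) = TT.nsq (\<eta> (permute p \<pi>))"
proof -
  obtain e where e: "e \<in> C" "prtt D e = p" using conf_lift[OF p] by blast
  obtain b where b: "b \<in> carrier G" "tau D b = \<pi>" using tau_surj[OF \<pi>(1)] by blast
  have eb: "act D e b \<in> C" "prtt D (act D e b) = permute p \<pi>" using e b by (simp_all add: act_closed prtt_act)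
  show ?thesis
    using TT.nsq_coord[OF e(1) U_fibre[OF \<eta> e(1) \<pi>]] TT.nsq_coord[OF eb(1) ttsectionD[OF \<eta> eb(1)]]
      U_coord[OF \<eta> e(1) b(1)] b e eb(2) by (simp add: norm_rep)
qed

lemma U_sqint:
  assumes \<eta>: "\<eta> \<in> TT.sqint" and \<pi>: "\<pi> \<in> perms"
  shows "U_op D \<pi> \<eta> \<in> TT.sqint"
proof -
  have "integrable (conf_measure M) (\<lambda>p. TT.nsq (\<eta> (permute p \<pi>)))"
    using integrable_permute[OF ok \<pi> TT.sqint_borel_measurable[OF \<eta>]] TT.sqint_integrable[OF \<eta>] by simp
  then have "integrable (conf_measure M) (\<lambda>p. TT.nsq (U_op D \<pi> \<eta> p))"
    by (subst Bochner_Integration.integrable_cong[OF refl nsq_U[OF ttsection_sqint[OF \<eta>] \<pi>]])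
      (simp_all add: space_conf_measure)
  then show ?thesis
    using U_LS[OF compatible_borel _ \<pi>] \<eta> unfolding TT.sqint_iff by blast
qed

text \<open>Unitarity of the representation moves the pointwise squared distance to the permuted
  configuration unchanged; invariance of the measure removes the permutation.\<close>

lemma dist_U:
  assumes \<eta>: "\<eta> \<in> TT.sqint" and \<theta>: "\<theta> \<in> TT.sqint" and \<pi>: "\<pi> \<in> perms"
  shows "dist_sq TT.B (U_op D \<pi> \<eta>) (U_op D \<pi> \<theta>) = dist_sq TT.B \<eta> \<theta>"
proof -
  note sec = ttsection_sqint[OF \<eta>] ttsection_sqint[OF \<theta>]
  obtain b where b: "b \<in> carrier G" "tau D b = \<pi>" using tau_surj[OF \<pi>(1)] by blast
  have "TT.nsq (TT.diff (U_op D \<pi> \<eta>) (U_op D \<pi> \<theta>) p) = TT.nsq (TT.diff \<eta> \<theta> (permute p \<pi>))"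
    if p: "p \<in> conf M" for p
  proof -
    obtain e where e: "e \<in> C" "prtt D e = p" using conf_lift[OF p] by blast
    have eb: "act D e b \<in> C" "prtt D (act D e b) = permute p \<pi>" using e b by (simp_all add: act_closed prtt_act)
    show ?thesis
      using TT.nsq_diff[OF e(1) U_fibre[OF sec(1) e(1) \<pi>] U_fibre[OF sec(2) e(1) \<pi>]]
        TT.nsq_diff[OF eb(1) ttsectionD[OF sec(1) eb(1)] ttsectionD[OF sec(2) eb(1)]]
        U_coord[OF sec(1) e(1) b(1)] U_coord[OF sec(2) e(1) b(1)] b e eb(2)
      by (simp add: linear_diff[OF linear_rep[OF b(1)], symmetric] norm_rep)
  qed
  then have "dist_sq TT.B (U_op D \<pi> \<eta>) (U_op D \<pi> \<theta>) = (LINT p|conf_measure M. TT.nsq (TT.diff \<eta> \<theta> (permute p \<pi>)))"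
    unfolding TT.dist_sq_diff by (intro Bochner_Integration.integral_cong refl) (simp add: space_conf_measure)
  also have "\<dots> = dist_sq TT.B \<eta> \<theta>"
    unfolding TT.dist_sq_diff
    by (rule integral_permute[OF ok \<pi> TT.sqint_borel_measurable[OF TT.diff_sqint[OF \<eta> \<theta>]]])
  finally show ?thesis .
qed

lemma P_sqint: "\<eta> \<in> TT.sqint \<Longrightarrow> P_op D \<eta> \<in> TT.sqint"
  using TT.sqint_lincomb[OF finite_perms _ P_lincomb[OF ttsection_sqint]] U_sqint by blast

text \<open>An average of isometries: the Cauchy-Schwarz constant n!, the n! summands and the
  squared weight 1/(n!)^2 multiply to exactly 1.\<close>

lemma dist_P:
  assumes \<eta>: "\<eta> \<in> TT.sqint" and \<theta>: "\<theta> \<in> TT.sqint"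
  shows "dist_sq TT.B (P_op D \<eta>) (P_op D \<theta>) \<le> dist_sq TT.B \<eta> \<theta>"
proof -
  have "dist_sq TT.B (P_op D \<eta>) (P_op D \<theta>) \<le> real (card (perms :: ('n \<Rightarrow> 'n) set)) *
      (\<Sum>\<pi>\<in>perms. (cmod (1 / fact CARD('n)))\<^sup>2 * dist_sq TT.B (U_op D \<pi> \<eta>) (U_op D \<pi> \<theta>))"
    by (rule TT.dist_sq_lincomb[OF finite_perms _ _ P_lincomb P_lincomb])
      (use \<eta> \<theta> U_sqint ttsection_sqint in auto)
  also have "(\<Sum>\<pi>\<in>perms. (cmod (1 / fact CARD('n)))\<^sup>2 * dist_sq TT.B (U_op D \<pi> \<eta>) (U_op D \<pi> \<theta>)) =
      (\<Sum>\<pi>\<in>(perms :: ('n \<Rightarrow> 'n) set). (1 / fact CARD('n))\<^sup>2 * dist_sq TT.B \<eta> \<theta>)"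
    by (intro sum.cong refl) (simp add: dist_U[OF \<eta> \<theta>] norm_divide)
  finally show ?thesis
    unfolding sum_constant card_perms by (simp add: power2_eq_square)
qed

lemma P_smooth:
  assumes "\<eta> \<in> smooth_sections TT.B"
  shows "P_op D \<eta> \<in> smooth_sections TT.B"
proof -
  have \<eta>: "\<eta> \<in> TT.LS (smooth_on_conf M)" using assms by (simp add: TT.smooth_sections_B)
  show ?thesis
    unfolding TT.smooth_sections_B
    by (rule TT.LS_lincomb[OF TT.smooth finite_perms U_LS[OF compatible_smooth[OF ok] \<eta>]
          P_lincomb[OF ttsection_LS[OF \<eta>]], unfolded space_conf_measure, folded space_conf_measure])
qed

section \<open>The invariant subspace as range and as almost everywhere fixed points\<close>

definition Sinv :: "('a^'n \<Rightarrow> ('e, 'k) orbit) set" where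
  "Sinv = {\<eta>\<in>smooth_sections TT.B \<inter> TT.sqint. invariant \<eta>}"

lemma L2_inv: "L2_inv D = L2_closure TT.B Sinv"
  by (simp add: L2_inv_def Sinv_def invariant_def bundle_tt)

lemma L2_inv_subset: "L2_inv D \<subseteq> L2 TT.B"
  unfolding L2_inv L2_def L2_closure_def Sinv_def by blast

lemma P_Sinv: "\<eta> \<in> smooth_sections TT.B \<inter> TT.sqint \<Longrightarrow> P_op D \<eta> \<in> Sinv"
  by (simp add: Sinv_def P_smooth P_sqint P_invariant ttsection_sqint)

lemma AE_conf_I: "(\<And>p. p \<in> conf M \<Longrightarrow> Q p) \<Longrightarrow> AE p in (conf_measure M :: ('a^'n) measure). Q p"
  by (rule AE_I2) (simp add: space_conf_measure)

lemma U_cong: "\<eta> (permute p \<pi>) = \<theta> (permute p \<pi>) \<Longrightarrow> U_op D \<pi> \<eta> p = U_op D \<pi> \<theta> p"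
  by (simp add: U_op_def)

lemma P_cong: "(\<And>\<pi>. \<pi> \<in> perms \<Longrightarrow> \<eta> (permute p \<pi>) = \<theta> (permute p \<pi>)) \<Longrightarrow> P_op D \<eta> p = P_op D \<theta> p"
  using U_cong[of \<eta> p _ \<theta>] by (simp add: P_op_def cong: ball_cong)

text \<open>The average at \<open>p\<close> sees all rearrangements of \<open>p\<close>; the
  finitely many permuted copies of a null set are null by invariance of the measure.\<close>

lemma P_AE_cong:
  assumes "AE p in conf_measure M. \<eta> p = \<theta> p"
  shows "AE p in conf_measure M. P_op D \<eta> p = P_op D \<theta> p"
proof -
  have "AE p in conf_measure M. \<forall>\<pi>\<in>perms. \<eta> (permute p \<pi>) = \<theta> (permute p \<pi>)"
    using AE_permute[OF ok _ assms] by (intro AE_finite_allI finite_perms)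
  then show ?thesis by (rule AE_mp) (auto intro!: AE_I2 P_cong)
qed

lemma P_L2_class:
  assumes "\<eta> \<in> TT.sqint"
  shows "P_L2 D (ae_class TT.B \<eta>) = ae_class TT.B (P_op D \<eta>)"
proof -
  have "ae_class TT.B (P_op D \<theta>) = ae_class TT.B (P_op D \<eta>)" if "\<theta> \<in> ae_class TT.B \<eta>" for \<theta>
    by (rule TT.ae_class_cong[OF P_AE_cong[OF TT.ae_classD(2)[OF that]]])
  then have "P_L2 D (ae_class TT.B \<eta>) = (\<Union>\<theta>\<in>ae_class TT.B \<eta>. ae_class TT.B (P_op D \<eta>))"
    unfolding P_L2_def induced_def bundle_tt by (intro SUP_cong refl) auto
  then show ?thesis using TT.ae_class_self[OF assms] by auto
qed

lemma Sinv_fixed: "\<sigma> \<in> Sinv \<Longrightarrow> p \<in> conf M \<Longrightarrow> P_op D \<sigma> p = \<sigma> p"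
  by (rule P_fixes) (auto simp: Sinv_def invariant_def intro: ttsection_sqint)

text \<open>The closure only yields some limit \<open>\<eta>\<close> of invariant sections.
  \<open>P_op\<close> fixes these and does not increase distances, so \<open>P_op D \<eta>\<close>
  is a limit of the same sequence. It equals \<open>\<eta>\<close> almost everywhere and is a
  representative invariant at every configuration.\<close>

lemma L2_invE:
  assumes "Y \<in> L2_inv D"
  obtains \<eta> \<sigma> where "\<eta> \<in> TT.sqint" "invariant \<eta>" "Y = ae_class TT.B \<eta>" "\<And>k::nat. \<sigma> k \<in> Sinv"
    "(\<lambda>k. dist_sq TT.B (\<sigma> k) \<eta>) \<longlonglongrightarrow> 0"
proof -
  obtain \<eta> \<sigma> where 1: "\<eta> \<in> TT.sqint" "Y = ae_class TT.B \<eta>" "\<And>k::nat. \<sigma> k \<in> Sinv"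
    "(\<lambda>k. dist_sq TT.B (\<sigma> k) \<eta>) \<longlonglongrightarrow> 0"
    using TT.L2_closureE[OF assms[unfolded L2_inv]] by metis
  have s: "\<sigma> k \<in> TT.sqint" for k using 1(3) by (simp add: Sinv_def)
  have "dist_sq TT.B (\<sigma> k) (P_op D \<eta>) = dist_sq TT.B (P_op D (\<sigma> k)) (P_op D \<eta>)" for k
    by (rule TT.dist_sq_cong) (simp_all add: space_conf_measure Sinv_fixed[OF 1(3)])
  then have le: "dist_sq TT.B (\<sigma> k) (P_op D \<eta>) \<le> dist_sq TT.B (\<sigma> k) \<eta>" for k
    using dist_P[OF s 1(1)] by simp
  have lim: "(\<lambda>k. dist_sq TT.B (\<sigma> k) (P_op D \<eta>)) \<longlonglongrightarrow> 0"
    by (rule tendsto_zero_squeeze[OF TT.dist_sq_nonneg[OF s P_sqint[OF 1(1)]] le 1(4)])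
  have "AE p in conf_measure M. \<eta> p = P_op D \<eta> p"
    by (rule TT.dist_sq_limit_unique[OF s 1(1) P_sqint[OF 1(1)] 1(4) lim])
  then have "Y = ae_class TT.B (P_op D \<eta>)" using 1(2) TT.ae_class_cong by simp
  then show ?thesis
    using that P_sqint[OF 1(1)] P_invariant[OF ttsection_sqint[OF 1(1)]] 1(3) lim by blast
qed

lemma P_invariant_eq:
  assumes "\<eta> \<in> TT.sqint" "invariant \<eta>" "p \<in> conf M"
  shows "P_op D \<eta> p = \<eta> p"
  by (rule P_fixes[OF ttsection_sqint[OF assms(1)] assms(3)]) (use assms in \<open>auto simp: invariant_def\<close>)

text \<open>Averaging turns smooth approximants into smooth invariant ones and, being a contraction,
  keeps them convergent.\<close>

lemma P_L2_in:
  assumes "Y \<in> L2 TT.B"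
  shows "P_L2 D Y \<in> L2_inv D"
proof -
  obtain \<eta> \<sigma> where 1: "\<eta> \<in> TT.sqint" "Y = ae_class TT.B \<eta>"
    "\<And>k::nat. \<sigma> k \<in> smooth_sections TT.B \<inter> TT.sqint" "(\<lambda>k. dist_sq TT.B (\<sigma> k) \<eta>) \<longlonglongrightarrow> 0"
    using TT.L2_closureE[OF assms[unfolded L2_def]] by metis
  have s: "\<sigma> k \<in> TT.sqint" for k using 1(3) by blast
  have "(\<lambda>k. dist_sq TT.B (P_op D (\<sigma> k)) (P_op D \<eta>)) \<longlonglongrightarrow> 0"
    by (rule tendsto_zero_squeeze[OF TT.dist_sq_nonneg[OF P_sqint[OF s] P_sqint[OF 1(1)]] dist_P[OF s 1(1)] 1(4)])
  then show ?thesis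
    unfolding L2_inv 1(2) P_L2_class[OF 1(1)]
    by (rule TT.L2_closureI[OF P_sqint[OF 1(1)] P_Sinv[OF 1(3)]])
qed

text \<open>For the harder inclusion, an invariant class is its own preimage: the average fixes its
  everywhere invariant representative.\<close>

lemma range_P: "L2_inv D = P_L2 D ` L2 TT.B"
proof
  show "P_L2 D ` L2 TT.B \<subseteq> L2_inv D" using P_L2_in by blast
  show "L2_inv D \<subseteq> P_L2 D ` L2 TT.B"
  proof
    fix Y assume Y: "Y \<in> L2_inv D"
    then obtain \<eta> where 1: "\<eta> \<in> TT.sqint" "invariant \<eta>" "Y = ae_class TT.B \<eta>" by (metis L2_invE)
    have "P_L2 D Y = Y"
      unfolding 1(3) P_L2_class[OF 1(1)]
      by (rule TT.ae_class_cong[OF AE_conf_I]) (rule P_invariant_eq[OF 1(1,2)])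
    then show "Y \<in> P_L2 D ` L2 TT.B"
      using subsetD[OF L2_inv_subset Y] image_eqI[of Y "P_L2 D" Y] by simp
  qed
qed

text \<open>One way, any member of the class differs from an everywhere invariant one on a null set,
  and the permuted null set is also null. The other way, one exceptional set serves for the finitely
  many permutations, so the average fixes the class, which then lies in the range just
  identified.\<close>

lemma L2_inv_ae: "L2_inv D = {Y\<in>L2 TT.B. \<forall>\<eta>\<in>Y. ae_invariant D \<eta>}"
proof (intro Set.set_eqI iffI CollectI conjI ballI)
  fix Y assume Y: "Y \<in> L2_inv D"
  then show "Y \<in> L2 TT.B" using L2_inv_subset by blast
  obtain \<eta> where 1: "\<eta> \<in> TT.sqint" "invariant \<eta>" "Y = ae_class TT.B \<eta>" using Y by (metis L2_invE)
  fix \<theta> assume "\<theta> \<in> Y"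
  then have ae: "AE p in conf_measure M. \<theta> p = \<eta> p" using TT.ae_classD(2) 1(3) by simp
  show "ae_invariant D \<theta>"
    unfolding ae_invariant_def
  proof
    fix \<pi> :: "'n \<Rightarrow> 'n" assume \<pi>: "\<pi> \<in> perms"
    show "AE p in conf_measure M. \<theta> p = U_op D \<pi> \<theta> p"
      using ae AE_permute[OF ok \<pi> ae] AE_space[of "conf_measure M"]
    proof eventually_elim
      case (elim p)
      then have p: "p \<in> conf M" by (simp add: space_conf_measure)
      have "U_op D \<pi> \<theta> p = U_op D \<pi> \<eta> p" using elim(2) by (rule U_cong)
      also have "\<dots> = \<eta> p" using 1(2) \<pi> p by (simp add: invariant_def)
      finally show ?case using elim(1) by simp
    qed
  qed
next
  fix Y assume "Y \<in> {Y\<in>L2 TT.B. \<forall>\<eta>\<in>Y. ae_invariant D \<eta>}"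
  then have Y: "Y \<in> L2 TT.B" "\<And>\<eta>. \<eta> \<in> Y \<Longrightarrow> ae_invariant D \<eta>" by auto
  obtain \<eta> where 1: "\<eta> \<in> TT.sqint" "Y = ae_class TT.B \<eta>"
    using TT.L2_closureE[OF Y(1)[unfolded L2_def]] by metis
  have "ae_invariant D \<eta>" using Y(2) TT.ae_class_self[OF 1(1)] 1(2) by blast
  then have "AE p in conf_measure M. \<forall>\<pi>\<in>perms. \<eta> p = U_op D \<pi> \<eta> p"
    unfolding ae_invariant_def by (intro AE_finite_allI finite_perms) auto
  then have "AE p in conf_measure M. P_op D \<eta> p = \<eta> p"
    using AE_space[of "conf_measure M"]
  proof eventually_elim
    case (elim p)
    then show ?case
      by (intro P_fixes ttsection_sqint 1) (auto simp: space_conf_measure)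
  qed
  then have "P_L2 D Y = Y"
    unfolding 1(2) P_L2_class[OF 1(1)] by (rule TT.ae_class_cong)
  then show "Y \<in> L2_inv D" using P_L2_in[OF Y(1)] by simp
qed

text \<open>Invariance is a linear condition on coordinates, because each \<open>rep D b\<close> is
  linear.\<close>

lemma Sinv_lincomb:
  assumes I: "finite I" and \<eta>: "\<And>i. i \<in> I \<Longrightarrow> \<eta> i \<in> Sinv" and l: "TT.lincomb I c \<eta> \<zeta>"
  shows "\<zeta> \<in> Sinv"
proof -
  have 1: "\<zeta> \<in> smooth_sections TT.B" "\<zeta> \<in> TT.sqint"
    using TT.smooth_lincomb[OF I _ l] TT.sqint_lincomb[OF I _ l] \<eta> by (auto simp: Sinv_def)
  have "invariant \<zeta>"
  proof (rule invariantI[OF ttsection_sqint[OF 1(2)]])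
    fix e b assume e: "e \<in> C" and b: "b \<in> carrier G"
    have eb: "act D e b \<in> C" using e b by (simp add: act_closed)
    show "TT.coord e (\<zeta> (prtt D e)) = rep D b (TT.coord (act D e b) (\<zeta> (prtt D (act D e b))))"
      unfolding TT.lincombD(2)[OF l e refl] TT.lincombD(2)[OF l eb refl] rep_sum[OF b] rep_scale[OF b]
    proof (intro sum.cong refl)
      fix i assume "i \<in> I"
      then have "ttsection (\<eta> i)" "invariant (\<eta> i)" using \<eta> ttsection_sqint by (auto simp: Sinv_def)
      then show "c i *s TT.coord e (\<eta> i (prtt D e)) =
          c i *s rep D b (TT.coord (act D e b) (\<eta> i (prtt D (act D e b))))"
        using invariant_coord[of "\<eta> i" e b] e b by simp
    qed
  qed
  with 1 show ?thesis by (simp add: Sinv_def)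
qed

lemma Sinv_sqint: "Sinv \<subseteq> TT.sqint"
  by (auto simp: Sinv_def)

lemma linear_subspace_L2_inv: "linear_subspace TT.B (L2_inv D)"
  unfolding linear_subspace_def
proof (intro conjI ballI allI)
  show "L2_inv D \<subseteq> L2 TT.B" by (rule L2_inv_subset)
  obtain \<zeta> where z: "TT.lincomb {} (\<lambda>_::unit. 0) (\<lambda>_. \<zeta>) \<zeta>" by (rule TT.zero_section)
  then have "\<zeta> \<in> Sinv" by (rule Sinv_lincomb[rotated 2]) auto
  then have "ae_class TT.B \<zeta> \<in> L2_inv D"
    unfolding L2_inv using Sinv_sqint TT.dist_sq_self
    by (intro TT.L2_closureI[of _ "\<lambda>_. \<zeta>"]) auto
  then show "L2_inv D \<noteq> {}" by blast
next
  fix Y Z assume "Y \<in> L2_inv D" "Z \<in> L2_inv D"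
  then show "L2_add TT.B Y Z \<in> L2_inv D"
    unfolding L2_inv
  proof (intro TT.L2_closure_add[OF Sinv_sqint])
    fix \<eta> \<theta> assume *: "\<eta> \<in> Sinv" "\<theta> \<in> Sinv"
    then have "\<eta> \<in> TT.sqint" "\<theta> \<in> TT.sqint" using Sinv_sqint by auto
    from Sinv_lincomb[OF _ _ TT.lincomb_add[OF TT.sqint_fibre[OF this(1)] TT.sqint_fibre[OF this(2)]]]
    show "(\<lambda>x. fadd TT.B (\<eta> x) (\<theta> x)) \<in> Sinv" using * by simp
  qed
next
  fix c Y assume "Y \<in> L2_inv D"
  then show "L2_scale TT.B c Y \<in> L2_inv D"
    unfolding L2_inv
  proof (intro TT.L2_closure_scale[OF Sinv_sqint])
    fix \<eta> assume *: "\<eta> \<in> Sinv"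
    then have "\<eta> \<in> TT.sqint" using Sinv_sqint by auto
    from Sinv_lincomb[OF _ _ TT.lincomb_scale[OF TT.sqint_fibre[OF this]]]
    show "(\<lambda>x. fscale TT.B c (\<eta> x)) \<in> Sinv" using * by simp
  qed
qed

section \<open>The induced map on classes and its inverse\<close>

definition Jmap :: "(('a, 'n) sym_power \<Rightarrow> ('e, 'k) orbit) set \<Rightarrow> ('a^'n \<Rightarrow> ('e, 'k) orbit) set" where
  "Jmap Y = L2_scale (bundle_tt D) (sqrt (fact CARD('n))) (pullback_L2 D Y)"

lemma Jmap_class:
  assumes \<xi>: "\<xi> \<in> T.sqint"
  shows "Jmap (ae_class T.B \<xi>) = ae_class TT.B (J \<xi>)"
proof -
  let ?K = "\<lambda>\<xi> p. fscale TT.B (1 / fact CARD('n)) (Pr_pullback D \<xi> p)"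
  have "ae_class TT.B (?K \<zeta>) = ae_class TT.B (?K \<xi>)" if "\<zeta> \<in> ae_class T.B \<xi>" for \<zeta>
  proof (rule TT.ae_class_cong)
    show "AE p in conf_measure M. ?K \<zeta> p = ?K \<xi> p"
      using AE_nconf[OF T.ae_classD(2)[OF that]] by (rule AE_mp) (auto simp: Pr_pullback_def)
  qed
  then have "pullback_L2 D (ae_class T.B \<xi>) = (\<Union>\<zeta>\<in>ae_class T.B \<xi>. ae_class TT.B (?K \<xi>))"
    unfolding pullback_L2_def induced_def bundle_tt by (intro SUP_cong refl) auto
  then have 1: "pullback_L2 D (ae_class T.B \<xi>) = ae_class TT.B (?K \<xi>)"
    using T.ae_class_self[OF \<xi>] by auto
  \<comment> \<open>\<open>L2_scale_class\<close> asks for square integrability of the section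
    before rescaling. It is recovered from \<open>J \<xi>\<close> by undoing the factor
    sqrt(n!).\<close>
  let ?r = "1 / complex_of_real (sqrt (fact CARD('n)))"
  note sec = tsection_sqint[OF \<xi>]
  have "TT.lincomb (UNIV::unit set) (\<lambda>_. ?r) (\<lambda>_. J \<xi>) (?K \<xi>)"
    unfolding TT.lincomb_def
    using pullback_fibre[OF sec] pullback_coord[OF sec]
    by (auto simp: J_coord[OF sec] kappa_def TT.fscale_fibre TT.coord_fscale vector_smult_assoc)
  then have "?K \<xi> \<in> TT.sqint" by (rule TT.sqint_lincomb[rotated 2]) (use J_sqint[OF \<xi>] in auto)
  then show ?thesis
    unfolding Jmap_def 1 bundle_tt by (subst TT.L2_scale_class) (simp_all add: J_def[abs_def])
qed

lemma L2_tE: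
  assumes "Y \<in> L2 T.B"
  obtains \<xi> \<sigma> where "\<xi> \<in> T.sqint" "Y = ae_class T.B \<xi>" "\<And>k::nat. \<sigma> k \<in> smooth_sections T.B \<inter> T.sqint"
    "(\<lambda>k. dist_sq T.B (\<sigma> k) \<xi>) \<longlonglongrightarrow> 0"
  using T.L2_closureE[OF assms[unfolded L2_def]] by metis

lemma J_Sinv:
  assumes "\<sigma> \<in> smooth_sections T.B \<inter> T.sqint"
  shows "J \<sigma> \<in> Sinv"
proof -
  have "\<sigma> \<in> T.LS (smooth_on_nconf M)" using assms by (simp add: T.smooth_sections_B)
  then have "J \<sigma> \<in> smooth_sections TT.B"
    unfolding TT.smooth_sections_B by (rule J_LS[OF compatible_smooth[OF ok]])
  then show ?thesis using assms by (simp add: Sinv_def J_sqint J_invariant tsection_sqint)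
qed

text \<open>\<open>J\<close> multiplies coordinates by \<open>kappa CARD('n)\<close>, so its inverse
  on invariant sections divides by this constant after descending.\<close>

definition Jinv :: "('a^'n \<Rightarrow> ('e, 'k) orbit) \<Rightarrow> ('a, 'n) sym_power \<Rightarrow> ('e, 'k) orbit" where
  "Jinv \<eta> x = fscale T.B (1 / kappa CARD('n)) (descend \<eta> x)"

lemma Jinv_lincomb:
  assumes "ttsection \<eta>" "invariant \<eta>"
  shows "T.lincomb (UNIV::unit set) (\<lambda>_. 1 / kappa CARD('n)) (\<lambda>_. descend \<eta>) (Jinv \<eta>)"
  unfolding T.lincomb_def using assms
  by (auto simp: Jinv_def T.fscale_fibre T.coord_fscale descend_fibre)

lemma Jinv_LS:
  assumes c: "compatible M reg regT" and \<eta>: "\<eta> \<in> TT.LS reg" "invariant \<eta>"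
  shows "Jinv \<eta> \<in> T.LS regT"
  by (rule T.LS_lincomb[OF compatible_regularity(2)[OF c] _ descend_LS[OF c \<eta>]
        Jinv_lincomb[OF ttsection_LS[OF \<eta>(1)] \<eta>(2)]]) simp

lemma Jinv_section: "ttsection \<eta> \<Longrightarrow> invariant \<eta> \<Longrightarrow> tsection (Jinv \<eta>)"
  unfolding tsection_def covering_space_imp_surjective[OF cov_t, symmetric]
  using T.lincombD(1)[OF Jinv_lincomb] by blast

lemma J_Jinv:
  assumes \<eta>: "ttsection \<eta>" "invariant \<eta>" and p: "p \<in> conf M"
  shows "J (Jinv \<eta>) p = \<eta> p"
proof -
  obtain e where e: "e \<in> C" "prtt D e = p" using conf_lift[OF p] by blast
  note sec = Jinv_section[OF \<eta>]
  have "TT.coord e (J (Jinv \<eta>) (prtt D e)) = TT.coord e (\<eta> (prtt D e))"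
    unfolding J_coord[OF sec e(1)] T.lincombD(2)[OF Jinv_lincomb[OF \<eta>] e(1) refl]
    by (simp add: vector_smult_assoc kappa_nonzero descend_coord[OF \<eta> e(1)])
  then have "J (Jinv \<eta>) (prtt D e) = \<eta> (prtt D e)"
    by (rule TT.fibre_eqI[OF e(1) J_fibre[OF sec e(1)] ttsectionD[OF \<eta>(1) e(1)]])
  then show ?thesis using e(2) by simp
qed

text \<open>\<open>J\<close> recovers \<open>\<eta>\<close> from \<open>Jinv \<eta>\<close>, so the
  pointwise norm identity of \<open>J\<close>, read backwards, costs only a factor n!.\<close>

lemma Jinv_sqint:
  assumes \<eta>: "\<eta> \<in> TT.sqint" "invariant \<eta>"
  shows "Jinv \<eta> \<in> T.sqint"
proof -
  note sec = ttsection_sqint[OF \<eta>(1)]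
  have LS: "Jinv \<eta> \<in> T.LS borel_reg"
    using Jinv_LS[OF compatible_borel _ \<eta>(2)] \<eta>(1) TT.sqint_iff by blast
  have "T.nsq (Jinv \<eta> (pr p)) = fact CARD('n) * TT.nsq (\<eta> p)" if p: "p \<in> conf M" for p
    using nsq_J[OF Jinv_section[OF sec \<eta>(2)] p] J_Jinv[OF sec \<eta>(2) p] by simp
  then have "integrable (conf_measure M) (\<lambda>p. T.nsq (Jinv \<eta> (pr p))) \<longleftrightarrow>
      integrable (conf_measure M) (\<lambda>p. fact CARD('n) * TT.nsq (\<eta> p))"
    by (intro Bochner_Integration.integrable_cong refl) (simp add: space_conf_measure)
  also have "integrable (conf_measure M) (\<lambda>p. fact CARD('n) * TT.nsq (\<eta> p))"
    by (intro integrable_mult_right TT.sqint_integrable[OF \<eta>(1)])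
  finally show ?thesis
    unfolding T.sqint_iff using LS integrable_nconf[OF T.borel_measurable_nsq[OF LS]] by simp
qed

lemma Jinv_smooth:
  assumes "\<sigma> \<in> Sinv"
  shows "Jinv \<sigma> \<in> smooth_sections T.B \<inter> T.sqint"
  using Jinv_LS[OF compatible_smooth[OF ok]] Jinv_sqint assms
  by (auto simp: Sinv_def T.smooth_sections_B TT.smooth_sections_B)

text \<open>Injectivity is the isometry property. For surjectivity \<open>Jinv\<close> has to carry
  down the representative together with its smooth approximants, so both must be invariant at every
  configuration, as \<open>L2_invE\<close> provides; distances are preserved because
  \<open>J\<close> undoes \<open>Jinv\<close>.\<close>

lemma bij_Jmap: "bij_betw Jmap (L2 T.B) (L2_inv D)"
  unfolding bij_betw_def
proof
  show "inj_on Jmap (L2 T.B)"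
  proof (rule inj_onI)
    fix Y Z assume Y: "Y \<in> L2 T.B" and Z: "Z \<in> L2 T.B" and eq: "Jmap Y = Jmap Z"
    obtain \<xi> where \<xi>: "\<xi> \<in> T.sqint" "Y = ae_class T.B \<xi>" using L2_tE[OF Y] by metis
    obtain \<zeta> where \<zeta>: "\<zeta> \<in> T.sqint" "Z = ae_class T.B \<zeta>" using L2_tE[OF Z] by metis
    have "AE p in conf_measure M. J \<xi> p = J \<zeta> p"
      using eq J_sqint[OF \<xi>(1)] TT.ae_class_eqD unfolding \<xi>(2) \<zeta>(2) Jmap_class[OF \<xi>(1)] Jmap_class[OF \<zeta>(1)]
      by blast
    then have "dist_sq TT.B (J \<xi>) (J \<zeta>) = dist_sq TT.B (J \<xi>) (J \<xi>)"
      using J_sqint \<xi>(1) \<zeta>(1) by (intro TT.dist_sq_cong_AE[symmetric]) auto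
    then have "dist_sq T.B \<xi> \<zeta> = 0"
      using dist_J \<xi>(1) \<zeta>(1) T.dist_sq_self by simp
    then have "AE x in nconf_measure M. \<xi> x = \<zeta> x"
      by (rule T.AE_eq_of_dist_sq_zero[OF \<xi>(1) \<zeta>(1)])
    then show "Y = Z" unfolding \<xi>(2) \<zeta>(2) by (rule T.ae_class_cong)
  qed
  show "Jmap ` L2 T.B = L2_inv D"
  proof (intro equalityI subsetI)
    fix Z assume "Z \<in> Jmap ` L2 T.B"
    then obtain Y where Y: "Y \<in> L2 T.B" "Z = Jmap Y" by blast
    obtain \<xi> \<sigma> where \<xi>: "\<xi> \<in> T.sqint" "Y = ae_class T.B \<xi>"
      "\<And>k::nat. \<sigma> k \<in> smooth_sections T.B \<inter> T.sqint" "(\<lambda>k. dist_sq T.B (\<sigma> k) \<xi>) \<longlonglongrightarrow> 0"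
      using L2_tE[OF Y(1)] by metis
    have "(\<lambda>k. dist_sq TT.B (J (\<sigma> k)) (J \<xi>)) \<longlonglongrightarrow> 0"
      using \<xi>(3,4) dist_J[OF _ \<xi>(1)] by simp
    then show "Z \<in> L2_inv D"
      unfolding Y(2) \<xi>(2) Jmap_class[OF \<xi>(1)] L2_inv
      by (rule TT.L2_closureI[OF J_sqint[OF \<xi>(1)] J_Sinv[OF \<xi>(3)]])
  next
    fix Z assume "Z \<in> L2_inv D"
    then obtain \<eta> \<sigma> where \<eta>: "\<eta> \<in> TT.sqint" "invariant \<eta>" "Z = ae_class TT.B \<eta>"
      "\<And>k::nat. \<sigma> k \<in> Sinv" "(\<lambda>k. dist_sq TT.B (\<sigma> k) \<eta>) \<longlonglongrightarrow> 0"
      using L2_invE by metis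
    note sec = ttsection_sqint[OF \<eta>(1)]
    have s: "\<sigma> k \<in> TT.sqint" "invariant (\<sigma> k)" for k using \<eta>(4) by (auto simp: Sinv_def)
    have "dist_sq T.B (Jinv (\<sigma> k)) (Jinv \<eta>) = dist_sq TT.B (\<sigma> k) \<eta>" for k
    proof -
      have "dist_sq T.B (Jinv (\<sigma> k)) (Jinv \<eta>) = dist_sq TT.B (J (Jinv (\<sigma> k))) (J (Jinv \<eta>))"
        by (rule dist_J[symmetric]) (use s \<eta> Jinv_sqint in auto)
      also have "\<dots> = dist_sq TT.B (\<sigma> k) \<eta>"
        by (rule TT.dist_sq_cong)
          (simp_all add: space_conf_measure J_Jinv[OF sec \<eta>(2)] J_Jinv[OF ttsection_sqint[OF s(1)] s(2)])
      finally show ?thesis .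
    qed
    then have "(\<lambda>k. dist_sq T.B (Jinv (\<sigma> k)) (Jinv \<eta>)) \<longlonglongrightarrow> 0" using \<eta>(5) by simp
    then have "ae_class T.B (Jinv \<eta>) \<in> L2 T.B"
      unfolding L2_def by (rule T.L2_closureI[OF Jinv_sqint[OF \<eta>(1,2)] Jinv_smooth[OF \<eta>(4)]])
    moreover have "Jmap (ae_class T.B (Jinv \<eta>)) = Z"
      unfolding Jmap_class[OF Jinv_sqint[OF \<eta>(1,2)]] \<eta>(3)
      by (rule TT.ae_class_cong[OF AE_conf_I]) (rule J_Jinv[OF sec \<eta>(2)])
    ultimately show "Z \<in> Jmap ` L2 T.B" by blast
  qed
qed

lemma J_fadd:
  assumes \<xi>: "tsection \<xi>" and \<zeta>: "tsection \<zeta>" and s: "tsection (\<lambda>x. fadd T.B (\<xi> x) (\<zeta> x))" and p: "p \<in> conf M"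
  shows "J (\<lambda>x. fadd T.B (\<xi> x) (\<zeta> x)) p = fadd TT.B (J \<xi> p) (J \<zeta> p)"
proof -
  obtain e where e: "e \<in> C" "prtt D e = p" using conf_lift[OF p] by blast
  have "J (\<lambda>x. fadd T.B (\<xi> x) (\<zeta> x)) (prtt D e) = fadd TT.B (J \<xi> (prtt D e)) (J \<zeta> (prtt D e))"
  proof (rule TT.fibre_eqI[OF e(1) J_fibre[OF s e(1)]])
    show "fadd TT.B (J \<xi> (prtt D e)) (J \<zeta> (prtt D e)) \<in> TT.fibre (prtt D e)"
      by (rule TT.fadd_fibre[OF e(1) J_fibre[OF \<xi> e(1)] J_fibre[OF \<zeta> e(1)]])
    show "TT.coord e (J (\<lambda>x. fadd T.B (\<xi> x) (\<zeta> x)) (prtt D e)) =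
        TT.coord e (fadd TT.B (J \<xi> (prtt D e)) (J \<zeta> (prtt D e)))"
      unfolding TT.coord_fadd[OF e(1) J_fibre[OF \<xi> e(1)] J_fibre[OF \<zeta> e(1)]] J_coord[OF s e(1)]
        J_coord[OF \<xi> e(1)] J_coord[OF \<zeta> e(1)] T.coord_fadd[OF e(1) tsectionD[OF \<xi> e(1)] tsectionD[OF \<zeta> e(1)]]
      by (simp add: vector_add_ldistrib)
  qed
  then show ?thesis using e(2) by simp
qed

lemma J_fscale:
  assumes \<xi>: "tsection \<xi>" and s: "tsection (\<lambda>x. fscale T.B c (\<xi> x))" and p: "p \<in> conf M"
  shows "J (\<lambda>x. fscale T.B c (\<xi> x)) p = fscale TT.B c (J \<xi> p)"
proof -
  obtain e where e: "e \<in> C" "prtt D e = p" using conf_lift[OF p] by blast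
  have "J (\<lambda>x. fscale T.B c (\<xi> x)) (prtt D e) = fscale TT.B c (J \<xi> (prtt D e))"
  proof (rule TT.fibre_eqI[OF e(1) J_fibre[OF s e(1)] TT.fscale_fibre[OF e(1) J_fibre[OF \<xi> e(1)]]])
    show "TT.coord e (J (\<lambda>x. fscale T.B c (\<xi> x)) (prtt D e)) = TT.coord e (fscale TT.B c (J \<xi> (prtt D e)))"
      unfolding TT.coord_fscale[OF e(1) J_fibre[OF \<xi> e(1)]] J_coord[OF s e(1)]
        J_coord[OF \<xi> e(1)] T.coord_fscale[OF e(1) tsectionD[OF \<xi> e(1)]]
      by (simp add: vector_smult_assoc mult.commute)
  qed
  then show ?thesis using e(2) by simp
qed

lemma fadd_sqint: "\<xi> \<in> T.sqint \<Longrightarrow> \<zeta> \<in> T.sqint \<Longrightarrow> (\<lambda>x. fadd T.B (\<xi> x) (\<zeta> x)) \<in> T.sqint"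
  by (rule T.sqint_lincomb[OF _ _ T.lincomb_add[OF T.sqint_fibre T.sqint_fibre]]) simp_all

lemma fscale_sqint: "\<xi> \<in> T.sqint \<Longrightarrow> (\<lambda>x. fscale T.B c (\<xi> x)) \<in> T.sqint"
  by (rule T.sqint_lincomb[OF _ _ T.lincomb_scale[OF T.sqint_fibre]]) simp_all

lemma unitary_Jmap: "unitary_onto T.B TT.B (L2_inv D) Jmap"
  unfolding unitary_onto_def
proof (intro conjI ballI allI)
  show "bij_betw Jmap (L2 T.B) (L2_inv D)" by (rule bij_Jmap)
next
  fix Y Z assume Y: "Y \<in> L2 T.B" and Z: "Z \<in> L2 T.B"
  obtain \<xi> where \<xi>: "\<xi> \<in> T.sqint" "Y = ae_class T.B \<xi>" using L2_tE[OF Y] by metis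
  obtain \<zeta> where \<zeta>: "\<zeta> \<in> T.sqint" "Z = ae_class T.B \<zeta>" using L2_tE[OF Z] by metis
  note sq = fadd_sqint[OF \<xi>(1) \<zeta>(1)]
  show "Jmap (L2_add T.B Y Z) = L2_add TT.B (Jmap Y) (Jmap Z)"
    unfolding \<xi>(2) \<zeta>(2) T.L2_add_class[OF \<xi>(1) \<zeta>(1)] Jmap_class[OF \<xi>(1)] Jmap_class[OF \<zeta>(1)]
      Jmap_class[OF sq] TT.L2_add_class[OF J_sqint[OF \<xi>(1)] J_sqint[OF \<zeta>(1)]]
    by (rule TT.ae_class_cong[OF AE_conf_I])
      (rule J_fadd[OF tsection_sqint[OF \<xi>(1)] tsection_sqint[OF \<zeta>(1)] tsection_sqint[OF sq]])
  show "L2_inner TT.B (Jmap Y) (Jmap Z) = L2_inner T.B Y Z"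
    unfolding \<xi>(2) \<zeta>(2) Jmap_class[OF \<xi>(1)] Jmap_class[OF \<zeta>(1)] T.L2_inner_class[OF \<xi>(1) \<zeta>(1)]
      TT.L2_inner_class[OF J_sqint[OF \<xi>(1)] J_sqint[OF \<zeta>(1)]]
    by (rule integral_J[OF \<xi>(1) \<zeta>(1)])
next
  fix c Y assume Y: "Y \<in> L2 T.B"
  obtain \<xi> where \<xi>: "\<xi> \<in> T.sqint" "Y = ae_class T.B \<xi>" using L2_tE[OF Y] by metis
  note sq = fscale_sqint[OF \<xi>(1)]
  show "Jmap (L2_scale T.B c Y) = L2_scale TT.B c (Jmap Y)"
    unfolding \<xi>(2) T.L2_scale_class[OF \<xi>(1)] Jmap_class[OF \<xi>(1)]
      Jmap_class[OF sq] TT.L2_scale_class[OF J_sqint[OF \<xi>(1)]]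
    by (rule TT.ae_class_cong[OF AE_conf_I])
      (rule J_fscale[OF tsection_sqint[OF \<xi>(1)] tsection_sqint[OF sq]])
qed

lemma pullback_unitary_equivalence:
  "unitary_onto (bundle_t D) (bundle_tt D) (L2_inv D)
     (\<lambda>Y. L2_scale (bundle_tt D) (sqrt (fact CARD('n))) (pullback_L2 D Y))"
  "linear_subspace (bundle_tt D) (L2_inv D)"
  "L2_inv D = P_L2 D ` L2 (bundle_tt D)"
  "L2_inv D = {Y\<in>L2 (bundle_tt D). \<forall>\<eta>\<in>Y. ae_invariant D \<eta>}"
  using unitary_Jmap linear_subspace_L2_inv range_P L2_inv_ae
  unfolding Jmap_def[abs_def] bundle_t bundle_tt by simp_all

end

theorem mainTheorem1:
  fixes D :: "(real^2, 'n::finite, 'e::topological_space, 'k::finite) braid_data"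
    and D' :: "(real^3, 'n, 'e, 'k) braid_data"
    and m :: real
  shows
    "(braid_setup D \<and> mom D = plane \<longrightarrow>
        unitary_onto (bundle_t D) (bundle_tt D) (L2_inv D)
          (\<lambda>X. L2_scale (bundle_tt D) (sqrt (fact CARD('n))) (pullback_L2 D X)) \<and>
        linear_subspace (bundle_tt D) (L2_inv D) \<and>
        L2_inv D = P_L2 D ` L2 (bundle_tt D) \<and>
        L2_inv D = {X\<in>L2 (bundle_tt D). \<forall>\<eta>\<in>X. ae_invariant D \<eta>}) \<and>
     (braid_setup D' \<and> 0 < m \<and> mom D' = mass_shell m \<longrightarrow>
        unitary_onto (bundle_t D') (bundle_tt D') (L2_inv D')
          (\<lambda>X. L2_scale (bundle_tt D') (sqrt (fact CARD('n))) (pullback_L2 D' X)) \<and>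
        linear_subspace (bundle_tt D') (L2_inv D') \<and>
        L2_inv D' = P_L2 D' ` L2 (bundle_tt D') \<and>
        L2_inv D' = {X\<in>L2 (bundle_tt D'). \<forall>\<eta>\<in>X. ae_invariant D' \<eta>})"
proof (intro conjI impI; elim conjE)
  assume "braid_setup D" "mom D = plane"
  then interpret braid_model D
    by unfold_locales (simp_all add: momentum_ok_plane)
  show "unitary_onto (bundle_t D) (bundle_tt D) (L2_inv D)
      (\<lambda>X. L2_scale (bundle_tt D) (sqrt (fact CARD('n))) (pullback_L2 D X))"
    "linear_subspace (bundle_tt D) (L2_inv D)"
    "L2_inv D = P_L2 D ` L2 (bundle_tt D)"
    "L2_inv D = {X\<in>L2 (bundle_tt D). \<forall>\<eta>\<in>X. ae_invariant D \<eta>}"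
    by (fact pullback_unitary_equivalence)+
next
  assume "braid_setup D'" "0 < m" "mom D' = mass_shell m"
  then interpret braid_model D'
    by unfold_locales (simp_all add: momentum_ok_mass_shell)
  show "unitary_onto (bundle_t D') (bundle_tt D') (L2_inv D')
      (\<lambda>X. L2_scale (bundle_tt D') (sqrt (fact CARD('n))) (pullback_L2 D' X))"
    "linear_subspace (bundle_tt D') (L2_inv D')"
    "L2_inv D' = P_L2 D' ` L2 (bundle_tt D')"
    "L2_inv D' = {X\<in>L2 (bundle_tt D'). \<forall>\<eta>\<in>X. ae_invariant D' \<eta>}"
    by (fact pullback_unitary_equivalence)+
qed

end
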